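(* Let $G$ be a Lie group and let $F$ be a left-invariant cyclic Finsler metric on $G$ which has constant flag curvature $K\equiv 0$. Then the Lie algebra of $G$ is Abelian.
   Context: A Minkowski norm on a finite-dimensional real vector space $V$ is a continuous function $F:V\to[0,\infty)$, positive and smooth on $V\setminus\{0\}$, with $F(\lambda y)=\lambda F(y)$ for $\lambda\ge 0$, such that for every $y\neq0$ the fundamental tensor $$\langle u,v\rangle_y=\tfrac12\tfrac{\partial^2}{\partial s\partial t}\Big|_{s=t=0}F^2(y+su+tv)$$ is positive definite. A left-invariant Finsler metric $F$ on a Lie group $G$ with Lie algebra $\mathfrak g$ is determined by its restriction to $T_eG=\mathfrak g$, an arbitrary Minkowski norm on $\mathfrak g$. Such an $F$ is called cyclic (with respect to the reductive decomposition $\mathfrak g=0+\mathfrak g$) if $$\langle[x,y],z\rangle_y+\langle[y,z],x\rangle_y+\langle[z,x],y\rangle_y=0\quad\text{for all } y\in\mathfrak g\setminus\{0\},\ x,z\in\mathfrak g.$$ For a Finsler metric $F$ on a manifold $M$, in standard local coordinates $(x^i,y^i)$ on $TM$, let $g_{ij}=\tfrac12[F^2]_{y^iy^j}$, $(g^{ij})=(g_{ij})^{-1}$, and $G^i=\tfrac14g^{il}\big([F^2]_{x^ky^l}y^k-[F^2]_{x^l}\big)$. The Riemann curvature $R_y:T_xM\to T_xM$, $y\in T_xM\setminus\{0\}$, is $R_y=R^i_k\,\partial_{x^i}\otimes dx^k$ with $$R^i_k=2\tfrac{\partial G^i}{\partial x^k}-y^j\tfrac{\partial^2G^i}{\partial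 x^j\partial y^k}+2G^j\tfrac{\partial^2G^i}{\partial y^j\partial y^k}-\tfrac{\partial G^i}{\partial y^j}\tfrac{\partial G^j}{\partial y^k}.$$ The flag curvature is $K(x,y,y\wedge u)=\dfrac{\langle R_yu,u\rangle_y}{\langle y,y\rangle_y\langle u,u\rangle_y-\langle y,u\rangle_y^2}$ for linearly independent $y,u\in T_xM$. The condition $K\equiv0$ is equivalent to $R_y=0$ for all $y\neq 0$. *)

theory Defs
  imports "HOL-Analysis.Analysis" "HOL-Algebra.Group" "HOL-Library.Function_Algebras"
begin

section \<open>Smooth maps between open subsets of Euclidean spaces\<close>

text \<open>Meant for open \<open>S\<close>: \<open>Ck_on k S f\<close> says that \<open>f\<close> is \<open>k\<close> times continuously
  differentiable on \<open>S\<close>.\<close>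

fun Ck_on ::
  "nat \<Rightarrow> 'a::real_normed_vector set \<Rightarrow> ('a \<Rightarrow> 'b::real_normed_vector) \<Rightarrow> bool" where
  "Ck_on 0 S f \<longleftrightarrow> continuous_on S f"
| "Ck_on (Suc k) S f \<longleftrightarrow>
     (\<forall>x\<in>S. f differentiable (at x)) \<and> (\<forall>v. Ck_on k S (\<lambda>x. frechet_derivative f (at x) v))"

definition smooth_on ::
  "'a::real_normed_vector set \<Rightarrow> ('a \<Rightarrow> 'b::real_normed_vector) \<Rightarrow> bool" where
  "smooth_on S f \<longleftrightarrow> (\<forall>k. Ck_on k S f)"


section \<open>Smooth manifolds\<close>

text \<open>A chart is a pair of its domain and its coordinate map; the values of the coordinate map
  outside the domain are irrelevant.\<close>

type_synonym ('m, 'e) chart = "'m set \<times> ('m \<Rightarrow> 'e)"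

definition chart_inv :: "('m, 'e) chart \<Rightarrow> 'e \<Rightarrow> 'm" where
  "chart_inv c = inv_into (fst c) (snd c)"

definition charts_at :: "('m, 'e) chart set \<Rightarrow> 'm \<Rightarrow> ('m, 'e) chart set" where
  "charts_at A p = {c \<in> A. p \<in> fst c}"

text \<open>The atlas need not be maximal.\<close>

definition smooth_manifold ::
  "'m topology \<Rightarrow> ('m, 'e::euclidean_space) chart set \<Rightarrow> bool" where
  "smooth_manifold X A \<longleftrightarrow>
     Hausdorff_space X \<and> second_countable X \<and>
     (\<forall>c\<in>A. openin X (fst c) \<and> open (snd c ` fst c) \<and>
        homeomorphic_map (subtopology X (fst c)) (top_of_set (snd c ` fst c)) (snd c)) \<and>
     (\<Union>c\<in>A. fst c) = topspace X \<and>
     (\<forall>c\<in>A. \<forall>d\<in>A. smooth_on (snd c ` (fst c \<inter> fst d)) (snd d \<circ> chart_inv c))"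

definition smooth_map ::
  "'m topology \<Rightarrow> ('m, 'e::euclidean_space) chart set \<Rightarrow>
   'k topology \<Rightarrow> ('k, 'f::euclidean_space) chart set \<Rightarrow> ('m \<Rightarrow> 'k) \<Rightarrow> bool" where
  "smooth_map X A Y B f \<longleftrightarrow>
     continuous_map X Y f \<and>
     (\<forall>c\<in>A. \<forall>d\<in>B. smooth_on (snd c ` {p \<in> fst c. f p \<in> fst d}) (snd d \<circ> f \<circ> chart_inv c))"

definition prod_atlas ::
  "('m, 'e) chart set \<Rightarrow> ('k, 'f) chart set \<Rightarrow> ('m \<times> 'k, 'e \<times> 'f) chart set" where
  "prod_atlas A B = {(fst c \<times> fst d, map_prod (snd c) (snd d)) | c d. c \<in> A \<and> d \<in> B}"


section \<open>Tangent vectors\<close>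

text \<open>Real-valued functions, and more generally functions into a real vector space, form a real
  vector space pointwise (the additive structure is in \<open>HOL-Library.Function_Algebras\<close>).\<close>

instantiation "fun" :: (type, real_vector) real_vector
begin

definition scaleR_fun :: "real \<Rightarrow> ('a \<Rightarrow> 'b) \<Rightarrow> 'a \<Rightarrow> 'b" where
  "scaleR_fun r f = (\<lambda>x. r *\<^sub>R f x)"

instance
  by standard (auto simp: scaleR_fun_def fun_eq_iff scaleR_add_right scaleR_add_left)

end

text \<open>A tangent vector at a point \<open>p\<close> is the family of its components with respect to all charts
  around \<open>p\<close>; any two of these components are related by the derivative of the change of
  coordinates. Entries that do not belong to a chart around \<open>p\<close> are set to \<open>0\<close>, so that the
  tangent space at \<open>p\<close> is a linear subspace of the space of all families.\<close>

type_synonym ('m, 'e) tvec = "('m, 'e) chart \<Rightarrow> 'e"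

definition tangent_space ::
  "('m, 'e::euclidean_space) chart set \<Rightarrow> 'm \<Rightarrow> ('m, 'e) tvec set" where
  "tangent_space A p =
     {v. (\<forall>c. c \<notin> charts_at A p \<longrightarrow> v c = 0) \<and>
         (\<forall>c \<in> charts_at A p. \<forall>d \<in> charts_at A p.
            v d = frechet_derivative (snd d \<circ> chart_inv c) (at (snd c p)) (v c))}"

text \<open>The tangent vector \<open>\<Sum>i. y\<^sup>i \<partial>/\<partial>x\<^sup>i\<close> at \<open>p\<close>, where \<open>(x\<^sup>i)\<close> are the coordinates
  of \<open>c\<close>.\<close>

definition tangent_of_coords ::
  "('m, 'e::euclidean_space) chart set \<Rightarrow> ('m, 'e) chart \<Rightarrow> 'm \<Rightarrow> 'e \<Rightarrow> ('m, 'e) tvec" where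
  "tangent_of_coords A c p y =
     (\<lambda>d. if d \<in> charts_at A p
          then frechet_derivative (snd d \<circ> chart_inv c) (at (snd c p)) y else 0)"

definition differential ::
  "('m, 'e::euclidean_space) chart set \<Rightarrow> ('k, 'f::euclidean_space) chart set \<Rightarrow>
   ('m \<Rightarrow> 'k) \<Rightarrow> 'm \<Rightarrow> ('m, 'e) tvec \<Rightarrow> ('k, 'f) tvec" where
  "differential A B f p v =
     (let c = (SOME c. c \<in> charts_at A p) in
      (\<lambda>d. if d \<in> charts_at B (f p)
           then frechet_derivative (snd d \<circ> f \<circ> chart_inv c) (at (snd c p)) (v c) else 0))"

text \<open>In coordinates, \<open>[V,W]\<^sup>i = V\<^sup>j \<partial>\<^sub>j W\<^sup>i - W\<^sup>j \<partial>\<^sub>j V\<^sup>i\<close>.\<close>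

definition field_bracket ::
  "('m, 'e::euclidean_space) chart set \<Rightarrow> ('m \<Rightarrow> ('m, 'e) tvec) \<Rightarrow> ('m \<Rightarrow> ('m, 'e) tvec) \<Rightarrow>
   'm \<Rightarrow> ('m, 'e) tvec" where
  "field_bracket A V W p =
     (\<lambda>c. if c \<in> charts_at A p
          then frechet_derivative (\<lambda>x. W (chart_inv c x) c) (at (snd c p)) (V p c)
             - frechet_derivative (\<lambda>x. V (chart_inv c x) c) (at (snd c p)) (W p c)
          else 0)"


section \<open>Lie groups and their Lie algebras\<close>

definition lie_group ::
  "('m, 'b) monoid_scheme \<Rightarrow> 'm topology \<Rightarrow> ('m, 'e::euclidean_space) chart set \<Rightarrow> bool" where
  "lie_group G X A \<longleftrightarrow>
     group G \<and> smooth_manifold X A \<and> topspace X = carrier G \<and>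
     smooth_map (prod_topology X X) (prod_atlas A A) X A (\<lambda>(g, h). g \<otimes>\<^bsub>G\<^esub> h) \<and>
     smooth_map X A X A (\<lambda>g. inv\<^bsub>G\<^esub> g)"

text \<open>The Lie algebra is the tangent space at the identity, a vector \<open>v\<close> being identified with
  the left-invariant vector field extending it.\<close>

definition lie_algebra ::
  "('m, 'b) monoid_scheme \<Rightarrow> ('m, 'e::euclidean_space) chart set \<Rightarrow> ('m, 'e) tvec set" where
  "lie_algebra G A = tangent_space A \<one>\<^bsub>G\<^esub>"

definition left_invariant_field ::
  "('m, 'b) monoid_scheme \<Rightarrow> ('m, 'e::euclidean_space) chart set \<Rightarrow> ('m, 'e) tvec \<Rightarrow>
   'm \<Rightarrow> ('m, 'e) tvec" where
  "left_invariant_field G A v = (\<lambda>g. differential A A (\<lambda>h. g \<otimes>\<^bsub>G\<^esub> h) \<one>\<^bsub>G\<^esub> v)"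

definition lie_bracket ::
  "('m, 'b) monoid_scheme \<Rightarrow> ('m, 'e::euclidean_space) chart set \<Rightarrow>
   ('m, 'e) tvec \<Rightarrow> ('m, 'e) tvec \<Rightarrow> ('m, 'e) tvec" where
  "lie_bracket G A u v =
     field_bracket A (left_invariant_field G A u) (left_invariant_field G A v) \<one>\<^bsub>G\<^esub>"

definition abelian_lie_algebra ::
  "('m, 'b) monoid_scheme \<Rightarrow> ('m, 'e::euclidean_space) chart set \<Rightarrow> bool" where
  "abelian_lie_algebra G A \<longleftrightarrow>
     (\<forall>u \<in> lie_algebra G A. \<forall>v \<in> lie_algebra G A. lie_bracket G A u v = 0)"


section \<open>Finsler metrics\<close>

definition fundamental_tensor ::
  "('v::real_vector \<Rightarrow> real) \<Rightarrow> 'v \<Rightarrow> 'v \<Rightarrow> 'v \<Rightarrow> real" where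
  "fundamental_tensor N y u v =
     1/2 * deriv (\<lambda>s. deriv (\<lambda>t. (N (y + s *\<^sub>R u + t *\<^sub>R v))\<^sup>2) 0) 0"

definition minkowski_norm :: "('e::euclidean_space \<Rightarrow> real) \<Rightarrow> bool" where
  "minkowski_norm N \<longleftrightarrow>
     continuous_on UNIV N \<and> smooth_on (UNIV - {0}) N \<and>
     (\<forall>y. 0 \<le> N y) \<and> (\<forall>y. y \<noteq> 0 \<longrightarrow> 0 < N y) \<and>
     (\<forall>r y. 0 \<le> r \<longrightarrow> N (r *\<^sub>R y) = r * N y) \<and>
     (\<forall>y u. y \<noteq> 0 \<longrightarrow> u \<noteq> 0 \<longrightarrow> 0 < fundamental_tensor N y u u)"

text \<open>A function on the tangent bundle is written as \<open>F p v\<close> with \<open>p\<close> a point and \<open>v\<close> a tangent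
  vector at \<open>p\<close>. Its local expression is \<open>F(x\<^sup>i, y\<^sup>i)\<close> in the standard local coordinates
  of the tangent bundle induced by the chart \<open>c\<close>.\<close>

definition local_expr ::
  "('m, 'e::euclidean_space) chart set \<Rightarrow> ('m \<Rightarrow> ('m, 'e) tvec \<Rightarrow> real) \<Rightarrow> ('m, 'e) chart \<Rightarrow>
   'e \<Rightarrow> 'e \<Rightarrow> real" where
  "local_expr A F c x y = F (chart_inv c x) (tangent_of_coords A c (chart_inv c x) y)"

definition finsler_metric ::
  "('m, 'e::euclidean_space) chart set \<Rightarrow> ('m \<Rightarrow> ('m, 'e) tvec \<Rightarrow> real) \<Rightarrow> bool" where
  "finsler_metric A F \<longleftrightarrow>
     (\<forall>c\<in>A.
        continuous_on (snd c ` fst c \<times> UNIV) (\<lambda>(x, y). local_expr A F c x y) \<and>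
        smooth_on (snd c ` fst c \<times> (UNIV - {0})) (\<lambda>(x, y). local_expr A F c x y) \<and>
        (\<forall>x \<in> snd c ` fst c. minkowski_norm (local_expr A F c x)))"

definition left_invariant ::
  "('m, 'b) monoid_scheme \<Rightarrow> ('m, 'e::euclidean_space) chart set \<Rightarrow>
   ('m \<Rightarrow> ('m, 'e) tvec \<Rightarrow> real) \<Rightarrow> bool" where
  "left_invariant G A F \<longleftrightarrow>
     (\<forall>g \<in> carrier G. \<forall>h \<in> carrier G. \<forall>v \<in> tangent_space A h.
        F (g \<otimes>\<^bsub>G\<^esub> h) (differential A A (\<lambda>k. g \<otimes>\<^bsub>G\<^esub> k) h v) = F h v)"

definition cyclic_metric ::
  "('m, 'b) monoid_scheme \<Rightarrow> ('m, 'e::euclidean_space) chart set \<Rightarrow>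
   ('m \<Rightarrow> ('m, 'e) tvec \<Rightarrow> real) \<Rightarrow> bool" where
  "cyclic_metric G A F \<longleftrightarrow>
     (\<forall>y \<in> lie_algebra G A - {0}. \<forall>x \<in> lie_algebra G A. \<forall>z \<in> lie_algebra G A.
        fundamental_tensor (F \<one>\<^bsub>G\<^esub>) y (lie_bracket G A x y) z
      + fundamental_tensor (F \<one>\<^bsub>G\<^esub>) y (lie_bracket G A y z) x
      + fundamental_tensor (F \<one>\<^bsub>G\<^esub>) y (lie_bracket G A z x) y = 0)"


section \<open>Flag curvature\<close>

definition partial_deriv :: "'n \<Rightarrow> (real^'n \<Rightarrow> real) \<Rightarrow> real^'n \<Rightarrow> real" where
  "partial_deriv i f x = deriv (\<lambda>t. f (x + t *\<^sub>R axis i 1)) 0"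

text \<open>In the following definitions \<open>L x y\<close> is the local expression \<open>F(x\<^sup>i, y\<^sup>i)\<close> of a Finsler
  metric. \<open>g_coeff\<close> is the matrix \<open>g\<^sub>i\<^sub>j\<close>, \<open>spray_coeff\<close> is \<open>G\<^sup>i\<close>, and row \<open>i\<close>, column \<open>k\<close> of
  \<open>riemann_coeff\<close> is \<open>R\<^sup>i\<^sub>k\<close>.\<close>

definition g_coeff :: "(real^'n \<Rightarrow> real^'n \<Rightarrow> real) \<Rightarrow> real^'n \<Rightarrow> real^'n \<Rightarrow> real^'n^'n" where
  "g_coeff L x y =
     (\<chi> i j. 1/2 * partial_deriv j (partial_deriv i (\<lambda>y. (L x y)\<^sup>2)) y)"

definition spray_coeff ::
  "(real^'n \<Rightarrow> real^'n \<Rightarrow> real) \<Rightarrow> 'n \<Rightarrow> real^'n \<Rightarrow> real^'n \<Rightarrow> real" where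
  "spray_coeff L i x y =
     1/4 * (\<Sum>l\<in>UNIV. matrix_inv (g_coeff L x y) $ i $ l *
       ((\<Sum>k\<in>UNIV. partial_deriv l (\<lambda>y. partial_deriv k (\<lambda>x. (L x y)\<^sup>2) x) y * y $ k)
        - partial_deriv l (\<lambda>x. (L x y)\<^sup>2) x))"

definition riemann_coeff ::
  "(real^'n \<Rightarrow> real^'n \<Rightarrow> real) \<Rightarrow> real^'n \<Rightarrow> real^'n \<Rightarrow> real^'n^'n" where
  "riemann_coeff L x y =
     (let S = spray_coeff L in
      \<chi> i k.
        2 * partial_deriv k (\<lambda>x. S i x y) x
        - (\<Sum>j\<in>UNIV. y $ j * partial_deriv j (\<lambda>x. partial_deriv k (\<lambda>y. S i x y) y) x)
        + 2 * (\<Sum>j\<in>UNIV. S j x y * partial_deriv j (\<lambda>y. partial_deriv k (\<lambda>y. S i x y) y) y)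
        - (\<Sum>j\<in>UNIV. partial_deriv j (\<lambda>y. S i x y) y * partial_deriv k (\<lambda>y. S j x y) y))"

definition local_flag_curvature ::
  "(real^'n \<Rightarrow> real^'n \<Rightarrow> real) \<Rightarrow> real^'n \<Rightarrow> real^'n \<Rightarrow> real^'n \<Rightarrow> real" where
  "local_flag_curvature L x y u =
     fundamental_tensor (L x) y (riemann_coeff L x y *v u) u /
     (fundamental_tensor (L x) y y y * fundamental_tensor (L x) y u u
        - (fundamental_tensor (L x) y y u)\<^sup>2)"

text \<open>Flag curvature at \<open>p\<close> of tangent vectors \<open>y\<close> and \<open>u\<close>, computed in the chart \<open>c\<close>.\<close>

definition flag_curvature ::
  "('m, real^'n) chart set \<Rightarrow> ('m \<Rightarrow> ('m, real^'n) tvec \<Rightarrow> real) \<Rightarrow> ('m, real^'n) chart \<Rightarrow>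
   'm \<Rightarrow> ('m, real^'n) tvec \<Rightarrow> ('m, real^'n) tvec \<Rightarrow> real" where
  "flag_curvature A F c p y u = local_flag_curvature (local_expr A F c) (snd c p) (y c) (u c)"

definition constant_flag_curvature ::
  "'m topology \<Rightarrow> ('m, real^'n) chart set \<Rightarrow> ('m \<Rightarrow> ('m, real^'n) tvec \<Rightarrow> real) \<Rightarrow> real \<Rightarrow> bool"
  where
  "constant_flag_curvature X A F \<kappa> \<longleftrightarrow>
     (\<forall>p \<in> topspace X. \<forall>c \<in> charts_at A p. \<forall>y \<in> tangent_space A p. \<forall>u \<in> tangent_space A p.
        y \<noteq> u \<and> independent {y, u} \<longrightarrow> flag_curvature A F c p y u = \<kappa>)"

end

theory Submission
  imports Defs
begin

text \<open>
  Fix a chart around the identity. Let \<open>E x\<close> be the left-invariant frame in this chart and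
  \<open>B x\<close> its inverse, the Maurer--Cartan form, so that the metric is \<open>L x y = N (B x y)\<close> with
  \<open>N\<close> the Minkowski norm on the Lie algebra. Write \<open>\<langle>u,w\<rangle>\<^sub>y\<close> for the fundamental tensor of \<open>N\<close>.
  A vector \<open>y \<noteq> 0\<close> with \<open>\<langle>y,[u,y]\<rangle>\<^sub>y = 0\<close> for all \<open>u\<close> is called a geodesic vector. The proof
  shows first that geodesic vectors are central, and then that there are too many of them
  for the bracket to be nonzero.

  \<^bold>\<open>Geodesic vectors are central.\<close> Let \<open>\<eta>\<close> be the vector field on the Lie algebra
  with \<open>\<langle>\<eta>(v),w\<rangle>\<^sub>v = \<langle>v,[w,v]\<rangle>\<^sub>v\<close>. The spray coefficients are
  \<open>2 G(x,y) = E\<^sub>x (dB(y) y + \<eta>(B\<^sub>x y))\<close>, and \<open>y\<close> is a geodesic vector iff \<open>\<eta>(y) = 0\<close>. In that case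
  the Maurer--Cartan equation removes everything that depends on the chart from the coordinate
  formula of the curvature, and \<open>R\<^sub>y = D A - (A + D)\<^sup>2/4\<close> with \<open>A = ad y\<close> and \<open>D = d\<eta>(y)\<close>
  (\<open>riemann_coeff_geodesic_vector\<close>). For a cyclic metric \<open>D = A - 2 A*\<close>, where \<open>A*\<close> is the adjoint
  with respect to \<open>\<langle>_,_\<rangle>\<^sub>y\<close>, hence \<open>R\<^sub>y = A A* - A* A - A*\<^sup>2\<close>. Cyclicity, the Jacobi identity and the
  condition on \<open>y\<close> also make \<open>A\<^sup>2\<close> self-adjoint, so \<open>R\<^sub>y = 0\<close> becomes \<open>A\<^sup>2 = A A* - A* A\<close>, and this
  forces \<open>A = 0\<close> (\<open>curvature_operator_rigid\<close>).

  \<^bold>\<open>Minimisers of \<open>N\<close> are geodesic vectors.\<close> If \<open>z \<noteq> 0\<close> minimises \<open>N\<close> along all the curves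
  \<open>exp(t ad u) z\<close>, or on a coset of \<open>[\<gg>,\<gg>]\<close>, then \<open>z\<close> is a geodesic vector, hence central. This is
  used twice. Given \<open>y\<close>, choose a polynomial \<open>q\<close> with \<open>q(0) = 1\<close> and \<open>q(ad y) (ad y)\<^sup>k = 0\<close>. The
  function \<open>z \<mapsto> det q(ad z)\<close> is invariant under all \<open>exp(ad u)\<close>; minimising \<open>N\<close> on its level set
  through \<open>y\<close> gives a point where it has the value \<open>det q(0) = 1\<close>. So \<open>q(ad y)\<close> is invertible and \<open>ad y\<close> is nilpotent
  (\<open>ad_nilpotent\<close>). Minimising on the cosets of \<open>[\<gg>,\<gg>]\<close> gives \<open>\<gg> = Z(\<gg>) + [\<gg>,\<gg>]\<close>
  (\<open>exists_central_mod_derived\<close>), hence \<open>[\<gg>,\<gg>] = [\<gg>,[\<gg>,\<gg>]]\<close>.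

  By Engel's theorem \<open>\<gg>\<close> is nilpotent, and then the last equation implies \<open>[\<gg>,\<gg>] = 0\<close>
  (\<open>engel_perfect\<close>).
\<close>


section \<open>Smooth maps\<close>

abbreviation fd :: "('a::real_normed_vector \<Rightarrow> 'b::real_normed_vector) \<Rightarrow> 'a \<Rightarrow> 'a \<Rightarrow> 'b" where
  "fd f x \<equiv> frechet_derivative f (at x)"

lemma fd_eqI: "(f has_derivative f') (at x) \<Longrightarrow> fd f x = f'"
  by (rule frechet_derivative_at[symmetric])

lemma fd_works: "f differentiable (at x) \<Longrightarrow> (f has_derivative fd f x) (at x)"
  using frechet_derivative_works by blast

lemma fd_linear: "f differentiable (at x) \<Longrightarrow> linear (fd f x)"
  by (rule linear_frechet_derivative)

lemma fd_cong_open: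
  assumes "open S" "x \<in> S" "\<And>y. y \<in> S \<Longrightarrow> f y = g y"
  shows "fd f x = fd g x"
proof -
  have "(f has_derivative f') (at x) \<longleftrightarrow> (g has_derivative f') (at x)" for f'
    using assms by (metis has_derivative_transform_within_open)
  then show ?thesis unfolding frechet_derivative_def by simp
qed

lemma differentiable_cong_open:
  assumes "open S" "x \<in> S" "\<And>y. y \<in> S \<Longrightarrow> f y = g y"
  shows "f differentiable (at x) \<longleftrightarrow> g differentiable (at x)"
  unfolding differentiable_def using assms by (metis has_derivative_transform_within_open)

lemma Ck_on_cong:
  assumes "open S" "\<And>y. y \<in> S \<Longrightarrow> f y = g y"
  shows "Ck_on k S f \<longleftrightarrow> Ck_on k S g"
  using assms(2)
proof (induction k arbitrary: f g)
  case 0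
  then show ?case by (simp cong: continuous_on_cong)
next
  case (Suc k)
  have "Ck_on k S (\<lambda>x. fd f x v) \<longleftrightarrow> Ck_on k S (\<lambda>x. fd g x v)" for v
    using Suc fd_cong_open[OF assms(1), of _ f g] by (intro Suc.IH) auto
  moreover have "\<forall>x\<in>S. f differentiable (at x) \<longleftrightarrow> g differentiable (at x)"
    using differentiable_cong_open[OF assms(1)] Suc.prems by blast
  ultimately show ?case by auto
qed

lemma Ck_on_SucD: "Ck_on (Suc k) S f \<Longrightarrow> Ck_on k S f"
proof (induction k arbitrary: f)
  case 0
  then show ?case
    by (auto simp: continuous_on_eq_continuous_within intro!: differentiable_imp_continuous_within
        intro: differentiable_at_withinI)
next
  case (Suc k)
  then show ?case by simp
qed

lemma Ck_on_subset: "Ck_on k S f \<Longrightarrow> T \<subseteq> S \<Longrightarrow> Ck_on k T f"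
  by (induction k arbitrary: f) (auto intro: continuous_on_subset)

lemma Ck_on_const: "Ck_on k S (\<lambda>x. c)"
  by (induction k arbitrary: c) auto

lemma Ck_on_add:
  assumes "open S"
  shows "Ck_on k S f \<Longrightarrow> Ck_on k S g \<Longrightarrow> Ck_on k S (\<lambda>x. f x + g x)"
proof (induction k arbitrary: f g)
  case 0
  then show ?case by (auto intro: continuous_intros)
next
  case (Suc k)
  have "fd (\<lambda>x. f x + g x) x = (\<lambda>v. fd f x v + fd g x v)" if "x \<in> S" for x
    using Suc.prems that by (intro fd_eqI has_derivative_add fd_works) auto
  then have "Ck_on k S (\<lambda>x. fd (\<lambda>x. f x + g x) x v) \<longleftrightarrow> Ck_on k S (\<lambda>x. fd f x v + fd g x v)" for v
    by (intro Ck_on_cong assms) auto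
  then show ?case using Suc by auto
qed

lemma Ck_on_linear:
  assumes "bounded_linear l" "open S"
  shows "Ck_on k S f \<Longrightarrow> Ck_on k S (\<lambda>x. l (f x))"
proof (induction k arbitrary: f)
  case 0
  then show ?case unfolding Ck_on.simps by (rule bounded_linear.continuous_on[OF assms(1)])
next
  case (Suc k)
  have d: "((\<lambda>x. l (f x)) has_derivative (\<lambda>v. l (fd f x v))) (at x)" if "x \<in> S" for x
    using Suc.prems that by (intro bounded_linear.has_derivative[OF assms(1)] fd_works) auto
  from d have "Ck_on k S (\<lambda>x. fd (\<lambda>x. l (f x)) x v) \<longleftrightarrow> Ck_on k S (\<lambda>x. l (fd f x v))" for v
    using fd_eqI by (intro Ck_on_cong assms) fastforce
  moreover have "(\<lambda>x. l (f x)) differentiable (at x)" if "x \<in> S" for x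
    using d[OF that] unfolding differentiable_def by blast
  ultimately show ?case using Suc by simp
qed

lemma Ck_on_bilinear:
  assumes "bounded_bilinear h" "open S"
  shows "Ck_on k S f \<Longrightarrow> Ck_on k S g \<Longrightarrow> Ck_on k S (\<lambda>x. h (f x) (g x))"
proof (induction k arbitrary: f g)
  case 0
  then show ?case unfolding Ck_on.simps by (rule bounded_bilinear.continuous_on[OF assms(1)])
next
  case (Suc k)
  have d: "((\<lambda>x. h (f x) (g x)) has_derivative (\<lambda>v. h (f x) (fd g x v) + h (fd f x v) (g x))) (at x)"
    if "x \<in> S" for x
    using Suc.prems that by (intro bounded_bilinear.FDERIV[OF assms(1)] fd_works) auto
  then have "Ck_on k S (\<lambda>x. fd (\<lambda>x. h (f x) (g x)) x v) \<longleftrightarrow>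
      Ck_on k S (\<lambda>x. h (f x) (fd g x v) + h (fd f x v) (g x))" for v
    using fd_eqI by (intro Ck_on_cong assms) fastforce
  moreover have "Ck_on k S f" "Ck_on k S g" using Suc.prems Ck_on_SucD by blast+
  moreover have "(\<lambda>x. h (f x) (g x)) differentiable (at x)" if "x \<in> S" for x
    using d[OF that] differentiable_def by blast
  ultimately show ?case using Suc by (auto intro!: Ck_on_add assms Suc.IH)
qed

lemma Ck_on_sum:
  assumes "open S" "\<And>i. i \<in> I \<Longrightarrow> Ck_on k S (f i)"
  shows "Ck_on k S (\<lambda>x. \<Sum>i\<in>I. f i x)"
  using assms(2) by (induction I rule: infinite_finite_induct) (auto intro: Ck_on_const Ck_on_add assms)

lemma Ck_on_compose:
  fixes g :: "'a::real_normed_vector \<Rightarrow> 'b::euclidean_space" and f :: "'b \<Rightarrow> 'c::real_normed_vector"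
  assumes "open S" "open T" "g ` S \<subseteq> T"
  shows "Ck_on k S g \<Longrightarrow> Ck_on k T f \<Longrightarrow> Ck_on k S (\<lambda>x. f (g x))"
proof (induction k arbitrary: f)
  case 0
  then show ?case using assms by (auto intro: continuous_on_compose2)
next
  case (Suc k)
  have d: "((\<lambda>x. f (g x)) has_derivative (\<lambda>v. fd f (g x) (fd g x v))) (at x)" if "x \<in> S" for x
    using Suc.prems that assms
    by (intro has_derivative_compose[of g _ x UNIV f, simplified] fd_works) auto
  have "fd f (g x) (fd g x v) = (\<Sum>b\<in>Basis. (fd g x v \<bullet> b) *\<^sub>R fd f (g x) b)" if "x \<in> S" for x v
  proof -
    have l: "linear (fd f (g x))" using Suc.prems that assms by (intro fd_linear) auto
    have "fd f (g x) (\<Sum>b\<in>Basis. (fd g x v \<bullet> b) *\<^sub>R b) = (\<Sum>b\<in>Basis. (fd g x v \<bullet> b) *\<^sub>R fd f (g x) b)"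
      by (simp add: linear_sum[OF l] linear_cmul[OF l])
    then show ?thesis by (simp add: euclidean_representation)
  qed
  with d have "Ck_on k S (\<lambda>x. fd (\<lambda>x. f (g x)) x v) \<longleftrightarrow>
      Ck_on k S (\<lambda>x. \<Sum>b\<in>Basis. (fd g x v \<bullet> b) *\<^sub>R fd f (g x) b)" for v
    using fd_eqI by (intro Ck_on_cong assms) fastforce
  moreover have "Ck_on k S (\<lambda>x. \<Sum>b\<in>Basis. (fd g x v \<bullet> b) *\<^sub>R fd f (g x) b)" for v
  proof (rule Ck_on_sum[OF assms(1)])
    fix b :: 'b
    have "Ck_on k S (\<lambda>x. fd g x v \<bullet> b)"
      using Suc.prems(1) by (intro Ck_on_linear[OF bounded_linear_inner_left assms(1)]) simp
    moreover have "Ck_on k S (\<lambda>x. fd f (g x) b)"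
      using Suc.prems Ck_on_SucD by (intro Suc.IH) auto
    ultimately show "Ck_on k S (\<lambda>x. (fd g x v \<bullet> b) *\<^sub>R fd f (g x) b)"
      by (rule Ck_on_bilinear[OF bounded_bilinear_scaleR assms(1)])
  qed
  moreover have "(\<lambda>x. f (g x)) differentiable (at x)" if "x \<in> S" for x
    using d[OF that] unfolding differentiable_def by blast
  ultimately show ?case by simp
qed

lemma Ck_on_inverse: "Ck_on k (UNIV - {0}) (inverse :: real \<Rightarrow> real)"
proof (induction k)
  case 0
  show ?case by (simp add: continuous_on_inverse)
next
  case (Suc k)
  have d: "(inverse has_derivative (\<lambda>v. - (inverse x * v * inverse x))) (at x)" if "x \<noteq> 0" for x :: real
    using that by (rule has_derivative_inverse')
  have o: "open (UNIV - {0::real})" by (simp add: open_delete)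
  have e: "fd inverse x v = - v * (inverse x * inverse x)" if "x \<in> UNIV - {0}" for x v :: real
    using fd_eqI[OF d] that by simp
  have "inverse differentiable (at x)" if "x \<noteq> 0" for x :: real
    using d[OF that] unfolding differentiable_def by blast
  moreover have "Ck_on k (UNIV - {0}) (\<lambda>x::real. - v * (inverse x * inverse x))" for v
    using Ck_on_bilinear[OF bounded_bilinear_mult o Ck_on_const[of k _ "- v"]
        Ck_on_bilinear[OF bounded_bilinear_mult o Suc Suc]] .
  then have "Ck_on k (UNIV - {0}) (\<lambda>x. fd inverse x v)" for v :: real
    by (rule iffD2[OF Ck_on_cong[OF o e[of _ v]], rotated]) assumption
  ultimately show ?case unfolding Ck_on.simps by blast
qed

lemma smooth_onD:
  assumes "smooth_on S f" "x \<in> S"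
  shows "f differentiable (at x)"
  using assms unfolding smooth_on_def by (metis Ck_on.simps(2))

lemma smooth_on_fd: "smooth_on S f \<Longrightarrow> smooth_on S (\<lambda>x. fd f x v)"
  unfolding smooth_on_def by (metis Ck_on.simps(2))

lemma smooth_on_continuous: "smooth_on S f \<Longrightarrow> continuous_on S f"
  unfolding smooth_on_def by (metis Ck_on.simps(1))

lemma smooth_on_subset: "smooth_on S f \<Longrightarrow> T \<subseteq> S \<Longrightarrow> smooth_on T f"
  unfolding smooth_on_def using Ck_on_subset by blast

lemma smooth_on_cong:
  assumes "open S" "\<And>y. y \<in> S \<Longrightarrow> f y = g y"
  shows "smooth_on S f \<longleftrightarrow> smooth_on S g"
  unfolding smooth_on_def using Ck_on_cong[OF assms(1), of f g] assms(2) by blast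

lemma smooth_on_const: "smooth_on S (\<lambda>x. c)"
  by (simp add: smooth_on_def Ck_on_const)

lemma smooth_on_bounded_linear:
  assumes "bounded_linear l" "open S"
  shows "smooth_on S l"
proof -
  have "fd l x = l" for x
    by (rule fd_eqI) (rule bounded_linear_imp_has_derivative[OF assms(1)])
  then have "Ck_on k S l" for k
  proof (cases k)
    case 0
    then show ?thesis using assms linear_continuous_on by simp
  next
    case (Suc j)
    have "\<forall>v. Ck_on j S (\<lambda>x. fd l x v)" by (simp add: \<open>\<And>x. fd l x = l\<close> Ck_on_const)
    moreover have "\<forall>x\<in>S. l differentiable (at x)"
      using bounded_linear_imp_has_derivative[OF assms(1)] unfolding differentiable_def by blast
    ultimately show ?thesis using Suc Ck_on.simps(2) by blast
  qed
  then show ?thesis by (simp add: smooth_on_def)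
qed

lemma smooth_on_add: "open S \<Longrightarrow> smooth_on S f \<Longrightarrow> smooth_on S g \<Longrightarrow> smooth_on S (\<lambda>x. f x + g x)"
  by (simp add: smooth_on_def Ck_on_add)

lemma smooth_on_sum:
  "open S \<Longrightarrow> (\<And>i. i \<in> I \<Longrightarrow> smooth_on S (f i)) \<Longrightarrow> smooth_on S (\<lambda>x. \<Sum>i\<in>I. f i x)"
  by (simp add: smooth_on_def Ck_on_sum)

lemma smooth_on_linear: "bounded_linear l \<Longrightarrow> open S \<Longrightarrow> smooth_on S f \<Longrightarrow> smooth_on S (\<lambda>x. l (f x))"
  by (simp add: smooth_on_def Ck_on_linear)

lemma smooth_on_bilinear:
  "bounded_bilinear h \<Longrightarrow> open S \<Longrightarrow> smooth_on S f \<Longrightarrow> smooth_on S g \<Longrightarrow> smooth_on S (\<lambda>x. h (f x) (g x))"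
  by (simp add: smooth_on_def Ck_on_bilinear)

lemmas smooth_on_mult = smooth_on_bilinear[OF bounded_bilinear_mult]
lemmas smooth_on_scaleR = smooth_on_bilinear[OF bounded_bilinear_scaleR]

lemma smooth_on_prod:
  fixes f :: "'i \<Rightarrow> 'a::real_normed_vector \<Rightarrow> real"
  assumes "open S" "\<And>i. i \<in> I \<Longrightarrow> smooth_on S (f i)"
  shows "smooth_on S (\<lambda>x. \<Prod>i\<in>I. f i x)"
  using assms(2)
  by (induction I rule: infinite_finite_induct) (auto intro: smooth_on_const smooth_on_mult assms)

lemma smooth_on_compose:
  fixes g :: "'a::real_normed_vector \<Rightarrow> 'b::euclidean_space"
  shows "open S \<Longrightarrow> open T \<Longrightarrow> g ` S \<subseteq> T \<Longrightarrow> smooth_on S g \<Longrightarrow> smooth_on T f \<Longrightarrow> smooth_on S (\<lambda>x. f (g x))"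
  by (simp add: smooth_on_def Ck_on_compose)

lemma smooth_on_inverse:
  fixes f :: "'a::real_normed_vector \<Rightarrow> real"
  assumes "open S" "smooth_on S f" "\<And>x. x \<in> S \<Longrightarrow> f x \<noteq> 0"
  shows "smooth_on S (\<lambda>x. inverse (f x))"
  by (rule smooth_on_compose[where T="UNIV - {0}"])
    (auto simp: smooth_on_def[of "UNIV - {0}"] Ck_on_inverse open_delete assms)

lemma smooth_on_euclideanI:
  fixes f :: "'a::real_normed_vector \<Rightarrow> 'b::euclidean_space"
  assumes "open S" "\<And>b. b \<in> Basis \<Longrightarrow> smooth_on S (\<lambda>x. f x \<bullet> b)"
  shows "smooth_on S f"
proof -
  have "smooth_on S (\<lambda>x. \<Sum>b\<in>Basis. (f x \<bullet> b) *\<^sub>R b)"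
    by (rule smooth_on_sum[OF assms(1)], rule smooth_on_scaleR[OF assms(1)])
      (simp_all add: assms smooth_on_const)
  then show ?thesis by (simp add: euclidean_representation)
qed

lemma smooth_on_vecI:
  fixes f :: "'a::real_normed_vector \<Rightarrow> real^'n"
  assumes "open S" "\<And>i. smooth_on S (\<lambda>x. f x $ i)"
  shows "smooth_on S f"
  by (rule smooth_on_euclideanI) (auto simp: Basis_vec_def inner_axis assms)

lemma smooth_on_vec_nth:
  fixes f :: "'a::real_normed_vector \<Rightarrow> real^'n"
  assumes "open S" "smooth_on S f"
  shows "smooth_on S (\<lambda>x. f x $ i)"
  using assms by (rule smooth_on_linear[OF bounded_linear_vec_nth])

lemma smooth_on_Pair:
  fixes f :: "'a::real_normed_vector \<Rightarrow> 'b::real_normed_vector" and g :: "'a \<Rightarrow> 'c::real_normed_vector"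
  assumes "open S" "smooth_on S f" "smooth_on S g"
  shows "smooth_on S (\<lambda>x. (f x, g x))"
proof -
  have "bounded_linear (\<lambda>y::'b. (y, 0::'c))" "bounded_linear (\<lambda>y::'c. (0::'b, y))"
    by (simp_all add: bounded_linear_Pair bounded_linear_ident bounded_linear_zero)
  from smooth_on_add[OF assms(1) smooth_on_linear[OF this(1) assms(1,2)] smooth_on_linear[OF this(2) assms(1,3)]]
  show ?thesis by simp
qed

lemma has_real_derivative_along_line:
  fixes f :: "'a::real_normed_vector \<Rightarrow> real"
  assumes "f differentiable (at (x + t *\<^sub>R v))"
  shows "((\<lambda>t. f (x + t *\<^sub>R v)) has_real_derivative fd f (x + t *\<^sub>R v) v) (at t)"
proof -
  have "((\<lambda>t. f (x + t *\<^sub>R v)) has_derivative (\<lambda>s. fd f (x + t *\<^sub>R v) (s *\<^sub>R v))) (at t)"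
    using assms
    by (intro has_derivative_compose[of "\<lambda>t. x + t *\<^sub>R v" _ t UNIV f, simplified] fd_works)
      (auto intro!: derivative_eq_intros)
  then show ?thesis
    using linear_cmul[OF fd_linear[OF assms]] by (simp add: has_field_derivative_def mult_commute_abs)
qed

text \<open>Two applications of the mean value theorem, first along \<open>u\<close> and then along \<open>v\<close>. The left-hand
  side is symmetric in \<open>u\<close> and \<open>v\<close>, which is why second derivatives commute.\<close>

lemma second_difference_mean_value:
  fixes f :: "'a::real_normed_vector \<Rightarrow> real"
  assumes o: "ball x e \<subseteq> S" and f: "Ck_on 2 S f"
    and s: "s > 0" "s * (norm u + norm v) < e"
  shows "\<exists>a\<in>{0..s}. \<exists>b\<in>{0..s}.
    f (x + s *\<^sub>R u + s *\<^sub>R v) - f (x + s *\<^sub>R u) - f (x + s *\<^sub>R v) + f x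
      = s * s * fd (\<lambda>z. fd f z u) (x + a *\<^sub>R u + b *\<^sub>R v) v"
proof -
  have mem: "x + a *\<^sub>R u + b *\<^sub>R v \<in> S" if "a \<in> {0..s}" "b \<in> {0..s}" for a b
  proof -
    have "norm (a *\<^sub>R u + b *\<^sub>R v) \<le> \<bar>a\<bar> * norm u + \<bar>b\<bar> * norm v"
      by (metis norm_scaleR norm_triangle_ineq)
    also have "\<dots> \<le> s * norm u + s * norm v"
      using that by (intro add_mono mult_right_mono) auto
    finally have "norm (a *\<^sub>R u + b *\<^sub>R v) < e" using s by (simp add: algebra_simps)
    moreover have "dist x (x + w) = norm w" for w by (simp add: dist_norm)
    ultimately have "x + (a *\<^sub>R u + b *\<^sub>R v) \<in> ball x e" by (simp only: mem_ball)
    then show ?thesis using o by (auto simp: add.assoc)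
  qed
  have f1: "f differentiable (at z)" and f2: "(\<lambda>z. fd f z w) differentiable (at z)" if "z \<in> S" for z w
    using f that by (auto simp: numeral_2_eq_2)
  define h where "h r = f (x + s *\<^sub>R v + r *\<^sub>R u) - f (x + r *\<^sub>R u)" for r
  have "\<exists>a>0. a < s \<and> h s - h 0 = (s - 0) * (fd f (x + s *\<^sub>R v + a *\<^sub>R u) u - fd f (x + a *\<^sub>R u) u)"
  proof (rule MVT2[OF s(1)])
    fix r assume r: "0 \<le> r" "r \<le> s"
    have "x + s *\<^sub>R v + r *\<^sub>R u \<in> S" "x + r *\<^sub>R u \<in> S"
      using mem[of r s] mem[of r 0] r s by (simp_all add: algebra_simps)
    then show "(h has_real_derivative (fd f (x + s *\<^sub>R v + r *\<^sub>R u) u - fd f (x + r *\<^sub>R u) u)) (at r)"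
      unfolding h_def by (intro DERIV_diff has_real_derivative_along_line f1)
  qed
  then obtain a where a: "0 < a" "a < s"
    "h s - h 0 = s * (fd f (x + s *\<^sub>R v + a *\<^sub>R u) u - fd f (x + a *\<^sub>R u) u)"
    by auto
  define k where "k r = fd f (x + a *\<^sub>R u + r *\<^sub>R v) u" for r
  have "\<exists>b>0. b < s \<and> k s - k 0 = (s - 0) * fd (\<lambda>z. fd f z u) (x + a *\<^sub>R u + b *\<^sub>R v) v"
  proof (rule MVT2[OF s(1)])
    fix r assume r: "0 \<le> r" "r \<le> s"
    have "x + a *\<^sub>R u + r *\<^sub>R v \<in> S" using mem[of a r] a r by simp
    then show "(k has_real_derivative (fd (\<lambda>z. fd f z u) (x + a *\<^sub>R u + r *\<^sub>R v) v)) (at r)"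
      unfolding k_def by (intro has_real_derivative_along_line f2)
  qed
  then obtain b where b: "0 < b" "b < s"
    "k s - k 0 = s * fd (\<lambda>z. fd f z u) (x + a *\<^sub>R u + b *\<^sub>R v) v"
    by auto
  have "h s - h 0 = s * (k s - k 0)" using a(3) by (simp add: k_def algebra_simps)
  also have "\<dots> = s * s * fd (\<lambda>z. fd f z u) (x + a *\<^sub>R u + b *\<^sub>R v) v" using b(3) by simp
  finally have "f (x + s *\<^sub>R u + s *\<^sub>R v) - f (x + s *\<^sub>R u) - f (x + s *\<^sub>R v) + f x
      = s * s * fd (\<lambda>z. fd f z u) (x + a *\<^sub>R u + b *\<^sub>R v) v"
    by (simp add: h_def algebra_simps)
  then show ?thesis using a b by (intro bexI[of _ a] bexI[of _ b]) auto
qed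

lemma second_derivative_symmetric_real:
  fixes f :: "'a::real_normed_vector \<Rightarrow> real"
  assumes S: "open S" "x \<in> S" and f: "Ck_on 2 S f"
  shows "fd (\<lambda>z. fd f z u) x v = fd (\<lambda>z. fd f z v) x u"
proof -
  have bound: "\<bar>fd (\<lambda>z. fd f z u) x v - fd (\<lambda>z. fd f z v) x u\<bar> \<le> 2 * \<epsilon>" if \<epsilon>: "\<epsilon> > 0" for \<epsilon>
  proof -
    have c: "continuous (at x) (\<lambda>z. fd (\<lambda>z. fd f z p) z q)" for p q
      using f S by (auto simp: numeral_2_eq_2 continuous_on_eq_continuous_at)
    obtain d1 where d1: "d1 > 0"
      "\<And>z. dist z x < d1 \<Longrightarrow> dist (fd (\<lambda>z. fd f z u) z v) (fd (\<lambda>z. fd f z u) x v) < \<epsilon>"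
      using c[of u v, unfolded continuous_at_eps_delta] \<epsilon> by blast
    obtain d2 where d2: "d2 > 0"
      "\<And>z. dist z x < d2 \<Longrightarrow> dist (fd (\<lambda>z. fd f z v) z u) (fd (\<lambda>z. fd f z v) x u) < \<epsilon>"
      using c[of v u, unfolded continuous_at_eps_delta] \<epsilon> by blast
    obtain d3 where d3: "d3 > 0" "ball x d3 \<subseteq> S" using S openE by blast
    define d where "d = min d1 (min d2 d3)"
    have d: "d > 0" "ball x d \<subseteq> S" using d1 d2 d3 by (auto simp: d_def)
    \<comment> \<open>Small enough for the parallelogram with sides \<open>s u\<close> and \<open>s v\<close> to lie in the ball.\<close>
    define s where "s = d / (2 * (norm u + norm v + 1))"
    have n: "norm u + norm v + 1 > 0" by (smt (verit) norm_ge_zero)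
    have s0: "s > 0" using d n by (simp add: s_def)
    have "s * (norm u + norm v + 1) = d / 2" using n by (simp add: s_def field_simps)
    then have s1: "s * (norm u + norm v) < d" using s0 d by (simp add: algebra_simps)
    have near: "dist (x + a *\<^sub>R p + b *\<^sub>R q) x < d"
      if "a \<in> {0..s}" "b \<in> {0..s}" "norm p + norm q = norm u + norm v" for a b p q
    proof -
      have "norm (a *\<^sub>R p + b *\<^sub>R q) \<le> \<bar>a\<bar> * norm p + \<bar>b\<bar> * norm q"
        by (metis norm_scaleR norm_triangle_ineq)
      also have "\<dots> \<le> s * norm p + s * norm q"
        using that by (intro add_mono mult_right_mono) auto
      also have "\<dots> = s * (norm u + norm v)" using that by (simp flip: distrib_left)
      finally show ?thesis using s1 by (simp add: dist_norm add.assoc)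
    qed
    obtain a b where ab: "a \<in> {0..s}" "b \<in> {0..s}"
      "f (x + s *\<^sub>R u + s *\<^sub>R v) - f (x + s *\<^sub>R u) - f (x + s *\<^sub>R v) + f x
        = s * s * fd (\<lambda>z. fd f z u) (x + a *\<^sub>R u + b *\<^sub>R v) v"
      using second_difference_mean_value[OF d(2) f s0 s1] by blast
    obtain a' b' where ab': "a' \<in> {0..s}" "b' \<in> {0..s}"
      "f (x + s *\<^sub>R v + s *\<^sub>R u) - f (x + s *\<^sub>R v) - f (x + s *\<^sub>R u) + f x
        = s * s * fd (\<lambda>z. fd f z v) (x + a' *\<^sub>R v + b' *\<^sub>R u) u"
      using second_difference_mean_value[OF d(2) f s0, of v u] s1 by (auto simp: add.commute)
    have "s * s * fd (\<lambda>z. fd f z u) (x + a *\<^sub>R u + b *\<^sub>R v) v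
        = s * s * fd (\<lambda>z. fd f z v) (x + a' *\<^sub>R v + b' *\<^sub>R u) u"
      using ab(3) ab'(3) by (simp add: algebra_simps)
    then have "fd (\<lambda>z. fd f z u) (x + a *\<^sub>R u + b *\<^sub>R v) v
        = fd (\<lambda>z. fd f z v) (x + a' *\<^sub>R v + b' *\<^sub>R u) u"
      using s0 by simp
    moreover have "dist (x + a *\<^sub>R u + b *\<^sub>R v) x < d1" "dist (x + a' *\<^sub>R v + b' *\<^sub>R u) x < d2"
      using near[OF ab(1,2), of u v] near[OF ab'(1,2), of v u] by (auto simp: d_def)
    ultimately show ?thesis
      using d1(2) d2(2) by (fastforce simp: dist_real_def abs_if split: if_splits)
  qed
  show ?thesis
  proof (rule ccontr)
    define d where "d = \<bar>fd (\<lambda>z. fd f z u) x v - fd (\<lambda>z. fd f z v) x u\<bar>"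
    assume "\<not> ?thesis"
    then have "d > 0" by (simp add: d_def)
    with bound[of "d / 4", folded d_def] show False by simp
  qed
qed

lemma second_derivative_symmetric:
  fixes f :: "'a::real_normed_vector \<Rightarrow> 'b::euclidean_space"
  assumes S: "open S" "x \<in> S" and f: "smooth_on S f"
  shows "fd (\<lambda>z. fd f z u) x v = fd (\<lambda>z. fd f z v) x u"
proof (rule euclidean_eqI)
  fix b :: 'b assume "b \<in> Basis"
  have i: "fd (\<lambda>z. g z \<bullet> b) z w = fd g z w \<bullet> b" if "g differentiable (at z)" for g :: "'a \<Rightarrow> 'b" and z w
    using that by (metis fd_works fd_eqI has_derivative_inner_left)
  have d1: "fd (\<lambda>z. f z \<bullet> b) z w = fd f z w \<bullet> b" if "z \<in> S" for z w
    using that f smooth_onD i by blast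
  have d2: "fd (\<lambda>z. fd (\<lambda>z. f z \<bullet> b) z w) x w' = fd (\<lambda>z. fd f z w) x w' \<bullet> b" for w w'
    using fd_cong_open[OF S, of "\<lambda>z. fd (\<lambda>z. f z \<bullet> b) z w" "\<lambda>z. fd f z w \<bullet> b"] d1
      i[OF smooth_onD[OF smooth_on_fd[OF f] S(2)]] by simp
  have "Ck_on 2 S (\<lambda>z. f z \<bullet> b)"
    using f smooth_on_linear[OF bounded_linear_inner_left S(1)] smooth_on_def by blast
  from second_derivative_symmetric_real[OF S this]
  show "fd (\<lambda>z. fd f z u) x v \<bullet> b = fd (\<lambda>z. fd f z v) x u \<bullet> b"
    by (simp only: d2)
qed

text \<open>The product rule for evaluating a varying linear map at a varying vector. In finite dimension
  it suffices that \<open>M\<close> is differentiable at every fixed vector.\<close>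

lemma has_derivative_apply:
  fixes M :: "'a::real_normed_vector \<Rightarrow> 'b::euclidean_space \<Rightarrow> 'c::real_normed_vector"
  assumes S: "open S" "x \<in> S" and lin: "\<And>z. z \<in> S \<Longrightarrow> linear (M z)"
    and M: "\<And>v. ((\<lambda>z. M z v) has_derivative (\<lambda>h. M' h v)) (at x)"
    and f: "(f has_derivative f') (at x)"
  shows "((\<lambda>z. M z (f z)) has_derivative (\<lambda>h. M' h (f x) + M x (f' h))) (at x)"
proof -
  have rep: "M z w = (\<Sum>b\<in>Basis. (w \<bullet> b) *\<^sub>R M z b)" if "z \<in> S" for z w
  proof -
    have "M z (\<Sum>b\<in>Basis. (w \<bullet> b) *\<^sub>R b) = (\<Sum>b\<in>Basis. (w \<bullet> b) *\<^sub>R M z b)"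
      by (simp add: linear_sum[OF lin[OF that]] linear_cmul[OF lin[OF that]])
    then show ?thesis by (simp add: euclidean_representation)
  qed
  have rep': "M' h w = (\<Sum>b\<in>Basis. (w \<bullet> b) *\<^sub>R M' h b)" for h w
  proof -
    have "((\<lambda>z. M z w) has_derivative (\<lambda>h. (\<Sum>b\<in>Basis. (w \<bullet> b) *\<^sub>R M' h b))) (at x)"
      by (rule has_derivative_transform_within_open[where f="\<lambda>z. \<Sum>b\<in>Basis. (w \<bullet> b) *\<^sub>R M z b", OF _ S])
        (rule has_derivative_sum, rule has_derivative_scaleR_right, rule M, simp add: rep)
    with M[of w] have "(\<lambda>h. M' h w) = (\<lambda>h. (\<Sum>b\<in>Basis. (w \<bullet> b) *\<^sub>R M' h b))"
      by (rule has_derivative_unique)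
    then show ?thesis by metis
  qed
  have "((\<lambda>z. \<Sum>b\<in>Basis. (f z \<bullet> b) *\<^sub>R M z b) has_derivative
      (\<lambda>h. \<Sum>b\<in>Basis. (f x \<bullet> b) *\<^sub>R M' h b + (f' h \<bullet> b) *\<^sub>R M x b)) (at x)"
    by (rule has_derivative_sum, rule has_derivative_scaleR, rule has_derivative_inner_left[OF f], rule M)
  then have "((\<lambda>z. M z (f z)) has_derivative
      (\<lambda>h. \<Sum>b\<in>Basis. (f x \<bullet> b) *\<^sub>R M' h b + (f' h \<bullet> b) *\<^sub>R M x b)) (at x)"
    by (rule has_derivative_transform_within_open[OF _ S]) (simp add: rep)
  moreover have "(\<Sum>b\<in>Basis. (f x \<bullet> b) *\<^sub>R M' h b + (f' h \<bullet> b) *\<^sub>R M x b) = M' h (f x) + M x (f' h)" for h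
    using rep[OF S(2), of "f' h"] rep'[of h "f x"] by (simp add: sum.distrib)
  ultimately show ?thesis by simp
qed

text \<open>Cramer's rule, in the form of a rational expression in the coefficients: this is how inverses
  of smoothly varying matrices are seen to be smooth.\<close>

definition solve_linear :: "real^'n^'n \<Rightarrow> real^'n \<Rightarrow> real^'n" where
  "solve_linear M b = (\<chi> k. det (\<chi> i j. if j = k then b $ i else M $ i $ j) / det M)"

lemma solve_linear_iff: "det M \<noteq> 0 \<Longrightarrow> M *v x = b \<longleftrightarrow> x = solve_linear M b"
  unfolding solve_linear_def by (rule cramer)

lemma det_nonzero_iff:
  fixes M :: "real^'n^'n"
  shows "det M \<noteq> 0 \<longleftrightarrow> (\<forall>u. M *v u = 0 \<longrightarrow> u = 0)"
  by (simp add: invertible_left_inverse matrix_left_invertible_ker flip: invertible_det_nz)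

lemmas det_nonzeroI = det_nonzero_iff[THEN iffD2, rule_format]

lemma smooth_on_det:
  fixes M :: "'a::real_normed_vector \<Rightarrow> real^'n^'n"
  assumes "open S" "\<And>i j. smooth_on S (\<lambda>x. M x $ i $ j)"
  shows "smooth_on S (\<lambda>x. det (M x))"
  unfolding det_def using assms by (intro smooth_on_sum smooth_on_mult smooth_on_const smooth_on_prod) auto

lemma smooth_on_solve_linear:
  fixes M :: "'a::real_normed_vector \<Rightarrow> real^'n^'n"
  assumes S: "open S" and M: "\<And>i j. smooth_on S (\<lambda>x. M x $ i $ j)" and b: "smooth_on S b"
    and d: "\<And>x. x \<in> S \<Longrightarrow> det (M x) \<noteq> 0"
  shows "smooth_on S (\<lambda>x. solve_linear (M x) (b x))"
proof (rule smooth_on_vecI[OF S])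
  fix k
  have "smooth_on S (\<lambda>x. (\<chi> i j. if j = k then b x $ i else M x $ i $ j) $ i $ j)" for i j
    using smooth_on_vec_nth[OF S b] M by (cases "j = k") simp_all
  then show "smooth_on S (\<lambda>x. solve_linear (M x) (b x) $ k)"
    unfolding solve_linear_def divide_inverse
    using S M d by (simp, intro smooth_on_mult smooth_on_det smooth_on_inverse) auto
qed

lemma has_derivative_apply_fd:
  fixes M :: "'a::real_normed_vector \<Rightarrow> 'b::euclidean_space \<Rightarrow> 'c::real_normed_vector"
  assumes S: "open S" "x \<in> S" and lin: "\<And>z. z \<in> S \<Longrightarrow> linear (M z)"
    and M: "\<And>v. (\<lambda>z. M z v) differentiable (at x)"
    and f: "(f has_derivative f') (at x)"
  shows "((\<lambda>z. M z (f z)) has_derivative (\<lambda>h. fd (\<lambda>z. M z (f x)) x h + M x (f' h))) (at x)"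
  using has_derivative_apply[where M'="\<lambda>h v. fd (\<lambda>z. M z v) x h", OF S lin fd_works[OF M] f] .

lemma linear_fd_parameter:
  assumes "open S" "x \<in> S" "\<And>z. z \<in> S \<Longrightarrow> linear (M z)" "\<And>v. (\<lambda>z. M z v) differentiable (at x)"
  shows "linear (\<lambda>v. fd (\<lambda>z. M z v) x h)"
proof (rule linearI)
  fix v w
  have "((\<lambda>z. M z v + M z w) has_derivative (\<lambda>h. fd (\<lambda>z. M z v) x h + fd (\<lambda>z. M z w) x h)) (at x)"
    by (rule has_derivative_add; rule fd_works[OF assms(4)])
  moreover have "fd (\<lambda>z. M z (v + w)) x = fd (\<lambda>z. M z v + M z w) x"
    by (rule fd_cong_open[OF assms(1,2)]) (simp add: assms(3) linear_add)
  ultimately show "fd (\<lambda>z. M z (v + w)) x h = fd (\<lambda>z. M z v) x h + fd (\<lambda>z. M z w) x h"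
    using fd_eqI by metis
next
  fix r v
  have "((\<lambda>z. r *\<^sub>R M z v) has_derivative (\<lambda>h. r *\<^sub>R fd (\<lambda>z. M z v) x h)) (at x)"
    by (rule has_derivative_scaleR_right; rule fd_works[OF assms(4)])
  moreover have "fd (\<lambda>z. M z (r *\<^sub>R v)) x = fd (\<lambda>z. r *\<^sub>R M z v) x"
    by (rule fd_cong_open[OF assms(1,2)]) (simp add: assms(3) linear_cmul)
  ultimately show "fd (\<lambda>z. M z (r *\<^sub>R v)) x h = r *\<^sub>R fd (\<lambda>z. M z v) x h"
    using fd_eqI by metis
qed

lemma fd_compose:
  assumes "f differentiable (at (g x))" "(g has_derivative g') (at x)"
  shows "((\<lambda>x. f (g x)) has_derivative (\<lambda>h. fd f (g x) (g' h))) (at x)"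
  using has_derivative_compose[OF assms(2) fd_works[OF assms(1)]] .

lemma linear_has_derivative:
  fixes f :: "'a::euclidean_space \<Rightarrow> 'b::real_normed_vector"
  shows "linear f \<Longrightarrow> (f has_derivative f) (at x)"
  by (simp add: linear_conv_bounded_linear bounded_linear_imp_has_derivative)

lemma real_deriv_cong_line:
  fixes f :: "'a::real_normed_vector \<Rightarrow> real"
  assumes "f differentiable (at x)"
  shows "deriv (\<lambda>t. f (x + t *\<^sub>R v)) 0 = fd f x v"
  using has_real_derivative_along_line[of f x 0 v] assms by (simp add: DERIV_imp_deriv)


section \<open>Minkowski norms\<close>

locale minkowski =
  fixes N :: "'a::euclidean_space \<Rightarrow> real"
  assumes minkowski_norm: "minkowski_norm N"
begin

abbreviation g :: "'a \<Rightarrow> 'a \<Rightarrow> 'a \<Rightarrow> real" where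
  "g \<equiv> fundamental_tensor N"

abbreviation Nsq :: "'a \<Rightarrow> real" where
  "Nsq \<equiv> \<lambda>v. (N v)\<^sup>2"

lemma open_nonzero: "open (UNIV - {0::'a})"
  by (simp add: open_delete)

lemma smooth_Nsq: "smooth_on (UNIV - {0}) Nsq"
  using minkowski_norm smooth_on_mult[OF open_nonzero, of N N]
  by (simp add: minkowski_norm_def power2_eq_square)

lemma Nsq_differentiable: "v \<noteq> 0 \<Longrightarrow> Nsq differentiable (at v)"
  using smooth_onD[OF smooth_Nsq] by auto

lemma fd_Nsq_differentiable: "v \<noteq> 0 \<Longrightarrow> (\<lambda>z. fd Nsq z w) differentiable (at v)"
  using smooth_onD[OF smooth_on_fd[OF smooth_Nsq]] by auto

lemma g_eq:
  assumes "y \<noteq> 0"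
  shows "g y u v = 1/2 * fd (\<lambda>z. fd Nsq z v) y u"
proof -
  have "open {s::real. y + s *\<^sub>R u \<noteq> 0}"
    by (intro open_Collect_neq continuous_intros)
  from eventually_nhds_in_open[OF this, of 0] have "\<forall>\<^sub>F s in nhds (0::real). y + s *\<^sub>R u \<noteq> 0"
    using assms by simp
  then have "\<forall>\<^sub>F s in nhds (0::real). deriv (\<lambda>t. Nsq (y + s *\<^sub>R u + t *\<^sub>R v)) 0 = fd Nsq (y + s *\<^sub>R u) v"
    by eventually_elim (rule real_deriv_cong_line, erule Nsq_differentiable)
  then have "deriv (\<lambda>s. deriv (\<lambda>t. Nsq (y + s *\<^sub>R u + t *\<^sub>R v)) 0) 0 = deriv (\<lambda>s. fd Nsq (y + s *\<^sub>R u) v) 0"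
    by (rule deriv_cong_ev) simp
  also have "\<dots> = fd (\<lambda>z. fd Nsq z v) y u"
    by (rule real_deriv_cong_line[OF fd_Nsq_differentiable[OF assms]])
  finally show ?thesis by (simp add: fundamental_tensor_def)
qed

lemma g_sym: "y \<noteq> 0 \<Longrightarrow> g y u v = g y v u"
  using second_derivative_symmetric[OF open_nonzero _ smooth_Nsq, of y u v] by (simp add: g_eq)

lemma g_linear_left: "y \<noteq> 0 \<Longrightarrow> linear (\<lambda>u. g y u v)"
  using fd_linear[OF fd_Nsq_differentiable[of y v]] by (simp add: g_eq linear_iff algebra_simps)

lemma g_linear_right: "y \<noteq> 0 \<Longrightarrow> linear (g y u)"
  using g_linear_left[of y u] by (simp add: linear_iff g_sym[of y u])

lemma g_pos: "y \<noteq> 0 \<Longrightarrow> u \<noteq> 0 \<Longrightarrow> 0 < g y u u"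
  using minkowski_norm by (simp add: minkowski_norm_def)

lemma smooth_g: "smooth_on (UNIV - {0}) (\<lambda>y. g y u v)"
proof -
  have "smooth_on (UNIV - {0}) (\<lambda>y. 1/2 * fd (\<lambda>z. fd Nsq z v) y u)"
    by (rule smooth_on_mult[OF open_nonzero smooth_on_const smooth_on_fd[OF smooth_on_fd[OF smooth_Nsq]]])
  then show ?thesis by (subst smooth_on_cong[OF open_nonzero]) (simp_all add: g_eq)
qed

text \<open>Euler's identity: the derivative of \<open>N\<^sup>2\<close> is positively homogeneous of degree one, so its own
  derivative at \<open>y\<close> in the direction \<open>y\<close> is itself.\<close>

lemma fd_Nsq:
  assumes "y \<noteq> 0"
  shows "fd Nsq y v = 2 * g y y v"
proof -
  have hom: "fd Nsq (r *\<^sub>R y) v = r * fd Nsq y v" if r: "r > 0" for r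
  proof -
    have "((\<lambda>z. Nsq (r *\<^sub>R z)) has_derivative (\<lambda>h. fd Nsq (r *\<^sub>R y) (r *\<^sub>R h))) (at y)"
      using r assms
      by (intro fd_compose[of Nsq "\<lambda>z. r *\<^sub>R z"] Nsq_differentiable) (auto intro!: derivative_eq_intros)
    moreover have "(\<lambda>z. Nsq (r *\<^sub>R z)) = (\<lambda>z. r\<^sup>2 * Nsq z)"
      using minkowski_norm r by (auto simp: minkowski_norm_def power_mult_distrib)
    moreover have "((\<lambda>z. r\<^sup>2 * Nsq z) has_derivative (\<lambda>h. r\<^sup>2 * fd Nsq y h)) (at y)"
      by (rule has_derivative_mult_right[OF fd_works[OF Nsq_differentiable[OF assms]]])
    ultimately have "(\<lambda>h. fd Nsq (r *\<^sub>R y) (r *\<^sub>R h)) = (\<lambda>h. r\<^sup>2 * fd Nsq y h)"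
      using has_derivative_unique by metis
    then have "fd Nsq (r *\<^sub>R y) (r *\<^sub>R v) = r\<^sup>2 * fd Nsq y v" by metis
    moreover have "fd Nsq (r *\<^sub>R y) (r *\<^sub>R v) = r * fd Nsq (r *\<^sub>R y) v"
      using linear_cmul[OF fd_linear[OF Nsq_differentiable[of "r *\<^sub>R y"]]] r assms by simp
    ultimately show ?thesis using r by (simp add: power2_eq_square)
  qed
  have "((\<lambda>t. fd Nsq (y + t *\<^sub>R y) v) has_real_derivative fd (\<lambda>z. fd Nsq z v) y y) (at 0)"
    using has_real_derivative_along_line[of "\<lambda>z. fd Nsq z v" y 0 y] fd_Nsq_differentiable[OF assms, of v] by simp
  moreover have "((\<lambda>t. fd Nsq (y + t *\<^sub>R y) v) has_real_derivative fd Nsq y v) (at 0)"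
  proof (rule DERIV_cong_ev[THEN iffD2])
    have "\<forall>\<^sub>F t in nhds (0::real). t \<in> {-1<..}" by (rule eventually_nhds_in_open) auto
    then show "\<forall>\<^sub>F t in nhds 0. fd Nsq (y + t *\<^sub>R y) v = (1 + t) * fd Nsq y v"
    proof eventually_elim
      case (elim t)
      then show ?case using hom[of "1 + t"] by (simp add: scaleR_add_left)
    qed
    show "((\<lambda>t. (1 + t) * fd Nsq y v) has_real_derivative fd Nsq y v) (at 0)"
      by (auto intro!: derivative_eq_intros)
  qed simp_all
  ultimately have "fd (\<lambda>z. fd Nsq z v) y y = fd Nsq y v" by (rule DERIV_unique)
  then show ?thesis by (simp add: g_eq[OF assms])
qed

lemma g_has_derivative_base:
  assumes "y \<noteq> 0"
  shows "((\<lambda>z. g z z w) has_derivative (\<lambda>h. g y h w)) (at y)"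
proof (rule has_derivative_transform_within_open[OF _ open_nonzero])
  show "((\<lambda>z. 1/2 * fd Nsq z w) has_derivative (\<lambda>h. g y h w)) (at y)"
    using has_derivative_mult_right[OF fd_works[OF fd_Nsq_differentiable[OF assms, of w]], of "1/2"]
    by (simp add: g_eq[OF assms])
qed (use assms in \<open>auto simp: fd_Nsq\<close>)

lemma g_nondegenerate:
  assumes "y \<noteq> 0" "\<And>w. g y u w = 0"
  shows "u = 0"
  using g_pos[OF assms(1), of u] assms(2)[of u] by fastforce

end


section \<open>Operators with self-adjoint square\<close>

lemma quadratic_nonneg_imp_linear_coeff_0:
  fixes a b :: real
  assumes "\<And>t. 0 \<le> 2 * t * a + t\<^sup>2 * b"
  shows "a = 0"
proof (rule ccontr)
  assume a: "a \<noteq> 0"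
  \<comment> \<open>For \<open>t = - s a\<close> with this small \<open>s\<close> the linear term dominates.\<close>
  define s where "s = 1 / (\<bar>b\<bar> + 1)"
  have s: "s > 0" "s * \<bar>b\<bar> < 1" by (simp_all add: s_def field_simps)
  have "0 \<le> 2 * (- s * a) * a + (- s * a)\<^sup>2 * b" by (rule assms)
  also have "\<dots> = s * a\<^sup>2 * (s * b - 2)" by (simp add: power2_eq_square algebra_simps)
  finally have "0 \<le> s * a\<^sup>2 * (s * b - 2)" .
  moreover have "s * a\<^sup>2 > 0" using s a by simp
  ultimately have "s * b - 2 \<ge> 0" by (smt (verit) mult_pos_neg)
  moreover have "s * b \<le> s * \<bar>b\<bar>" using s by (intro mult_left_mono) auto
  ultimately show False using s by linarith
qed

locale inner_form =
  fixes ip :: "'a::euclidean_space \<Rightarrow> 'a \<Rightarrow> real"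
  assumes ip_bilinear: "bilinear ip" and ip_sym: "ip u v = ip v u" and ip_pos: "u \<noteq> 0 \<Longrightarrow> 0 < ip u u"
begin

lemmas ip_simps = bilinear_ladd[OF ip_bilinear] bilinear_radd[OF ip_bilinear]
  bilinear_lmul[OF ip_bilinear] bilinear_rmul[OF ip_bilinear]
  bilinear_lsub[OF ip_bilinear] bilinear_rsub[OF ip_bilinear]
  bilinear_lzero[OF ip_bilinear] bilinear_rzero[OF ip_bilinear]

lemma ip_ge_0: "0 \<le> ip u u"
  using ip_pos[of u] by (cases "u = 0") (auto simp: ip_simps)

lemma ip_eq_0: "ip u u \<le> 0 \<Longrightarrow> u = 0"
  using ip_pos[of u] by fastforce

lemma ip_nondegenerate: "(\<And>w. ip u w = 0) \<Longrightarrow> u = 0"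
  by (rule ip_eq_0) simp

lemma ip_continuous:
  assumes "continuous_on T f" "continuous_on T h"
  shows "continuous_on T (\<lambda>x. ip (f x) (h x))"
proof -
  have "bounded_bilinear ip" using ip_bilinear bilinear_conv_bounded_bilinear by blast
  then show ?thesis using bounded_bilinear.continuous_on assms by blast
qed

text \<open>The Rayleigh quotient attains its maximum on the unit sphere, and its first variation vanishes
  there.\<close>

lemma positive_eigenvalue:
  assumes P: "linear P" and sa: "\<And>u w. ip (P u) w = ip u (P w)" and u0: "ip (P u0) u0 > 0"
  shows "\<exists>p w. p > 0 \<and> w \<noteq> 0 \<and> P w = p *\<^sub>R w"
proof -
  have u0': "u0 \<noteq> 0" using u0 by (auto simp: ip_simps)
  define f where "f u = ip (P u) u / ip u u" for u
  have cP: "continuous_on T P" for T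
    using P linear_continuous_on linear_conv_bounded_linear by blast
  have "continuous_on (sphere 0 1) f"
    unfolding f_def
    by (intro continuous_on_divide ip_continuous cP continuous_on_id ballI)
      (metis ip_pos less_irrefl norm_zero zero_neq_one mem_sphere_0)
  moreover have "sphere (0::'a) 1 \<noteq> {}" by simp
  ultimately obtain w where w: "w \<in> sphere 0 1" and max: "\<And>u. u \<in> sphere 0 1 \<Longrightarrow> f u \<le> f w"
    using continuous_attains_sup[OF compact_sphere] by blast
  have w0: "w \<noteq> 0" using w by auto
  have max': "f u \<le> f w" if "u \<noteq> 0" for u
  proof -
    have "f (u /\<^sub>R norm u) = f u"
      using that by (simp add: f_def linear_cmul[OF P] ip_simps)
    then show ?thesis using max[of "u /\<^sub>R norm u"] that by simp
  qed
  define p where "p = f w"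
  have "0 < f u0" using u0 ip_pos[OF u0'] by (simp add: f_def)
  then have p: "p > 0" using max'[OF u0'] by (simp add: p_def)
  have nonneg: "0 \<le> p * ip u u - ip (P u) u" for u
  proof (cases "u = 0")
    case False
    then show ?thesis using max'[OF False] ip_pos[OF False] by (simp add: p_def f_def[of u] divide_le_eq)
  qed (simp add: ip_simps)
  have eq: "p * ip w w - ip (P w) w = 0" using ip_pos[OF w0] by (simp add: p_def f_def)
  have "p * ip w v - ip (P w) v = 0" for v
  proof (rule quadratic_nonneg_imp_linear_coeff_0)
    fix t
    have "0 \<le> p * ip (w + t *\<^sub>R v) (w + t *\<^sub>R v) - ip (P (w + t *\<^sub>R v)) (w + t *\<^sub>R v)" by (rule nonneg)
    also have "\<dots> = (p * ip w w - ip (P w) w) + 2 * t * (p * ip w v - ip (P w) v) + t\<^sup>2 * (p * ip v v - ip (P v) v)"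
      using sa[of v w] ip_sym[of v w] ip_sym[of v "P w"]
      by (simp add: linear_add[OF P] linear_cmul[OF P] ip_simps power2_eq_square algebra_simps)
    finally show "0 \<le> 2 * t * (p * ip w v - ip (P w) v) + t\<^sup>2 * (p * ip v v - ip (P v) v)" using eq by simp
  qed
  then have "p *\<^sub>R w - P w = 0" by (intro ip_nondegenerate) (simp add: ip_simps)
  then show ?thesis using p w0 by (intro exI[of _ p] exI[of _ w]) auto
qed

text \<open>Since \<open>A\<^sup>2 = C\<^sup>2\<close>, the vector \<open>C w\<close> is an eigenvector for \<open>p\<close> as well. The quadratic identity at
  \<open>C w\<close> gives \<open>|C w|\<^sup>2 \<le> \<sigma> p |w|\<^sup>2\<close>, the one at \<open>w\<close> gives \<open>|A w|\<^sup>2 = |C w|\<^sup>2 - \<sigma> p |w|\<^sup>2\<close>; so \<open>A w = 0\<close>. The sign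
  \<open>\<sigma> = \<plusminus>1\<close> makes the statement applicable with \<open>A\<close> and \<open>C\<close> exchanged.\<close>

lemma no_eigenvalue:
  assumes A: "linear A" and C: "linear C" and sq: "\<And>u. C (C u) = A (A u)"
    and quad: "\<And>u. \<sigma> * ip (A (A u)) u = ip (C u) (C u) - ip (A u) (A u)"
    and w: "A (A w) = p *\<^sub>R w" and p: "\<sigma> * p > 0" and \<sigma>: "\<sigma> * \<sigma> = (1::real)"
  shows "w = 0"
proof -
  have CC: "C (C w) = p *\<^sub>R w" by (simp add: sq w)
  have "A (A (C w)) = C (C (C w))" by (rule sq[symmetric])
  also have "\<dots> = p *\<^sub>R C w" unfolding CC by (rule linear_cmul[OF C])
  finally have AC: "A (A (C w)) = p *\<^sub>R C w" .
  have "\<sigma> * (p * ip (C w) (C w)) = p * (p * ip w w) - ip (A (C w)) (A (C w))"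
    using quad[of "C w"] unfolding AC CC by (simp add: ip_simps)
  moreover have "(\<sigma> * p) * ((\<sigma> * p) * ip w w) = (\<sigma> * \<sigma>) * (p * (p * ip w w))"
    by (simp only: ac_simps)
  then have "(\<sigma> * p) * ((\<sigma> * p) * ip w w) = p * (p * ip w w)" by (simp only: \<sigma> mult_1_left)
  moreover have "(\<sigma> * p) * ip (C w) (C w) = \<sigma> * (p * ip (C w) (C w))" by (rule mult.assoc)
  ultimately have "(\<sigma> * p) * ip (C w) (C w) \<le> (\<sigma> * p) * ((\<sigma> * p) * ip w w)"
    using ip_ge_0[of "A (C w)"] by linarith
  then have "ip (C w) (C w) \<le> \<sigma> * p * ip w w" by (simp only: mult_le_cancel_left_pos[OF p])
  moreover have "\<sigma> * p * ip w w = ip (C w) (C w) - ip (A w) (A w)"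
    using quad[of w] w by (simp add: ip_simps)
  ultimately have "A w = 0" by (intro ip_eq_0) simp
  then have "p *\<^sub>R w = 0" using w linear_0[OF A] by simp
  then show "w = 0" using p by auto
qed

text \<open>Here \<open>C\<close> is the adjoint of \<open>A\<close>, and the last two hypotheses together say that
  \<open>A\<^sup>2 = A C - C A\<close> is self-adjoint. By the preceding lemma this operator has no nonzero eigenvalue, so
  it vanishes; then \<open>A\<^sup>2 = 0\<close> and \<open>A\<close> is normal, so \<open>|C A u| = |A A u| = 0\<close> and \<open>A = 0\<close>.\<close>

lemma curvature_operator_rigid:
  assumes A: "linear A" and C: "linear C" and adj: "\<And>u w. ip (A u) w = ip u (C w)"
    and sa: "\<And>u w. ip (A (A u)) w = ip u (A (A w))"
    and quad: "\<And>u. ip (C u) (C u) - ip (A u) (A u) - ip (A (A u)) u = 0"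
  shows "A u = 0"
proof -
  define P where "P u = A (A u)" for u
  have P: "linear P" unfolding P_def[abs_def] using linear_compose[OF A A] by (simp add: o_def)
  have sq: "C (C u) = A (A u)" for u
  proof -
    have "ip (C (C u) - A (A u)) w = 0" for w
      using adj[of w "C u"] adj[of "A w" u] sa[of w u] ip_sym[of "C (C u)" w] ip_sym[of "A (A u)" w]
      by (simp add: ip_simps)
    from ip_nondegenerate[OF this] show ?thesis by simp
  qed
  have sa': "ip (P u) w = ip u (P w)" for u w by (simp add: P_def sa)
  have "\<not> ip (P u) u > 0" for u
  proof
    assume "ip (P u) u > 0"
    from positive_eigenvalue[OF P sa' this] obtain p w where pw: "p > 0" "w \<noteq> 0" "P w = p *\<^sub>R w" by blast
    then show False using no_eigenvalue[OF A C sq, of 1 w p] quad by (simp add: P_def)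
  qed
  moreover have "\<not> ip (P u) u < 0" for u
  proof
    assume "ip (P u) u < 0"
    then have "ip (- P u) u > 0" using bilinear_lneg[OF ip_bilinear] by simp
    moreover have "ip (- P u) w = ip u (- P w)" for u w
      using sa' bilinear_lneg[OF ip_bilinear] bilinear_rneg[OF ip_bilinear] by simp
    ultimately obtain p w where pw: "p > 0" "w \<noteq> 0" "- P w = p *\<^sub>R w"
      using positive_eigenvalue[OF linear_compose_neg[OF P]] by blast
    then have "C (C w) = (- p) *\<^sub>R w" by (simp add: sq P_def) (metis minus_equation_iff)
    moreover have "- 1 * ip (C (C u)) u = ip (A u) (A u) - ip (C u) (C u)" for u
      using quad[of u] sq[of u] by simp
    ultimately show False using no_eigenvalue[OF C A sq[symmetric], of "-1" w "-p"] pw by simp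
  qed
  ultimately have z: "ip (P u) u = 0" for u by (meson linorder_less_linear)
  have "ip (P u) w = 0" for u w
    using z[of "u + w"] z[of u] z[of w] sa'[of w u] ip_sym[of w "P u"]
    by (simp add: linear_add[OF P] ip_simps)
  then have P0: "A (A u) = 0" for u using ip_nondegenerate[of "P u"] P_def by metis
  then have "ip (C (A u)) (C (A u)) = 0" using quad[of "A u"] P0[of u] by (simp add: ip_simps linear_0[OF A])
  then have "C (A u) = 0" by (intro ip_eq_0) simp
  then have "ip (A u) (A u) = 0" using adj[of u "A u"] by (simp add: ip_simps)
  then show ?thesis by (intro ip_eq_0) simp
qed

end


section \<open>Real Lie algebras: Engel's theorem\<close>

locale real_lie_algebra =
  fixes br :: "'a::euclidean_space \<Rightarrow> 'a \<Rightarrow> 'a"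
  assumes bilinear: "bilinear br" and skew: "br u v = - br v u"
    and jacobi_id: "br (br u v) w + br (br v w) u + br (br w u) v = 0"
begin

lemmas br_simps = bilinear_ladd[OF bilinear] bilinear_radd[OF bilinear]
  bilinear_lmul[OF bilinear] bilinear_rmul[OF bilinear]
  bilinear_lsub[OF bilinear] bilinear_rsub[OF bilinear]
  bilinear_lneg[OF bilinear] bilinear_rneg[OF bilinear]
  bilinear_lzero[OF bilinear] bilinear_rzero[OF bilinear]

lemma self: "br u u = 0"
  using skew[of u u] by (simp add: eq_neg_iff_add_eq_0 flip: scaleR_2)

lemma linear_br: "linear (br u)"
  using bilinear by (simp add: bilinear_def)

lemma br_br: "br (br u v) w = br u (br v w) - br v (br u w)"
proof -
  have "br (br u v) w = - br (br v w) u - br (br w u) v"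
    using jacobi_id[of u v w] by (simp add: eq_diff_eq eq_neg_iff_add_eq_0 algebra_simps)
  moreover have "br (br w u) v = br v (br u w)"
    using skew[of "br w u" v] skew[of w u] by (simp add: br_simps)
  moreover have "br (br v w) u = - br u (br v w)" by (rule skew)
  ultimately show ?thesis by simp
qed

text \<open>The classical induction: a maximal proper subalgebra \<open>H\<close> of \<open>M\<close> acts on \<open>M\<close> modulo \<open>H\<close>, which yields a
  vector \<open>v\<close> normalising \<open>H\<close> with \<open>M = H + \<real> v\<close>; among the vectors of \<open>V\<close> that \<open>H\<close> sends to \<open>U\<close>, a suitable
  power of \<open>\<rho> v\<close> produces one that \<open>v\<close> sends to \<open>U\<close> too. Quotients are replaced by pairs \<open>U \<subset> V\<close> of
  invariant subspaces of one fixed space, so that the induction hypothesis applies both to the adjoint action on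
  \<open>M\<close> modulo \<open>H\<close> and to \<open>\<rho>\<close>.\<close>

theorem engel:
  fixes \<rho> :: "'a \<Rightarrow> 'a \<Rightarrow> 'a"
  assumes ad_nilpotent: "\<And>x. \<exists>k. \<forall>v. (br x ^^ k) v = 0"
    and "subspace M" "\<And>x y. x \<in> M \<Longrightarrow> y \<in> M \<Longrightarrow> br x y \<in> M"
    and "bilinear \<rho>"
    and "\<And>x y v. x \<in> M \<Longrightarrow> y \<in> M \<Longrightarrow> \<rho> (br x y) v = \<rho> x (\<rho> y v) - \<rho> y (\<rho> x v)"
    and "\<And>x. x \<in> M \<Longrightarrow> \<exists>k. \<forall>v. (\<rho> x ^^ k) v = 0"
    and "subspace U" "subspace V" "U \<subset> V"
    and "\<And>x v. x \<in> M \<Longrightarrow> v \<in> V \<Longrightarrow> \<rho> x v \<in> V"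
    and "\<And>x u. x \<in> M \<Longrightarrow> u \<in> U \<Longrightarrow> \<rho> x u \<in> U"
  shows "\<exists>v\<in>V - U. \<forall>x\<in>M. \<rho> x v \<in> U"
  using assms(2-)
proof (induction "dim M" arbitrary: M \<rho> U V rule: less_induct)
  case less
  note M = less.prems(1,2) and \<rho> = less.prems(3-5) and UV = less.prems(6-8) and inv = less.prems(9,10)
  show ?case
  proof (cases "M = {0}")
    case True
    then show ?thesis using UV bilinear_lzero[OF \<rho>(1)] subspace_0[OF UV(1)] by auto
  next
    case False
    define Q where "Q H \<longleftrightarrow> subspace H \<and> (\<forall>x\<in>H. \<forall>y\<in>H. br x y \<in> H) \<and> H \<subset> M" for H
    have "Q {0}" using False subspace_0[OF M(1)] by (auto simp: Q_def br_simps)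
    moreover have "\<forall>H. Q H \<longrightarrow> dim H \<le> DIM('a)" using dim_subset_UNIV by blast
    ultimately obtain H where H: "Q H" and max: "\<And>H'. Q H' \<Longrightarrow> dim H' \<le> dim H"
      using ex_has_greatest_nat[of Q "{0}" dim "Suc (DIM('a))"] by (auto simp: le_imp_less_Suc)
    have Hs: "subspace H" and Hb: "\<And>x y. x \<in> H \<Longrightarrow> y \<in> H \<Longrightarrow> br x y \<in> H" and HM: "H \<subset> M"
      using H by (auto simp: Q_def)
    have dimH: "dim H < dim M"
      using dim_psubset[of H M] HM Hs M(1) by (simp add: span_eq_iff[THEN iffD2])
    have "\<exists>v\<in>M - H. \<forall>x\<in>H. br x v \<in> H"
      by (rule less.hyps[OF dimH Hs _ bilinear])
        (use br_br ad_nilpotent Hs M HM Hb in auto)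
    then obtain v where v: "v \<in> M" "v \<notin> H" "\<And>x. x \<in> H \<Longrightarrow> br x v \<in> H" by blast
    define H' where "H' = {m + r *\<^sub>R v | m r. m \<in> H}"
    have H's: "subspace H'"
    proof (rule subspaceI)
      show "0 \<in> H'" unfolding H'_def using subspace_0[OF Hs] by (intro CollectI exI[of _ 0]) simp
    next
      fix x y assume "x \<in> H'" "y \<in> H'"
      then obtain m r m' r' where "x = m + r *\<^sub>R v" "y = m' + r' *\<^sub>R v" "m \<in> H" "m' \<in> H" by (auto simp: H'_def)
      then show "x + y \<in> H'" unfolding H'_def using subspace_add[OF Hs, of m m']
        by (intro CollectI exI[of _ "m + m'"] exI[of _ "r + r'"]) (simp add: algebra_simps)
    next
      fix c x assume "x \<in> H'"
      then obtain m r where "x = m + r *\<^sub>R v" "m \<in> H" by (auto simp: H'_def)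
      then show "c *\<^sub>R x \<in> H'" unfolding H'_def using subspace_scale[OF Hs, of m c]
        by (intro CollectI exI[of _ "c *\<^sub>R m"] exI[of _ "c * r"]) (simp add: algebra_simps)
    qed
    have HH': "H \<subseteq> H'" and vH': "v \<in> H'"
    proof -
      have "m + 0 *\<^sub>R v \<in> H'" if "m \<in> H" for m unfolding H'_def using that by blast
      then show "H \<subseteq> H'" by auto
      have "0 + 1 *\<^sub>R v \<in> H'" unfolding H'_def using subspace_0[OF Hs] by blast
      then show "v \<in> H'" by simp
    qed
    have "br x y \<in> H" if xy: "x \<in> H'" "y \<in> H'" for x y
    proof -
      obtain m r m' r' where "x = m + r *\<^sub>R v" "y = m' + r' *\<^sub>R v" "m \<in> H" "m' \<in> H"
        using xy unfolding H'_def by blast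
      moreover have "br v m' \<in> H" using v(3)[of m'] skew[of v m'] \<open>m' \<in> H\<close> subspace_neg[OF Hs] by simp
      ultimately show ?thesis
        using Hb v(3) subspace_add[OF Hs] subspace_scale[OF Hs] by (simp add: br_simps self)
    qed
    then have sub: "\<forall>x\<in>H'. \<forall>y\<in>H'. br x y \<in> H'" using HH' by blast
    have subM: "H' \<subseteq> M"
      using HM v(1) subspace_add[OF M(1)] subspace_scale[OF M(1)] by (auto simp: H'_def)
    have M_eq: "H' = M"
    proof (rule ccontr)
      assume "H' \<noteq> M"
      then have "Q H'" unfolding Q_def using H's sub subM by (intro conjI psubsetI)
      from max[OF this] subspace_dim_equal[OF Hs H's HH'] have "H = H'" by simp
      then show False using vH' v(2) by simp
    qed
    have "\<exists>w\<in>V - U. \<forall>x\<in>H. \<rho> x w \<in> U"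
    proof (rule less.hyps[OF dimH Hs Hb \<rho>(1) _ _ UV])
      fix x y v assume x: "x \<in> H"
      then have "x \<in> M" using HM by auto
      show "\<exists>k. \<forall>v. (\<rho> x ^^ k) v = 0" using \<open>x \<in> M\<close> by (rule \<rho>(3))
      show "\<rho> x v \<in> V" if "v \<in> V" using \<open>x \<in> M\<close> that by (rule inv(1))
      show "\<rho> x v \<in> U" if "v \<in> U" using \<open>x \<in> M\<close> that by (rule inv(2))
      assume "y \<in> H"
      then have "y \<in> M" using HM by auto
      with \<open>x \<in> M\<close> show "\<rho> (br x y) v = \<rho> x (\<rho> y v) - \<rho> y (\<rho> x v)" by (rule \<rho>(2))
    qed
    then obtain w0 where w0: "w0 \<in> V" "w0 \<notin> U" "\<And>x. x \<in> H \<Longrightarrow> \<rho> x w0 \<in> U" by blast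
    \<comment> \<open>The space of vectors of \<open>V\<close> that \<open>H\<close> sends to \<open>U\<close> is stable under \<open>\<rho> v\<close>, as \<open>v\<close> normalises \<open>H\<close>.\<close>
    have W: "(\<rho> v ^^ j) w0 \<in> V \<and> (\<forall>x\<in>H. \<rho> x ((\<rho> v ^^ j) w0) \<in> U)" for j
    proof (induction j)
      case 0
      then show ?case using w0 by simp
    next
      case (Suc j)
      let ?w = "(\<rho> v ^^ j) w0"
      have "\<rho> x (\<rho> v ?w) \<in> U" if x: "x \<in> H" for x
      proof -
        have "x \<in> M" using x HM by auto
        then have "\<rho> x (\<rho> v ?w) = \<rho> v (\<rho> x ?w) + \<rho> (br x v) ?w" using \<rho>(2)[of x v ?w] v(1) by simp
        then show ?thesis using Suc x v inv(2) subspace_add[OF UV(1)] by simp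
      qed
      then show ?case using Suc inv(1)[OF v(1)] by simp
    qed
    obtain k where "\<forall>u. (\<rho> v ^^ k) u = 0" using \<rho>(3)[OF v(1)] by blast
    then have ex: "(\<rho> v ^^ k) w0 \<in> U" using subspace_0[OF UV(1)] by simp
    define j where "j = (LEAST k. (\<rho> v ^^ k) w0 \<in> U)"
    have j: "(\<rho> v ^^ j) w0 \<in> U" unfolding j_def using ex by (rule LeastI)
    then have "j \<noteq> 0" using w0(2) by (cases j) auto
    then obtain i where i: "j = Suc i" by (cases j) auto
    have "(\<rho> v ^^ i) w0 \<notin> U" using not_less_Least[of i "\<lambda>k. (\<rho> v ^^ k) w0 \<in> U"] i by (simp add: j_def)
    moreover have "\<rho> x ((\<rho> v ^^ i) w0) \<in> U" if x: "x \<in> M" for x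
    proof -
      obtain m r where "x = m + r *\<^sub>R v" "m \<in> H" using x M_eq by (auto simp: H'_def)
      then show ?thesis
        using W[of i] j i subspace_add[OF UV(1)] subspace_scale[OF UV(1)]
        by (simp add: bilinear_ladd[OF \<rho>(1)] bilinear_lmul[OF \<rho>(1)])
    qed
    ultimately show ?thesis using W[of i] by blast
  qed
qed

text \<open>Engel's theorem for the coadjoint representation (with \<open>\<gg>\<^sup>*\<close> identified with \<open>\<gg>\<close> by the Euclidean inner product) and
  the annihilator \<open>U\<close> of \<open>[\<gg>,\<gg>]\<close>: if \<open>[\<gg>,\<gg>] \<noteq> 0\<close>, some functional is nonzero on \<open>[\<gg>,\<gg>]\<close> but zero on
  \<open>[\<gg>,[\<gg>,\<gg>]]\<close>. The hypothesis \<open>perfect\<close> says that these two spaces are equal.\<close>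

lemma engel_perfect:
  assumes ad_nilpotent: "\<And>x. \<exists>k. \<forall>v. (br x ^^ k) v = 0"
    and perfect: "\<And>u v. \<exists>w \<in> span {br a b | a b. True}. br u v = br u w"
  shows "br u v = 0"
proof (rule ccontr)
  define h where "h = span {br a b | a b. True}"
  have hb: "br a b \<in> h" for a b unfolding h_def by (rule span_base) blast
  assume ne: "br u v \<noteq> 0"
  define \<rho> where "\<rho> x v = - adjoint (br x) v" for x v
  have adj: "w \<bullet> \<rho> x v = - (br x w \<bullet> v)" for w x v
    by (simp add: \<rho>_def adjoint_works[OF linear_br])
  have eqI: "a = b" if "\<And>w. w \<bullet> a = w \<bullet> b" for a b :: 'a
    using that by (metis vector_eq_rdot inner_commute)
  have bil: "bilinear \<rho>"
    unfolding bilinear_def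
  proof (intro conjI allI linearI)
  qed (rule eqI, simp add: adj br_simps inner_simps algebra_simps)+
  have rep: "\<rho> (br x y) v = \<rho> x (\<rho> y v) - \<rho> y (\<rho> x v)" for x y v
    by (rule eqI) (simp add: adj inner_diff_right br_br inner_diff_left)
  have nil: "\<exists>k. \<forall>v. (\<rho> x ^^ k) v = 0" for x
  proof -
    have pow: "w \<bullet> (\<rho> x ^^ k) v = (- 1) ^ k * ((br x ^^ k) w \<bullet> v)" for k w v
    proof (induction k arbitrary: w)
      case (Suc k)
      have "(br x ^^ k) (br x w) = br x ((br x ^^ k) w)" by (simp add: funpow_swap1)
      then show ?case using Suc[of "br x w"] by (simp add: adj)
    qed simp
    obtain k where "\<forall>v. (br x ^^ k) v = 0" using ad_nilpotent by blast
    then have "(\<rho> x ^^ k) v = 0" for v by (intro eqI) (simp add: pow)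
    then show ?thesis by blast
  qed
  define U where "U = {v. \<forall>w\<in>h. w \<bullet> v = 0}"
  have U: "subspace U" unfolding U_def by (auto simp: subspace_def inner_simps)
  have "br u v \<notin> U" using hb[of u v] ne by (force simp: U_def)
  then have "U \<subset> UNIV" by auto
  have "\<exists>v\<in>UNIV - U. \<forall>x\<in>UNIV. \<rho> x v \<in> U"
    by (rule engel[OF ad_nilpotent subspace_UNIV _ bil rep nil U subspace_UNIV \<open>U \<subset> UNIV\<close>])
      (auto simp: U_def adj hb)
  then obtain l where l: "l \<notin> U" "\<And>x. \<rho> x l \<in> U" by blast
  have "br a b \<bullet> l = 0" for a b
  proof -
    obtain w where "w \<in> h" "br a b = br a w" using perfect[of a b] by (auto simp: h_def)
    then show ?thesis using l(2)[of a] adj[of w a l] by (simp add: U_def)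
  qed
  then have "h \<subseteq> {w. w \<bullet> l = 0}"
    unfolding h_def by (intro span_minimal) (auto simp: subspace_def inner_simps)
  then show False using l(1) by (auto simp: U_def)
qed

end


section \<open>One-parameter groups of linear maps\<close>

text \<open>The exponential series \<open>exp(t T) v\<close>, summed coordinate by coordinate so that it can be
  differentiated as a real power series.\<close>

definition exp_flow :: "('a \<Rightarrow> 'a) \<Rightarrow> real \<Rightarrow> 'a::euclidean_space \<Rightarrow> 'a" where
  "exp_flow T t v = (\<Sum>b\<in>Basis. (\<Sum>n. (((T ^^ n) v \<bullet> b) / fact n) * t ^ n) *\<^sub>R b)"

lemma linear_funpow: "linear T \<Longrightarrow> linear (T ^^ n)" for T :: "'a::real_vector \<Rightarrow> 'a"
  by (induction n) (simp_all add: linear_id linear_compose)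

context
  fixes T :: "'a::euclidean_space \<Rightarrow> 'a"
  assumes T: "linear T"
begin

lemma summable_exp_flow: "summable (\<lambda>n. (((T ^^ n) v \<bullet> b) / fact n) * t ^ n)"
proof -
  obtain K where K: "K > 0" "\<And>v. norm (T v) \<le> K * norm v"
    using linear_bounded_pos[OF T] by blast
  have pow: "norm ((T ^^ n) v) \<le> K ^ n * norm v" for n
  proof (induction n)
    case (Suc n)
    have "norm (T ((T ^^ n) v)) \<le> K * norm ((T ^^ n) v)" by (rule K)
    also have "\<dots> \<le> K * (K ^ n * norm v)" using Suc K(1) by simp
    finally show ?case by simp
  qed simp
  have "summable (\<lambda>n. (norm v * norm b) * (inverse (fact n) * (K * \<bar>t\<bar>) ^ n))"
    by (intro summable_mult summable_exp)
  then show ?thesis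
  proof (rule summable_comparison_test')
    fix n :: nat
    have "\<bar>(T ^^ n) v \<bullet> b\<bar> \<le> (K ^ n * norm v) * norm b"
      using Cauchy_Schwarz_ineq2[of "(T ^^ n) v" b] mult_right_mono[OF pow norm_ge_zero, of n b] by linarith
    then have "\<bar>(T ^^ n) v \<bullet> b\<bar> * (\<bar>t\<bar> ^ n / fact n) \<le> (K ^ n * norm v) * norm b * (\<bar>t\<bar> ^ n / fact n)"
      by (intro mult_right_mono) auto
    then show "norm ((((T ^^ n) v \<bullet> b) / fact n) * t ^ n) \<le> (norm v * norm b) * (inverse (fact n) * (K * \<bar>t\<bar>) ^ n)"
      by (simp add: abs_mult power_abs power_mult_distrib field_simps)
  qed
qed

lemma exp_flow_0: "exp_flow T 0 v = v"
  unfolding exp_flow_def powser_zero by (simp add: euclidean_representation)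

lemma linear_exp_flow: "linear (exp_flow T t)"
proof (rule linearI)
  fix u v
  have "(\<Sum>n. (((T ^^ n) (u + v) \<bullet> b) / fact n) * t ^ n)
      = (\<Sum>n. (((T ^^ n) u \<bullet> b) / fact n) * t ^ n) + (\<Sum>n. (((T ^^ n) v \<bullet> b) / fact n) * t ^ n)" for b
    by (subst suminf_add[OF summable_exp_flow summable_exp_flow])
      (simp add: linear_add[OF linear_funpow[OF T]] inner_add_left add_divide_distrib distrib_right)
  then show "exp_flow T t (u + v) = exp_flow T t u + exp_flow T t v"
    by (simp add: exp_flow_def scaleR_add_left sum.distrib)
next
  fix r v
  have "(\<Sum>n. (((T ^^ n) (r *\<^sub>R v) \<bullet> b) / fact n) * t ^ n)
      = r * (\<Sum>n. (((T ^^ n) v \<bullet> b) / fact n) * t ^ n)" for b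
    by (subst suminf_mult[OF summable_exp_flow, symmetric])
      (simp add: linear_cmul[OF linear_funpow[OF T]] mult.assoc)
  then show "exp_flow T t (r *\<^sub>R v) = r *\<^sub>R exp_flow T t v"
    by (simp add: exp_flow_def scaleR_sum_right)
qed

lemma exp_flow_has_vector_derivative:
  "((\<lambda>t. exp_flow T t v) has_vector_derivative exp_flow T t (T v)) (at t)"
proof -
  have "((\<lambda>t. \<Sum>n. (((T ^^ n) v \<bullet> b) / fact n) * t ^ n) has_real_derivative
      (\<Sum>n. (((T ^^ n) (T v) \<bullet> b) / fact n) * t ^ n)) (at t)" for b
  proof -
    have "diffs (\<lambda>n. ((T ^^ n) v \<bullet> b) / fact n) = (\<lambda>n. ((T ^^ n) (T v) \<bullet> b) / fact n)"
      by (rule ext) (simp add: diffs_def funpow_swap1 field_simps del: of_nat_Suc)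
    with termdiffs_strong_converges_everywhere[of "\<lambda>n. ((T ^^ n) v \<bullet> b) / fact n" t, OF summable_exp_flow]
    show ?thesis by simp
  qed
  then show ?thesis
    unfolding exp_flow_def by (intro has_vector_derivative_sum has_vector_derivative_scaleR[THEN has_vector_derivative_eq_rhs] has_vector_derivative_const) (auto simp: has_real_derivative_iff_has_vector_derivative)
qed

lemma T_exp_flow: "T (exp_flow T t v) = exp_flow T t (T v)"
proof -
  have "T (exp_flow T t v) \<bullet> b = exp_flow T t (T v) \<bullet> b" if b: "b \<in> Basis" for b
  proof -
    \<comment> \<open>The matrix entries \<open>T b' \<bullet> b\<close> are moved through the series.\<close>
    let ?c = "\<lambda>v b' n. (((T ^^ n) v \<bullet> b') / fact n) * t ^ n"
    have "T (exp_flow T t v) \<bullet> b = (\<Sum>b'\<in>Basis. (\<Sum>n. ?c v b' n) * (T b' \<bullet> b))"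
      by (simp add: exp_flow_def linear_sum[OF T] linear_cmul[OF T] inner_sum_left)
    also have "\<dots> = (\<Sum>b'\<in>Basis. (\<Sum>n. ?c v b' n * (T b' \<bullet> b)))"
      by (simp only: suminf_mult2[OF summable_exp_flow])
    also have "\<dots> = (\<Sum>n. \<Sum>b'\<in>Basis. ?c v b' n * (T b' \<bullet> b))"
      by (rule suminf_sum[symmetric]) (rule summable_mult2[OF summable_exp_flow])
    also have "(\<lambda>n. \<Sum>b'\<in>Basis. ?c v b' n * (T b' \<bullet> b)) = ?c (T v) b"
    proof (rule ext)
      fix n
      have "T ((T ^^ n) v) = T (\<Sum>b'\<in>Basis. ((T ^^ n) v \<bullet> b') *\<^sub>R b')" by (simp add: euclidean_representation)
      also have "\<dots> = (\<Sum>b'\<in>Basis. ((T ^^ n) v \<bullet> b') *\<^sub>R T b')" by (simp add: linear_sum[OF T] linear_cmul[OF T])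
      finally have "(T ^^ n) (T v) \<bullet> b = (\<Sum>b'\<in>Basis. ((T ^^ n) v \<bullet> b') * (T b' \<bullet> b))"
        by (simp add: funpow_swap1 inner_sum_left)
      then show "(\<Sum>b'\<in>Basis. ?c v b' n * (T b' \<bullet> b)) = ?c (T v) b n"
        by (simp add: sum_divide_distrib sum_distrib_right sum_distrib_left field_simps)
    qed
    also have "(\<Sum>n. ?c (T v) b n) = exp_flow T t (T v) \<bullet> b"
      using b by (simp add: exp_flow_def inner_sum_left inner_Basis if_distrib cong: if_cong)
    finally show ?thesis .
  qed
  then show ?thesis by (rule euclidean_eqI)
qed

text \<open>The curve \<open>s \<mapsto> exp((t - s) T) (\<gamma> s)\<close> has derivative zero.\<close>

lemma exp_flow_unique_aux:
  assumes "\<And>s. (\<gamma> has_vector_derivative T (\<gamma> s)) (at s)"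
  shows "exp_flow T (t - s) (\<gamma> s) = exp_flow T t (\<gamma> 0)"
proof -
  have "((\<lambda>s. exp_flow T (t - s) (\<gamma> s)) has_vector_derivative 0) (at s)" for s
  proof -
    have 1: "((\<lambda>s. exp_flow T (t - s) v) has_derivative (\<lambda>h. h *\<^sub>R (- exp_flow T (t - s) (T v)))) (at s)" for v
    proof -
      have "((\<lambda>s. t - s) has_vector_derivative - 1) (at s)"
        by (auto intro!: derivative_eq_intros)
      from vector_diff_chain_at[OF this exp_flow_has_vector_derivative[of v "t - s"]]
      show ?thesis by (simp add: has_vector_derivative_def o_def)
    qed
    have "((\<lambda>s. exp_flow T (t - s) (\<gamma> s)) has_derivative
        (\<lambda>h. h *\<^sub>R (- exp_flow T (t - s) (T (\<gamma> s))) + exp_flow T (t - s) (h *\<^sub>R T (\<gamma> s)))) (at s)"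
      by (rule has_derivative_apply[where M="\<lambda>s. exp_flow T (t - s)", OF open_UNIV UNIV_I linear_exp_flow 1])
        (use assms in \<open>simp add: has_vector_derivative_def\<close>)
    then show ?thesis by (simp add: has_vector_derivative_def linear_cmul[OF linear_exp_flow])
  qed
  then have "(\<lambda>s. exp_flow T (t - s) (\<gamma> s)) s = (\<lambda>s. exp_flow T (t - s) (\<gamma> s)) 0"
    using has_vector_derivative_zero_constant[of UNIV "\<lambda>s. exp_flow T (t - s) (\<gamma> s)"]
    by (metis UNIV_I convex_UNIV)
  then show ?thesis by simp
qed

lemma exp_flow_unique:
  assumes "\<And>s. (\<gamma> has_vector_derivative T (\<gamma> s)) (at s)"
  shows "\<gamma> t = exp_flow T t (\<gamma> 0)"
  using exp_flow_unique_aux[OF assms, where t=t and s=t] by (simp add: exp_flow_0)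

lemma exp_flow_has_vector_derivative':
  "((\<lambda>t. exp_flow T t v) has_vector_derivative T (exp_flow T t v)) (at t)"
  unfolding T_exp_flow by (rule exp_flow_has_vector_derivative)

lemma exp_flow_inverse: "exp_flow T (- t) (exp_flow T t v) = v"
  using exp_flow_unique_aux[where \<gamma>="\<lambda>t. exp_flow T t v", OF exp_flow_has_vector_derivative', of 0 t]
  by (simp add: exp_flow_0)

text \<open>Both sides solve \<open>\<gamma>' = T \<gamma>\<close> with the same initial value.\<close>

lemma exp_flow_derivation:
  assumes br: "bilinear br" and der: "\<And>x y. T (br x y) = br (T x) y + br x (T y)"
  shows "exp_flow T t (br x y) = br (exp_flow T t x) (exp_flow T t y)"
proof -
  let ?\<gamma> = "\<lambda>s. br (exp_flow T s x) (exp_flow T s y)"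
  have "(?\<gamma> has_vector_derivative T (?\<gamma> s)) (at s)" for s
  proof -
    have "bounded_bilinear br" using br bilinear_conv_bounded_bilinear by blast
    from bounded_bilinear.has_vector_derivative[OF this exp_flow_has_vector_derivative' exp_flow_has_vector_derivative']
    show ?thesis by (simp add: der add.commute)
  qed
  from exp_flow_unique[OF this, of t] show ?thesis by (simp add: exp_flow_0)
qed

end


section \<open>Minimisers of a Minkowski norm\<close>

context minkowski
begin

text \<open>A Minkowski norm is bounded below by a positive multiple of the Euclidean norm, so its sublevel
  sets are compact.\<close>

lemma exists_minimiser:
  assumes C: "closed C" "C \<noteq> {}"
  shows "\<exists>z\<in>C. \<forall>x\<in>C. N z \<le> N x"
proof -
  have cont: "continuous_on T N" for T
    using minkowski_norm continuous_on_subset unfolding minkowski_norm_def by blast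
  have hom: "N (r *\<^sub>R y) = r * N y" if "r \<ge> 0" for r y using minkowski_norm that by (simp add: minkowski_norm_def)
  have pos: "N y > 0" if "y \<noteq> 0" for y using minkowski_norm that by (simp add: minkowski_norm_def)
  have "sphere (0::'a) 1 \<noteq> {}" by simp
  then obtain e where e: "e \<in> sphere 0 1" and min: "\<And>u. u \<in> sphere 0 1 \<Longrightarrow> N e \<le> N u"
    using continuous_attains_inf[OF compact_sphere _ cont] by blast
  have e0: "N e > 0" using e by (intro pos) auto
  have coercive: "N e * norm x \<le> N x" for x
  proof (cases "x = 0")
    case True
    then show ?thesis using hom[of 0 0] by simp
  next
    case False
    then have "N e \<le> N (x /\<^sub>R norm x)" by (intro min) simp
    from mult_right_mono[OF this norm_ge_zero[of x]]
    have "N e * norm x \<le> N (x /\<^sub>R norm x) * norm x" .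
    also have "\<dots> = N x" using False hom[of "inverse (norm x)" x] by simp
    finally show ?thesis .
  qed
  obtain c where c: "c \<in> C" using C by blast
  let ?K = "C \<inter> cball 0 (N c / N e)"
  have inK: "c \<in> ?K" using c coercive[of c] e0 by (simp add: field_simps)
  have "compact ?K" using C by (simp add: closed_Int_compact)
  then obtain z where z: "z \<in> ?K" and zmin: "\<And>x. x \<in> ?K \<Longrightarrow> N z \<le> N x"
    using continuous_attains_inf[OF _ _ cont, of ?K] inK by blast
  have "N z \<le> N x" if "x \<in> C" for x
  proof (cases "x \<in> ?K")
    case False
    then have "N c / N e < norm x" using that by simp
    then have "N c < N e * norm x" using e0 by (simp add: field_simps)
    then show ?thesis using coercive[of x] zmin[OF inK] by linarith
  qed (rule zmin)
  then show ?thesis using z by blast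
qed

lemma minimiser_along_curve:
  assumes z: "z \<noteq> 0" and \<gamma>: "(\<gamma> has_vector_derivative w) (at 0)" and \<gamma>0: "\<gamma> 0 = z"
    and min: "\<And>t. N z \<le> N (\<gamma> t)"
  shows "g z z w = 0"
proof -
  have "((\<lambda>t. Nsq (\<gamma> t)) has_derivative (\<lambda>t. fd Nsq (\<gamma> 0) (t *\<^sub>R w))) (at 0)"
    using \<gamma> by (intro fd_compose) (simp_all add: \<gamma>0 z Nsq_differentiable has_vector_derivative_def)
  then have "((\<lambda>t. Nsq (\<gamma> t)) has_real_derivative fd Nsq z w) (at 0)"
    using linear_cmul[OF fd_linear[OF Nsq_differentiable[OF z]]]
    by (simp add: has_field_derivative_def \<gamma>0 mult_commute_abs)
  moreover have "Nsq (\<gamma> 0) \<le> Nsq (\<gamma> t)" for t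
    using min[of t] minkowski_norm by (simp add: \<gamma>0 minkowski_norm_def power_mono)
  ultimately have "fd Nsq z w = 0"
    using DERIV_local_min[of "\<lambda>t. Nsq (\<gamma> t)" "fd Nsq z w" 0 1] by simp
  then show ?thesis by (simp add: fd_Nsq[OF z])
qed

end


section \<open>Geodesic vectors and the centre\<close>

text \<open>The powers of \<open>A\<close> are linearly dependent; a relation between them is normalised by its lowest
  nonzero coefficient.\<close>

lemma annihilating_relation:
  fixes A :: "real^'n \<Rightarrow> real^'n"
  assumes A: "linear A"
  shows "\<exists>k d c. c 0 = (1::real) \<and> (\<forall>v. (\<Sum>i\<le>d. c i *\<^sub>R (A ^^ i) ((A ^^ k) v)) = 0)"
proof -
  define m where "m = DIM(real^'n^'n)"
  define P where "P i = matrix (A ^^ i)" for i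
  have P: "P i *v v = (A ^^ i) v" for i v
    using matrix_works[of "A ^^ i" v] linear_funpow[OF A] by (simp add: P_def)
  have "\<exists>c. (\<exists>i\<le>m. c i \<noteq> (0::real)) \<and> (\<Sum>i\<le>m. c i *\<^sub>R P i) = 0"
  proof (cases "inj_on P {..m}")
    case True
    then have "card (P ` {..m}) = Suc m" by (simp add: card_image)
    then have "dependent (P ` {..m})" using independent_bound[of "P ` {..m}"] by (auto simp: m_def)
    then obtain u where u: "\<exists>v\<in>P ` {..m}. u v \<noteq> 0" "(\<Sum>v\<in>P ` {..m}. u v *\<^sub>R v) = 0"
      using dependent_finite[of "P ` {..m}"] by auto
    from u(2) have "(\<Sum>i\<le>m. u (P i) *\<^sub>R P i) = 0" by (simp add: sum.reindex[OF True])
    then show ?thesis using u(1) by (intro exI[of _ "\<lambda>i. u (P i)"]) auto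
  next
    case False
    then obtain i j where ij: "i \<le> m" "j \<le> m" "i \<noteq> j" "P i = P j" by (auto simp: inj_on_def)
    \<comment> \<open>Two powers coincide: their difference is the relation.\<close>
    define c where "c l = (if l = i then 1 else 0) - (if l = j then 1 else (0::real))" for l
    have "(\<Sum>l\<le>m. c l *\<^sub>R P l) = P i - P j"
      using ij by (simp add: c_def scaleR_diff_left sum_subtractf if_distrib[of "\<lambda>r. r *\<^sub>R _"] cong: if_cong)
    then show ?thesis using ij by (intro exI[of _ c]) (auto simp: c_def)
  qed
  then obtain c where c: "\<exists>i\<le>m. c i \<noteq> (0::real)" "(\<Sum>i\<le>m. c i *\<^sub>R P i) = 0" by blast
  define k where "k = (LEAST i. c i \<noteq> 0)"
  have ck: "c k \<noteq> 0" unfolding k_def using c(1) by (metis (mono_tags, lifting) LeastI)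
  have low: "c i = 0" if "i < k" for i using not_less_Least[of i "\<lambda>i. c i \<noteq> 0"] that by (auto simp: k_def)
  have km: "k \<le> m" using c(1) low by (meson leI le_trans)
  have "(\<Sum>i\<le>m - k. (c (i + k) / c k) *\<^sub>R (A ^^ i) ((A ^^ k) v)) = 0" for v
  proof -
    have "0 = (\<Sum>i\<le>m. c i *\<^sub>R P i) *v v" using c(2) by simp
    also have "\<dots> = (\<Sum>i\<le>m. c i *\<^sub>R (A ^^ i) v)"
    proof -
      have l: "linear (\<lambda>M::real^'n^'n. M *v v)"
        by (simp add: linear_iff matrix_vector_mult_add_rdistrib scaleR_matrix_vector_assoc)
      show ?thesis by (simp only: linear_sum[OF l] linear_cmul[OF l] P)
    qed
    also have "\<dots> = (\<Sum>i\<in>{k..m}. c i *\<^sub>R (A ^^ i) v)"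
      by (rule sum.mono_neutral_right) (auto simp: low)
    also have "\<dots> = (\<Sum>i\<le>m - k. c (i + k) *\<^sub>R (A ^^ (i + k)) v)"
      using km sum.shift_bounds_cl_nat_ivl[of "\<lambda>i. c i *\<^sub>R (A ^^ i) v" 0 k "m - k"] by (simp add: atLeast0AtMost)
    finally have "(\<Sum>i\<le>m - k. c (i + k) *\<^sub>R (A ^^ i) ((A ^^ k) v)) = 0" by (simp add: funpow_add)
    then have "(1 / c k) *\<^sub>R (\<Sum>i\<le>m - k. c (i + k) *\<^sub>R (A ^^ i) ((A ^^ k) v)) = 0" by simp
    then show ?thesis by (simp add: scaleR_sum_right)
  qed
  then show ?thesis using ck by (intro exI[of _ k] exI[of _ "m - k"] exI[of _ "\<lambda>i. c (i + k) / c k"]) simp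
qed

text \<open>The vectors \<open>z\<close> in the following hypothesis are the geodesic vectors: those for which
  \<open>t \<mapsto> exp(t z)\<close> is a geodesic of the left-invariant metric defined by \<open>N\<close>.\<close>

locale central_geodesic_vectors = real_lie_algebra br + minkowski N
  for br :: "real^'n \<Rightarrow> real^'n \<Rightarrow> real^'n" and N :: "real^'n \<Rightarrow> real" +
  assumes geodesic_central: "z \<noteq> 0 \<Longrightarrow> (\<And>u. g z z (br u z) = 0) \<Longrightarrow> br z v = 0"
begin

lemma ad_derivation: "br u (br x y) = br (br u x) y + br x (br u y)"
  by (simp add: br_br)

text \<open>With \<open>q\<close> the polynomial of \<open>annihilating_relation\<close> for \<open>ad y\<close>, the level set of
  \<open>z \<mapsto> det q(ad z)\<close> through \<open>y\<close> is invariant under the automorphisms \<open>exp(t ad u)\<close>, and a minimiser of \<open>N\<close> on it is zero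
  or a geodesic vector. In both cases it is central, so the level is \<open>det q(0) = 1\<close>; thus
  \<open>q(ad y)\<close> is invertible and the factor \<open>(ad y)\<^sup>k\<close> of the relation vanishes.\<close>

lemma ad_nilpotent: "\<exists>k. \<forall>v. (br y ^^ k) v = 0"
proof -
  obtain k d c where c0: "c 0 = (1::real)"
    and ann: "\<And>v. (\<Sum>i\<le>d. c i *\<^sub>R (br y ^^ i) ((br y ^^ k) v)) = 0"
    using annihilating_relation[OF linear_br] by blast
  define q where "q z v = (\<Sum>i\<le>d. c i *\<^sub>R (br z ^^ i) v)" for z v
  define \<phi> where "\<phi> z = det (matrix (q z))" for z
  have q_linear: "linear (q z)" for z
    unfolding q_def[abs_def] by (intro linear_compose_sum ballI linear_compose_scale_right linear_funpow[OF linear_br])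
  have bb: "bounded_bilinear br" using bilinear bilinear_conv_bounded_bilinear by blast
  have "continuous_on UNIV (\<lambda>z. (br z ^^ i) v)" for i v
    by (induction i) (simp_all add: bounded_bilinear.continuous_on[OF bb] continuous_on_id)
  then have "continuous_on UNIV (\<lambda>z. q z v)" for v
    unfolding q_def by (intro continuous_on_sum continuous_on_scaleR continuous_on_const)
  then have "continuous_on UNIV \<phi>"
    unfolding \<phi>_def[abs_def] det_def matrix_def
    by (auto intro!: continuous_on_sum continuous_on_mult continuous_on_const continuous_on_prod continuous_on_component)
  define C where "C = {z. \<phi> z = \<phi> y}"
  have "closed C" unfolding C_def using \<open>continuous_on UNIV \<phi>\<close> by (intro closed_Collect_eq) auto
  then obtain z where z: "z \<in> C" and zmin: "\<And>x. x \<in> C \<Longrightarrow> N z \<le> N x"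
    using exists_minimiser[of C] by (auto simp: C_def)
  have invariant: "\<phi> (exp_flow (br u) t x) = \<phi> x" for u t x
  proof -
    let ?E = "exp_flow (br u) t"
    have E: "linear ?E" by (rule linear_exp_flow[OF linear_br])
    have hom: "br (?E x) (?E v) = ?E (br x v)" for v
      by (rule exp_flow_derivation[where T="br u" and br=br, OF linear_br bilinear ad_derivation, symmetric])
    have pow: "(br (?E x) ^^ i) (?E v) = ?E ((br x ^^ i) v)" for i v
      by (induction i) (simp_all add: hom)
    have "q (?E x) (?E v) = ?E (q x v)" for v
      by (simp add: q_def pow linear_sum[OF E] linear_cmul[OF E])
    then have "q (?E x) \<circ> ?E = ?E \<circ> q x" by auto
    then have "matrix (q (?E x)) ** matrix ?E = matrix ?E ** matrix (q x)"
      using matrix_compose[OF E q_linear] matrix_compose[OF q_linear E] by metis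
    then have "det (matrix (q (?E x))) * det (matrix ?E) = det (matrix ?E) * det (matrix (q x))"
      by (metis det_mul)
    moreover have "det (matrix ?E) \<noteq> 0"
    proof -
      have "?E v = 0 \<Longrightarrow> v = 0" for v
        using exp_flow_inverse[OF linear_br, of u t v] linear_0[OF linear_exp_flow[OF linear_br]] by metis
      then show ?thesis
        using E by (simp add: det_nonzero_iff matrix_works)
    qed
    ultimately show ?thesis by (simp add: \<phi>_def)
  qed
  have central: "br z v = 0" for v
  proof (cases "z = 0")
    case False
    have "g z z (br u z) = 0" for u
    proof (rule minimiser_along_curve[OF False])
      show "((\<lambda>t. exp_flow (br u) t z) has_vector_derivative br u z) (at 0)"
        using exp_flow_has_vector_derivative'[OF linear_br, of u z 0] by (simp add: exp_flow_0[OF linear_br])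
      show "exp_flow (br u) 0 z = z" by (rule exp_flow_0[OF linear_br])
      show "N z \<le> N (exp_flow (br u) t z)" for t using z by (intro zmin) (simp add: C_def invariant)
    qed
    then show ?thesis using geodesic_central[OF False] by blast
  qed (simp add: br_simps)
  have "q z v = v" for v
  proof -
    have "(br z ^^ i) v = (if i = 0 then v else 0)" for i by (cases i) (simp_all add: central)
    then have "q z v = (\<Sum>i\<le>d. if i = 0 then v else 0)" unfolding q_def by (intro sum.cong) (auto simp: c0)
    then show ?thesis by simp
  qed
  then have "q z = id" by auto
  then have "\<phi> z = 1" by (simp add: \<phi>_def matrix_id_mat_1)
  then have "det (matrix (q y)) \<noteq> 0" using z by (simp add: C_def \<phi>_def)
  then have "\<forall>v. matrix (q y) *v v = 0 \<longrightarrow> v = 0"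
    by (simp add: det_nonzero_iff)
  moreover have "matrix (q y) *v ((br y ^^ k) v) = 0" for v
    using ann[of v] q_linear[of y] by (simp add: matrix_works q_def)
  ultimately show ?thesis by blast
qed

text \<open>A nonzero minimiser of \<open>N\<close> on the coset \<open>y + [\<gg>,\<gg>]\<close> is orthogonal to \<open>[\<gg>,\<gg>]\<close> and is therefore a
  geodesic vector.\<close>

lemma exists_central_mod_derived:
  "\<exists>w \<in> span {br a b | a b. True}. \<forall>v. br (y - w) v = 0"
proof -
  define h where "h = span {br a b | a b. True}"
  have hb: "br a b \<in> h" for a b unfolding h_def by (rule span_base) blast
  have "closed ((+) y ` h)" unfolding h_def by (intro closed_translation closed_subspace subspace_span)
  moreover have "0 \<in> h" unfolding h_def by (rule span_zero)
  then have "(+) y ` h \<noteq> {}" by auto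
  ultimately obtain z where "z \<in> (+) y ` h" and zmin: "\<And>x. x \<in> (+) y ` h \<Longrightarrow> N z \<le> N x"
    using exists_minimiser[of "(+) y ` h"] by metis
  then obtain w where w: "w \<in> h" "z = y + w" by auto
  have "br z v = 0" for v
  proof (cases "z = 0")
    case False
    have "g z z (br u z) = 0" for u
    proof (rule minimiser_along_curve[OF False, where \<gamma>="\<lambda>t. z + t *\<^sub>R br u z"])
      show "((\<lambda>t. z + t *\<^sub>R br u z) has_vector_derivative br u z) (at 0)"
        by (auto intro!: derivative_eq_intros)
      show "N z \<le> N (z + t *\<^sub>R br u z)" for t
      proof (rule zmin)
        have "w + t *\<^sub>R br u z \<in> h"
          using w(1) hb[of u z] unfolding h_def by (intro span_add span_scale)
        then show "z + t *\<^sub>R br u z \<in> (+) y ` h" using w(2) by (auto simp: add.assoc)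
      qed
    qed simp
    then show ?thesis using geodesic_central[OF False] by blast
  qed (simp add: br_simps)
  then show ?thesis using w span_neg[of w] unfolding h_def by (intro bexI[of _ "- w"]) auto
qed

theorem abelian: "br u v = 0"
proof (rule engel_perfect[OF ad_nilpotent])
  fix u v
  obtain w where w: "w \<in> span {br a b | a b. True}" "br (v - w) u = 0"
    using exists_central_mod_derived by blast
  then have "br u v = br u w" using skew[of "v - w" u] by (simp add: br_simps)
  then show "\<exists>w\<in>span {br a b |a b. True}. br u v = br u w" using w(1) by blast
qed

end

text \<open>The operator \<open>D\<close> in the last hypothesis stands for the derivative at \<open>y\<close> of the spray vector
  field \<open>\<eta>\<close> introduced below; its second property says that the curvature operator
  \<open>R\<^sub>y = D A - (A + D)\<^sup>2/4\<close>, with \<open>A = ad y\<close>, has zero quadratic form.\<close>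

theorem cyclic_flat_imp_abelian:
  fixes br :: "real^'n \<Rightarrow> real^'n \<Rightarrow> real^'n"
  assumes "real_lie_algebra br" and "minkowski_norm N"
    and cyclic: "\<And>x y z. y \<noteq> 0 \<Longrightarrow> fundamental_tensor N y (br x y) z
      + fundamental_tensor N y (br y z) x + fundamental_tensor N y (br z x) y = 0"
    and flat: "\<And>y. y \<noteq> 0 \<Longrightarrow> (\<And>u. fundamental_tensor N y y (br u y) = 0) \<Longrightarrow>
      \<exists>D. linear D \<and>
        (\<forall>u w. fundamental_tensor N y (D u) w
          = fundamental_tensor N y y (br w u) - fundamental_tensor N y u (br y w)) \<and>
        (\<forall>u. fundamental_tensor N y (D (br y u)
          - (1/4) *\<^sub>R (br y (br y u + D u) + D (br y u + D u))) u = 0)"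
  shows "br u v = 0"
proof -
  interpret real_lie_algebra br by fact
  interpret minkowski N by (unfold_locales) fact
  have "br y v = 0" if y: "y \<noteq> 0" and geo: "\<And>u. g y y (br u y) = 0" for y v
  proof -
    obtain D where D: "linear D" and gD: "\<And>u w. g y (D u) w = g y y (br w u) - g y u (br y w)"
      and R: "\<And>u. g y (D (br y u) - (1/4) *\<^sub>R (br y (br y u + D u) + D (br y u + D u))) u = 0"
      using flat[OF y geo] by blast
    interpret inner_form "g y"
      by unfold_locales (use y g_sym[OF y] g_pos[OF y] g_linear_left[OF y] g_linear_right[OF y] in \<open>auto simp: bilinear_def\<close>)
    define A where "A = br y"
    \<comment> \<open>As \<open>D = A - 2 A*\<close> for a cyclic metric, this is the adjoint of \<open>A\<close>.\<close>
    define C where "C w = (1/2) *\<^sub>R (A w - D w)" for w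
    have A: "linear A" unfolding A_def by (rule linear_br)
    have C: "linear C" unfolding C_def[abs_def]
      by (intro linear_compose_scale_right linear_compose_sub A D)
    have cyc: "g y y (br w u) = g y (A u) w - g y (A w) u" for u w
      using cyclic[OF y, of u w] skew[of u y] g_sym[OF y, of "br w u" y] by (simp add: A_def ip_simps bilinear_lneg[OF ip_bilinear])
    have adj: "g y (A u) w = g y u (C w)" for u w
    proof -
      have "g y (C w) u = 1/2 * (g y (A w) u - g y (D w) u)" by (simp add: C_def ip_simps)
      also have "\<dots> = g y (A u) w"
        using gD[of w u] cyc[of u w] cyc[of w u] skew[of u w] g_sym[OF y, of w "A u"]
        by (simp add: A_def ip_simps bilinear_rneg[OF ip_bilinear])
      finally show ?thesis using g_sym[OF y] by simp
    qed
    have Dw: "D w = A w - 2 *\<^sub>R C w" for w by (simp add: C_def)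
    have "A u = 0" for u
    proof (rule curvature_operator_rigid[OF A C adj])
      fix u w
      have "g y (A (A u)) w - g y (A (A w)) u = g y y (br w (A u)) + g y y (br (A w) u)"
        using cyc[where u="A u" and w=w] cyc[where u=u and w="A w"] g_sym[OF y, of "A u" "A w"] by simp
      also have "\<dots> = g y y (br y (br w u))"
        using ip_simps(2)[of y "br w (A u)" "br (A w) u"] br_br[of y w u] by (simp add: A_def add.commute)
      also have "\<dots> = 0" using geo[of "br w u"] skew[of y "br w u"] by (simp add: bilinear_rneg[OF ip_bilinear])
      finally show "g y (A (A u)) w = g y u (A (A w))" using g_sym[OF y, of u "A (A w)"] by simp
    next
      fix u
      have "D (A u) - (1/4) *\<^sub>R (A (A u + D u) + D (A u + D u)) = A (C u) - C (A u) - C (C u)"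
        unfolding Dw linear_add[OF A] linear_diff[OF A] linear_cmul[OF A] linear_add[OF C] linear_diff[OF C]
            linear_cmul[OF C] by (simp add: vec_eq_iff field_simps)
      then have "g y (A (C u) - C (A u) - C (C u)) u = 0" using R[of u] by (simp add: A_def)
      then show "g y (C u) (C u) - g y (A u) (A u) - g y (A (A u)) u = 0"
        using adj[of "C u" u] adj[of u "A u"] adj[of "A u" u] adj[of u "C u"] g_sym[OF y, of u "C (A u)"] g_sym[OF y, of u "C (C u)"]
        by (simp add: ip_simps)
    qed
    then show ?thesis by (simp add: A_def)
  qed
  then interpret central_geodesic_vectors br N by unfold_locales blast
  show ?thesis by (rule abelian)
qed


section \<open>Left-invariant frames\<close>

text \<open>The vector \<open>E x v\<close> is the value at \<open>x\<close> of the left-invariant field that has the value \<open>v\<close> at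
  the identity \<open>x0\<close>.\<close>

locale lie_frame =
  fixes S :: "(real^'n) set" and x0 :: "real^'n" and E :: "real^'n \<Rightarrow> real^'n \<Rightarrow> real^'n"
    and br :: "real^'n \<Rightarrow> real^'n \<Rightarrow> real^'n"
  assumes open_S: "open S" and x0: "x0 \<in> S"
    and E_linear: "\<And>x. x \<in> S \<Longrightarrow> linear (E x)"
    and E_smooth: "\<And>v. smooth_on S (\<lambda>x. E x v)"
    and E_x0: "\<And>v. E x0 v = v"
    and E_inj: "\<And>x v. x \<in> S \<Longrightarrow> E x v = 0 \<Longrightarrow> v = 0"
    and E_bracket: "\<And>x u v. x \<in> S \<Longrightarrow>
      fd (\<lambda>z. E z v) x (E x u) - fd (\<lambda>z. E z u) x (E x v) = E x (br u v)"
begin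

lemma br_eq: "br u v = fd (\<lambda>z. E z v) x0 u - fd (\<lambda>z. E z u) x0 v"
  using E_bracket[OF x0, of v u] E_x0 by simp

lemma E_differentiable: "x \<in> S \<Longrightarrow> (\<lambda>z. E z v) differentiable (at x)"
  using smooth_onD[OF E_smooth] .

lemma fd_E_linear: "x \<in> S \<Longrightarrow> linear (\<lambda>v. fd (\<lambda>z. E z v) x h)"
  using linear_fd_parameter[OF open_S _ E_linear E_differentiable] by blast

lemma br_linear_right: "linear (br u)"
  unfolding br_eq[abs_def]
  by (intro linear_compose_sub fd_E_linear[OF x0] fd_linear[OF E_differentiable[OF x0]])

lemma br_skew: "br u v = - br v u"
  by (simp add: br_eq)

lemma br_self: "br u u = 0"
  by (simp add: br_eq)

lemma br_linear_left: "linear (\<lambda>u. br u v)"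
  using linear_compose_neg[OF br_linear_right[of v]] by (simp flip: br_skew)

lemma br_bilinear: "bilinear br"
  by (simp add: bilinear_def br_linear_left br_linear_right)

text \<open>The Maurer--Cartan form: it carries a tangent vector at \<open>x\<close> back to the identity.\<close>

definition B :: "real^'n \<Rightarrow> real^'n \<Rightarrow> real^'n" where
  "B x w = solve_linear (matrix (E x)) w"

lemma E_mat: "x \<in> S \<Longrightarrow> matrix (E x) *v v = E x v"
  using E_linear by (simp add: matrix_works)

lemma det_E: "x \<in> S \<Longrightarrow> det (matrix (E x)) \<noteq> 0"
  using E_inj by (simp add: E_mat det_nonzero_iff)

lemma E_B: "x \<in> S \<Longrightarrow> E x (B x w) = w"
  using solve_linear_iff[OF det_E, of x "B x w" w] E_mat by (simp add: B_def)

lemma B_E: "x \<in> S \<Longrightarrow> B x (E x v) = v"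
  using solve_linear_iff[OF det_E, of x v "E x v"] E_mat by (simp add: B_def)

lemma B_eqI: "x \<in> S \<Longrightarrow> E x v = w \<Longrightarrow> B x w = v"
  using B_E by blast

lemma B_x0: "B x0 v = v"
  by (rule B_eqI[OF x0 E_x0])

lemma B_linear: "x \<in> S \<Longrightarrow> linear (B x)"
  by (rule linearI; rule B_eqI) (simp_all add: linear_add[OF E_linear] linear_cmul[OF E_linear] E_B)

lemma B_nonzero: "x \<in> S \<Longrightarrow> w \<noteq> 0 \<Longrightarrow> B x w \<noteq> 0"
  using E_B linear_0[OF E_linear] by metis

lemma B_smooth: "smooth_on S (\<lambda>x. B x w)"
proof -
  have "smooth_on S (\<lambda>x. matrix (E x) $ i $ j)" for i j
    using smooth_on_vec_nth[OF open_S E_smooth] by (simp add: matrix_def)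
  then show ?thesis unfolding B_def
    by (rule smooth_on_solve_linear[OF open_S _ smooth_on_const det_E])
qed

lemma B_differentiable: "x \<in> S \<Longrightarrow> (\<lambda>z. B z v) differentiable (at x)"
  using smooth_onD[OF B_smooth] .

lemma fd_B_linear: "x \<in> S \<Longrightarrow> linear (\<lambda>v. fd (\<lambda>z. B z v) x h)"
  using linear_fd_parameter[OF open_S _ B_linear B_differentiable] by blast

lemma fd_B_differentiable: "x \<in> S \<Longrightarrow> (\<lambda>z. fd (\<lambda>z. B z v) z h) differentiable (at x)"
  using smooth_onD[OF smooth_on_fd[OF B_smooth]] .

lemma E_fd_B:
  assumes x: "x \<in> S"
  shows "E x (fd (\<lambda>z. B z w) x h) = - fd (\<lambda>z. E z (B x w)) x h"
proof -
  have "((\<lambda>z. E z (B z w)) has_derivative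
      (\<lambda>h. fd (\<lambda>z. E z (B x w)) x h + E x (fd (\<lambda>z. B z w) x h))) (at x)"
    using has_derivative_apply_fd[OF open_S x E_linear E_differentiable[OF x]
        fd_works[OF B_differentiable[OF x, of w]]] .
  moreover have "((\<lambda>z. E z (B z w)) has_derivative (\<lambda>h. 0)) (at x)"
    by (rule has_derivative_transform_within_open[OF has_derivative_const open_S x]) (simp add: E_B)
  ultimately have "(\<lambda>h. fd (\<lambda>z. E z (B x w)) x h + E x (fd (\<lambda>z. B z w) x h)) = (\<lambda>h. 0)"
    by (rule has_derivative_unique)
  from fun_cong[OF this, of h] show ?thesis by (simp add: add_eq_0_iff)
qed

text \<open>The bracket relation of the frame, rewritten for its inverse by differentiating \<open>E B = 1\<close>.\<close>

lemma maurer_cartan: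
  assumes x: "x \<in> S"
  shows "fd (\<lambda>z. B z w) x u - fd (\<lambda>z. B z u) x w = - br (B x u) (B x w)"
proof -
  have "E x (fd (\<lambda>z. B z w) x u - fd (\<lambda>z. B z u) x w)
      = - (fd (\<lambda>z. E z (B x w)) x (E x (B x u)) - fd (\<lambda>z. E z (B x u)) x (E x (B x w)))"
    by (simp add: linear_diff[OF E_linear[OF x]] E_fd_B[OF x] E_B[OF x])
  also have "\<dots> = E x (- br (B x u) (B x w))"
    by (simp add: E_bracket[OF x] linear_neg[OF E_linear[OF x]])
  finally show ?thesis using B_E[OF x] by metis
qed

abbreviation dB :: "real^'n \<Rightarrow> real^'n \<Rightarrow> real^'n" where
  "dB h w \<equiv> fd (\<lambda>z. B z w) x0 h"

abbreviation ddB :: "real^'n \<Rightarrow> real^'n \<Rightarrow> real^'n \<Rightarrow> real^'n" where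
  "ddB h u w \<equiv> fd (\<lambda>x. fd (\<lambda>z. B z w) x u) x0 h"

lemma ddB_sym: "ddB h u w = ddB u h w"
  by (rule second_derivative_symmetric[OF open_S x0 B_smooth])

lemma maurer_cartan_deriv: "ddB h u w - ddB h w u = - (br (dB h u) w + br u (dB h w))"
proof -
  have "((\<lambda>x. fd (\<lambda>z. B z w) x u - fd (\<lambda>z. B z u) x w) has_derivative (\<lambda>h. ddB h u w - ddB h w u)) (at x0)"
    by (rule has_derivative_diff; rule fd_works[OF fd_B_differentiable[OF x0]])
  moreover have "bounded_bilinear br"
    using br_bilinear bilinear_conv_bounded_bilinear by blast
  then have "((\<lambda>x. br (B x u) (B x w)) has_derivative (\<lambda>h. br (B x0 u) (dB h w) + br (dB h u) (B x0 w))) (at x0)"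
    by (rule bounded_bilinear.FDERIV; intro fd_works[OF B_differentiable[OF x0]])
  then have "((\<lambda>x. - br (B x u) (B x w)) has_derivative (\<lambda>h. - (br u (dB h w) + br (dB h u) w))) (at x0)"
    unfolding B_x0 by (rule has_derivative_minus)
  then have "((\<lambda>x. fd (\<lambda>z. B z w) x u - fd (\<lambda>z. B z u) x w) has_derivative (\<lambda>h. - (br u (dB h w) + br (dB h u) w))) (at x0)"
    by (rule has_derivative_transform_within_open[OF _ open_S x0]) (simp add: maurer_cartan)
  ultimately have "(\<lambda>h. ddB h u w - ddB h w u) = (\<lambda>h. - (br u (dB h w) + br (dB h u) w))"
    by (rule has_derivative_unique)
  from fun_cong[OF this, of h] show ?thesis by (simp add: add.commute)
qed

lemma dB_diff: "dB h w - dB w h = - br h w"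
  using maurer_cartan[OF x0, of w h] by (simp add: B_x0)

text \<open>The Jacobi identity is \<open>d d B = 0\<close>: in the cyclic sum of the differentiated Maurer--Cartan equation
  the second derivatives of \<open>B\<close> cancel by symmetry.\<close>

lemma jacobi: "br (br h u) w + br (br u w) h + br (br w h) u = 0"
proof -
  have b: "br u v = dB v u - dB u v" for u v using dB_diff[where h=u and w=v] by (simp add: algebra_simps)
  have "br (br h u) w + br (br u w) h + br (br w h) u
     = br (dB u h) w - br (dB h u) w + (br (dB w u) h - br (dB u w) h) + (br (dB h w) u - br (dB w h) u)"
    by (simp add: b[of h u] b[of u w] b[of w h] bilinear_lsub[OF br_bilinear])
  also have "\<dots> = - (br (dB h u) w + br u (dB h w)) - (br (dB u w) h + br w (dB u h)) - (br (dB w h) u + br h (dB w u))"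
    using br_skew[of "dB u h" w] br_skew[of "dB w u" h] br_skew[of "dB h w" u] by simp
  also have "\<dots> = (ddB h u w - ddB h w u) + (ddB u w h - ddB u h w) + (ddB w h u - ddB w u h)"
    by (simp add: maurer_cartan_deriv)
  also have "\<dots> = 0"
    using ddB_sym[where h=h and u=u and w=w] ddB_sym[where h=h and u=w and w=u]
      ddB_sym[where h=u and u=w and w=h] by simp
  finally show ?thesis .
qed

end


section \<open>The spray and the curvature of a left-invariant metric\<close>

lemma partial_deriv_eq:
  fixes f :: "real^'n \<Rightarrow> real"
  assumes "(f has_derivative f') (at x)"
  shows "partial_deriv k f x = f' (axis k 1)"
proof -
  have "f differentiable (at x)" using assms unfolding differentiable_def by blast
  from real_deriv_cong_line[OF this, of "axis k 1"] show ?thesis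
    unfolding partial_deriv_def using fd_eqI[OF assms] by simp
qed

lemma linear_axis_sum:
  fixes f :: "real^'n \<Rightarrow> 'b::real_vector"
  assumes "linear f"
  shows "(\<Sum>k\<in>UNIV. y $ k *\<^sub>R f (axis k 1)) = f y"
proof -
  have "f y = f (\<Sum>k\<in>UNIV. y $ k *\<^sub>R axis k 1)" by (simp add: basis_expansion flip: scalar_mult_eq_scaleR)
  also have "\<dots> = (\<Sum>k\<in>UNIV. y $ k *\<^sub>R f (axis k 1))"
    by (simp add: linear_sum[OF assms] linear_cmul[OF assms])
  finally show ?thesis by simp
qed

lemma linear_axis_sum_real:
  fixes f :: "real^'n \<Rightarrow> real"
  assumes "linear f"
  shows "(\<Sum>k\<in>UNIV. f (axis k 1) * y $ k) = f y"
  using linear_axis_sum[OF assms, of y] by (simp add: mult.commute)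

lemma matrix_vector_mult_linear:
  fixes f :: "real^'n \<Rightarrow> real^'m"
  assumes "linear f" "\<And>i k. M $ i $ k = f (axis k 1) $ i"
  shows "M *v w = f w"
proof -
  have "M = matrix f" by (simp add: vec_eq_iff matrix_def assms(2))
  then show ?thesis using matrix_works[of f w] assms(1) by simp
qed

lemma has_derivative_nth:
  fixes f :: "'a::real_normed_vector \<Rightarrow> real^'n"
  shows "(f has_derivative f') (at x) \<Longrightarrow> ((\<lambda>x. f x $ i) has_derivative (\<lambda>h. f' h $ i)) (at x)"
  by (rule bounded_linear.has_derivative[OF bounded_linear_vec_nth])

locale finsler_frame = lie_frame S x0 E br + minkowski N
  for S :: "(real^'n) set" and x0 E br and N :: "real^'n \<Rightarrow> real" +
  fixes L :: "real^'n \<Rightarrow> real^'n \<Rightarrow> real"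
  assumes L_eq: "\<And>x y. x \<in> S \<Longrightarrow> L x y = N (B x y)"
begin

definition gmat :: "real^'n \<Rightarrow> real^'n^'n" where
  "gmat v = (\<chi> i j. g v (axis i 1) (axis j 1))"

lemma gmat_mult:
  assumes "v \<noteq> 0"
  shows "(gmat v *v u) $ i = g v (axis i 1) u"
  using linear_axis_sum_real[OF g_linear_right[OF assms], of _ u]
  by (simp add: gmat_def matrix_vector_mult_def)

lemma det_gmat: "v \<noteq> 0 \<Longrightarrow> det (gmat v) \<noteq> 0"
proof (rule det_nonzeroI)
  fix u assume v: "v \<noteq> 0" and "gmat v *v u = 0"
  then have "g v (axis i 1) u = 0" for i using gmat_mult[OF v, of u i] by simp
  then have "g v w u = 0" for w
    using linear_axis_sum_real[OF g_linear_left[OF v, of u], of w] by simp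
  then show "u = 0" using g_nondegenerate[OF v] g_sym[OF v] by metis
qed

text \<open>The spray vector field on the Lie algebra, defined by \<open>\<langle>\<eta>(v),w\<rangle>\<^sub>v = \<langle>v,[w,v]\<rangle>\<^sub>v\<close>. Its zeros are the
  geodesic vectors.\<close>

definition \<eta> :: "real^'n \<Rightarrow> real^'n" where
  "\<eta> v = solve_linear (gmat v) (\<chi> i. g v v (br (axis i 1) v))"

lemma g_\<eta>:
  assumes v: "v \<noteq> 0"
  shows "g v (\<eta> v) w = g v v (br w v)"
proof -
  have "gmat v *v \<eta> v = (\<chi> i. g v v (br (axis i 1) v))"
    by (simp add: \<eta>_def solve_linear_iff[OF det_gmat[OF v]])
  then have "g v (axis i 1) (\<eta> v) = g v v (br (axis i 1) v)" for i
    by (metis gmat_mult[OF v] vec_lambda_beta)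
  moreover have "linear (\<lambda>w. g v v (br w v))"
    using linear_compose[OF br_linear_left g_linear_right[OF v]] by (simp add: o_def)
  ultimately show ?thesis
    using linear_axis_sum_real[OF g_linear_left[OF v, of "\<eta> v"], of w]
      linear_axis_sum_real[of "\<lambda>w. g v v (br w v)" w] by (simp add: g_sym[OF v, of "\<eta> v"])
qed

lemma smooth_\<eta>: "smooth_on (UNIV - {0}) \<eta>"
proof -
  have 1: "smooth_on (UNIV - {0}) (\<lambda>v. gmat v $ i $ j)" for i j
    using smooth_g by (simp add: gmat_def)
  have "smooth_on (UNIV - {0}) (\<lambda>v. g v v (br (axis i 1) v))" for i
  proof -
    have "smooth_on (UNIV - {0}) (\<lambda>v. \<Sum>k\<in>UNIV. \<Sum>j\<in>UNIV. (g v (axis j 1) (axis k 1) * v $ j) * br (axis i 1) v $ k)"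
      using smooth_on_bounded_linear[OF bounded_linear_vec_nth open_nonzero] smooth_g
        smooth_on_vec_nth[OF open_nonzero smooth_on_bounded_linear[OF _ open_nonzero]]
        br_linear_right linear_conv_bounded_linear
      by (intro smooth_on_sum smooth_on_mult open_nonzero) blast+
    moreover have "(\<Sum>k\<in>UNIV. \<Sum>j\<in>UNIV. (g v (axis j 1) (axis k 1) * v $ j) * br (axis i 1) v $ k)
        = g v v (br (axis i 1) v)" if "v \<in> UNIV - {0}" for v
      using that linear_axis_sum_real[OF g_linear_left[of v]] linear_axis_sum_real[OF g_linear_right[of v v]]
      by (simp flip: sum_distrib_right)
    ultimately show ?thesis using smooth_on_cong[OF open_nonzero] by (metis (no_types, lifting))
  qed
  then have "smooth_on (UNIV - {0}) (\<lambda>v. \<chi> i. g v v (br (axis i 1) v))"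
    by (intro smooth_on_vecI[OF open_nonzero]) simp
  then show ?thesis unfolding \<eta>_def[abs_def]
    by (rule smooth_on_solve_linear[OF open_nonzero 1]) (simp add: det_gmat)
qed

lemma \<eta>_differentiable: "v \<noteq> 0 \<Longrightarrow> \<eta> differentiable (at v)"
  using smooth_onD[OF smooth_\<eta>] by simp

lemma fd_\<eta>_differentiable: "v \<noteq> 0 \<Longrightarrow> (\<lambda>v. fd \<eta> v w) differentiable (at v)"
  using smooth_onD[OF smooth_on_fd[OF smooth_\<eta>]] by simp

lemma fd_\<eta>_linear: "v \<noteq> 0 \<Longrightarrow> linear (fd \<eta> v)"
  using fd_linear[OF \<eta>_differentiable] .

lemma \<eta>_eq_0_iff: "v \<noteq> 0 \<Longrightarrow> \<eta> v = 0 \<longleftrightarrow> (\<forall>w. g v v (br w v) = 0)"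
  using g_\<eta>[of v] g_nondegenerate[of v "\<eta> v"] linear_0[OF g_linear_left[of v]] by metis

text \<open>The defining equation of \<open>\<eta>\<close> differentiated at a zero of \<open>\<eta>\<close>, where the derivative of the
  fundamental tensor on the left does not contribute. On the right, Euler's identity reduces the derivative of
  \<open>v \<mapsto> \<langle>v,_\<rangle>\<^sub>v\<close> to the fundamental tensor.\<close>

lemma fd_\<eta>:
  assumes y: "y \<noteq> 0" and \<eta>: "\<eta> y = 0"
  shows "g y (fd \<eta> y u) w = g y y (br w u) - g y u (br y w)"
proof -
  have "((\<lambda>v. g v (\<eta> v) w) has_derivative (\<lambda>h. fd (\<lambda>v. g v (\<eta> y) w) y h + g y (fd \<eta> y h) w)) (at y)"
    by (rule has_derivative_apply_fd[where M="\<lambda>v u. g v u w", OF open_nonzero])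
      (use y fd_works[OF \<eta>_differentiable] smooth_onD[OF smooth_g] g_linear_left in auto)
  moreover have "fd (\<lambda>v. g v 0 w) y h = 0" for h
  proof -
    have "((\<lambda>v. g v 0 w) has_derivative (\<lambda>h. 0)) (at y)"
      by (rule has_derivative_transform_within_open[OF has_derivative_const open_nonzero])
        (use y linear_0[OF g_linear_left] in auto)
    from fun_cong[OF fd_eqI[OF this], of h] show ?thesis .
  qed
  ultimately have 1: "((\<lambda>v. g v (\<eta> v) w) has_derivative (\<lambda>h. g y (fd \<eta> y h) w)) (at y)"
    by (simp add: \<eta>)
  have "((\<lambda>v. g v v (br w v)) has_derivative (\<lambda>h. g y h (br w y) + g y y (br w h))) (at y)"
    by (rule has_derivative_apply[where M="\<lambda>v. g v v" and M'="\<lambda>h u. g y h u", OF open_nonzero])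
      (use y g_linear_right g_has_derivative_base linear_has_derivative[OF br_linear_right] in auto)
  then have "((\<lambda>v. g v (\<eta> v) w) has_derivative (\<lambda>h. g y h (br w y) + g y y (br w h))) (at y)"
    by (rule has_derivative_transform_within_open[OF _ open_nonzero]) (use y g_\<eta> in auto)
  from fun_cong[OF has_derivative_unique[OF 1 this], of u]
  show ?thesis using linear_neg[OF g_linear_right[OF y]] by (simp add: br_skew[of w y])
qed

abbreviation dBx :: "real^'n \<Rightarrow> real^'n \<Rightarrow> real^'n \<Rightarrow> real^'n" where
  "dBx x h w \<equiv> fd (\<lambda>z. B z w) x h"

lemma L_sq_has_derivative_y:
  assumes "x \<in> S" "y \<noteq> 0"
  shows "((\<lambda>y. (L x y)\<^sup>2) has_derivative (\<lambda>h. fd Nsq (B x y) (B x h))) (at y)"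
  using fd_compose[of Nsq "B x", OF Nsq_differentiable[OF B_nonzero[OF assms]] linear_has_derivative[OF B_linear[OF assms(1)]]]
  by (simp add: L_eq[OF assms(1)])

lemma L_sq_has_derivative_x:
  assumes "x \<in> S" "y \<noteq> 0"
  shows "((\<lambda>x. (L x y)\<^sup>2) has_derivative (\<lambda>h. fd Nsq (B x y) (dBx x h y))) (at x)"
  by (rule has_derivative_transform_within_open[OF fd_compose[of Nsq "\<lambda>x. B x y",
      OF Nsq_differentiable[OF B_nonzero[OF assms]] fd_works[OF B_differentiable[OF assms(1)]]] open_S assms(1)])
    (simp add: L_eq)

lemma fd_Nsq_B_has_derivative:
  assumes "x \<in> S" "y \<noteq> 0"
  shows "((\<lambda>y. fd Nsq (B x y) w) has_derivative (\<lambda>h. 2 * g (B x y) (B x h) w)) (at y)"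
  using fd_compose[of "\<lambda>v. fd Nsq v w" "B x", OF fd_Nsq_differentiable[OF B_nonzero[OF assms]] linear_has_derivative[OF B_linear[OF assms(1)]]]
  by (simp add: g_eq[OF B_nonzero[OF assms]])

lemma g_coeff_L:
  assumes x: "x \<in> S" and y: "y \<noteq> 0"
  shows "g_coeff L x y $ i $ j = g (B x y) (B x (axis i 1)) (B x (axis j 1))"
proof -
  have 1: "partial_deriv i (\<lambda>y. (L x y)\<^sup>2) z = fd Nsq (B x z) (B x (axis i 1))" if "z \<noteq> 0" for z
    using partial_deriv_eq[OF L_sq_has_derivative_y[OF x that]] .
  have "(partial_deriv i (\<lambda>y. (L x y)\<^sup>2) has_derivative (\<lambda>h. 2 * g (B x y) (B x h) (B x (axis i 1)))) (at y)"
    by (rule has_derivative_transform_within_open[OF fd_Nsq_B_has_derivative[OF x y] open_nonzero])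
      (use y in \<open>auto simp: 1\<close>)
  from partial_deriv_eq[OF this, of j] show ?thesis
    by (simp add: g_coeff_def g_sym[OF B_nonzero[OF x y]])
qed

lemma mixed_L:
  assumes x: "x \<in> S" and y: "y \<noteq> 0"
  shows "partial_deriv l (\<lambda>y. partial_deriv k (\<lambda>x. (L x y)\<^sup>2) x) y
    = 2 * g (B x y) (B x (axis l 1)) (dBx x (axis k 1) y) + 2 * g (B x y) (B x y) (dBx x (axis k 1) (axis l 1))"
proof -
  have 1: "partial_deriv k (\<lambda>x. (L x z)\<^sup>2) x = fd Nsq (B x z) (dBx x (axis k 1) z)" if "z \<noteq> 0" for z
    using partial_deriv_eq[OF L_sq_has_derivative_x[OF x that]] .
  have "((\<lambda>y. fd Nsq (B x y) (dBx x (axis k 1) y)) has_derivative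
      (\<lambda>h. 2 * g (B x y) (B x h) (dBx x (axis k 1) y) + fd Nsq (B x y) (dBx x (axis k 1) h))) (at y)"
    by (rule has_derivative_apply[where M="\<lambda>y. fd Nsq (B x y)" and M'="\<lambda>h u. 2 * g (B x y) (B x h) u", OF open_nonzero])
      (use y fd_linear[OF Nsq_differentiable] B_nonzero[OF x] fd_Nsq_B_has_derivative[OF x y]
        linear_has_derivative[OF fd_B_linear[OF x]] in auto)
  then have "((\<lambda>y. partial_deriv k (\<lambda>x. (L x y)\<^sup>2) x) has_derivative
      (\<lambda>h. 2 * g (B x y) (B x h) (dBx x (axis k 1) y) + fd Nsq (B x y) (dBx x (axis k 1) h))) (at y)"
    by (rule has_derivative_transform_within_open[OF _ open_nonzero]) (use y in \<open>auto simp: 1\<close>)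
  from partial_deriv_eq[OF this, of l] show ?thesis by (simp add: fd_Nsq[OF B_nonzero[OF x y]])
qed

definition spray :: "real^'n \<Rightarrow> real^'n \<Rightarrow> real^'n" where
  "spray x y = (1/2) *\<^sub>R E x (dBx x y y + \<eta> (B x y))"

text \<open>In the covector to which the inverse of \<open>g\<^sub>i\<^sub>j\<close> is applied, the derivatives of \<open>B\<close> in the directions \<open>y\<close> and \<open>e\<^sub>l\<close> appear
  antisymmetrised; the Maurer--Cartan equation turns them into the bracket that defines \<open>\<eta>\<close>.\<close>

lemma spray_coeff_L:
  assumes x: "x \<in> S" and y: "y \<noteq> 0"
  shows "spray_coeff L i x y = spray x y $ i"
proof -
  define v where "v = B x y"
  have v: "v \<noteq> 0" using B_nonzero[OF x y] by (simp add: v_def)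
  define r where "r = (\<chi> l. (\<Sum>k\<in>UNIV. partial_deriv l (\<lambda>y. partial_deriv k (\<lambda>x. (L x y)\<^sup>2) x) y * y $ k)
        - partial_deriv l (\<lambda>x. (L x y)\<^sup>2) x)"
  have r: "r $ l = 2 * g v (B x (axis l 1)) (dBx x y y + \<eta> v)" for l
  proof -
    let ?b = "B x (axis l 1)"
    have l: "linear (\<lambda>h. g v u (dBx x h w))" for u w
      using linear_compose[OF fd_linear[OF B_differentiable[OF x]] g_linear_right[OF v]] by (simp add: o_def)
    have lin: "linear (\<lambda>h. 2 * g v ?b (dBx x h y) + 2 * g v v (dBx x h (axis l 1)))"
      using l[THEN linear_add] l[THEN linear_cmul] by (simp add: linear_iff algebra_simps)
    have "r $ l = (\<Sum>k\<in>UNIV. (2 * g v ?b (dBx x (axis k 1) y) + 2 * g v v (dBx x (axis k 1) (axis l 1))) * y $ k)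
        - 2 * g v v (dBx x (axis l 1) y)"
      using partial_deriv_eq[OF L_sq_has_derivative_x[OF x y]]
      by (simp add: r_def mixed_L[OF x y] v_def fd_Nsq[OF B_nonzero[OF x y]])
    also have "\<dots> = 2 * g v ?b (dBx x y y) + 2 * (g v v (dBx x y (axis l 1)) - g v v (dBx x (axis l 1) y))"
      using linear_axis_sum_real[OF lin, of y] by simp
    also have "g v v (dBx x y (axis l 1)) - g v v (dBx x (axis l 1) y) = g v v (br ?b v)"
      using maurer_cartan[OF x, where u=y and w="axis l 1"] br_skew[of ?b v] linear_diff[OF g_linear_right[OF v]]
      by (metis v_def)
    also have "\<dots> = g v ?b (\<eta> v)" using g_\<eta>[OF v, of ?b] g_sym[OF v, of ?b] by simp
    finally show ?thesis by (simp add: linear_add[OF g_linear_right[OF v]])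
  qed
  let ?X = "E x (dBx x y y + \<eta> v)"
  let ?M = "g_coeff L x y"
  have M: "(?M *v u) $ l = g v (B x (axis l 1)) (B x u)" for u l
  proof -
    have "linear (\<lambda>u. g v (B x (axis l 1)) (B x u))"
      using linear_compose[OF B_linear[OF x] g_linear_right[OF v]] by (simp add: o_def)
    from linear_axis_sum_real[OF this, of u] show ?thesis
      by (simp add: matrix_vector_mult_def g_coeff_L[OF x y] v_def)
  qed
  have "det ?M \<noteq> 0"
  proof (rule det_nonzeroI)
    fix u assume "?M *v u = 0"
    then have 0: "g v (B x (axis l 1)) (B x u) = 0" for l using M[of u l] by simp
    have "linear (\<lambda>w. g v (B x w) (B x u))"
      using linear_compose[OF B_linear[OF x] g_linear_left[OF v]] by (simp add: o_def)
    from linear_axis_sum_real[OF this, of u] have "g v (B x u) (B x u) = 0" by (simp add: 0)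
    then show "u = 0" using g_pos[OF v] B_nonzero[OF x] by fastforce
  qed
  then have "\<exists>M'. ?M ** M' = mat 1 \<and> M' ** ?M = mat 1"
    by (simp add: invertible_def flip: invertible_det_nz)
  then have inv: "matrix_inv ?M ** ?M = mat 1"
    unfolding matrix_inv_def by (metis (mono_tags, lifting) someI_ex)
  have "r = 2 *\<^sub>R (?M *v ?X)"
    by (simp add: vec_eq_iff M r B_E[OF x])
  then have "matrix_inv ?M *v r = 2 *\<^sub>R ?X"
    by (simp add: matrix_vector_mult_scaleR matrix_vector_mul_assoc inv)
  then have "(matrix_inv ?M *v r) $ i = 2 * ?X $ i" by simp
  moreover have "spray_coeff L i x y = 1/4 * (matrix_inv ?M *v r) $ i"
    by (simp add: spray_coeff_def matrix_vector_mult_def r_def)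
  ultimately show ?thesis by (simp add: spray_def v_def)
qed


definition spray_y :: "real^'n \<Rightarrow> real^'n \<Rightarrow> real^'n \<Rightarrow> real^'n" where
  "spray_y x y w = (1/2) *\<^sub>R E x (dBx x w y + dBx x y w + fd \<eta> (B x y) (B x w))"

lemma spray_has_derivative_y:
  assumes x: "x \<in> S" and y: "y \<noteq> 0"
  shows "((\<lambda>y. spray x y) has_derivative spray_y x y) (at y)"
proof -
  have "((\<lambda>y. dBx x y y) has_derivative (\<lambda>h. dBx x h y + dBx x y h)) (at y)"
    by (rule has_derivative_apply[where M="\<lambda>y w. dBx x y w" and M'="\<lambda>h w. dBx x h w", OF open_UNIV UNIV_I])
      (use fd_B_linear[OF x] linear_has_derivative[OF fd_linear[OF B_differentiable[OF x]]]
        in \<open>auto intro: linear_has_derivative\<close>)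
  moreover have "((\<lambda>y. \<eta> (B x y)) has_derivative (\<lambda>h. fd \<eta> (B x y) (B x h))) (at y)"
    by (rule fd_compose[OF \<eta>_differentiable[OF B_nonzero[OF x y]] linear_has_derivative[OF B_linear[OF x]]])
  ultimately have "((\<lambda>y. dBx x y y + \<eta> (B x y)) has_derivative
      (\<lambda>h. dBx x h y + dBx x y h + fd \<eta> (B x y) (B x h))) (at y)"
    by (rule has_derivative_add)
  from has_derivative_scaleR_right[OF bounded_linear.has_derivative[OF
      E_linear[OF x, unfolded linear_conv_bounded_linear] this], of "1/2"]
  show ?thesis unfolding spray_def spray_y_def[abs_def] .
qed

text \<open>At the identity \<open>dE = - dB\<close>.\<close>

lemma E_apply_has_derivative:
  assumes "(f has_derivative f') (at x0)"
  shows "((\<lambda>x. E x (f x)) has_derivative (\<lambda>h. f' h - dB h (f x0))) (at x0)"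
proof -
  have "fd (\<lambda>z. E z v) x0 h = - dB h v" for v h
    using E_fd_B[OF x0, of v h] by (simp add: E_x0 B_x0)
  with has_derivative_apply_fd[OF open_S x0 E_linear E_differentiable[OF x0] assms]
  show ?thesis by (simp add: E_x0)
qed

lemma spray_has_derivative_x:
  assumes y: "y \<noteq> 0"
  shows "((\<lambda>x. spray x y) has_derivative
    (\<lambda>h. (1/2) *\<^sub>R (ddB h y y + fd \<eta> y (dB h y) - dB h (dB y y + \<eta> y)))) (at x0)"
proof -
  have "((\<lambda>x. \<eta> (B x y)) has_derivative (\<lambda>h. fd \<eta> (B x0 y) (dB h y))) (at x0)"
    by (rule fd_compose[OF \<eta>_differentiable[OF B_nonzero[OF x0 y]] fd_works[OF B_differentiable[OF x0]]])
  from has_derivative_add[OF fd_works[OF fd_B_differentiable[OF x0]] this]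
  have "((\<lambda>x. dBx x y y + \<eta> (B x y)) has_derivative (\<lambda>h. ddB h y y + fd \<eta> y (dB h y))) (at x0)"
    by (simp add: B_x0)
  from has_derivative_scaleR_right[OF E_apply_has_derivative[OF this], of "1/2"]
  show ?thesis unfolding spray_def by (simp add: B_x0)
qed

lemma spray_y_has_derivative_x:
  assumes y: "y \<noteq> 0"
  shows "((\<lambda>x. spray_y x y w) has_derivative
    (\<lambda>h. (1/2) *\<^sub>R (ddB h w y + ddB h y w + (fd (\<lambda>v. fd \<eta> v w) y (dB h y) + fd \<eta> y (dB h w))
        - dB h (dB w y + dB y w + fd \<eta> y w)))) (at x0)"
proof -
  have c: "((\<lambda>x. fd \<eta> (B x y) u) has_derivative (\<lambda>h. fd (\<lambda>v. fd \<eta> v u) (B x0 y) (dB h y))) (at x0)" for u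
    by (rule fd_compose[of "\<lambda>v. fd \<eta> v u" "\<lambda>x. B x y",
          OF fd_\<eta>_differentiable[OF B_nonzero[OF x0 y]] fd_works[OF B_differentiable[OF x0]]])
  have "((\<lambda>x. fd \<eta> (B x y) (B x w)) has_derivative
      (\<lambda>h. fd (\<lambda>v. fd \<eta> v (B x0 w)) (B x0 y) (dB h y) + fd \<eta> (B x0 y) (dB h w))) (at x0)"
    by (rule has_derivative_apply[where M="\<lambda>x. fd \<eta> (B x y)"
          and M'="\<lambda>h u. fd (\<lambda>v. fd \<eta> v u) (B x0 y) (dB h y)", OF open_S x0 _ c fd_works[OF B_differentiable[OF x0]]])
      (rule fd_\<eta>_linear[OF B_nonzero[OF _ y]])
  from has_derivative_add[OF has_derivative_add[OF fd_works[OF fd_B_differentiable[OF x0]]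
        fd_works[OF fd_B_differentiable[OF x0]]] this]
  have "((\<lambda>x. dBx x w y + dBx x y w + fd \<eta> (B x y) (B x w)) has_derivative
      (\<lambda>h. ddB h w y + ddB h y w + (fd (\<lambda>v. fd \<eta> v w) y (dB h y) + fd \<eta> y (dB h w)))) (at x0)"
    by (simp add: B_x0)
  from has_derivative_scaleR_right[OF E_apply_has_derivative[OF this], of "1/2"]
  show ?thesis unfolding spray_y_def by (simp add: B_x0)
qed

lemma spray_y_has_derivative_y:
  assumes y: "y \<noteq> 0"
  shows "((\<lambda>y. spray_y x0 y w) has_derivative
    (\<lambda>h. (1/2) *\<^sub>R (dB w h + dB h w + fd (\<lambda>v. fd \<eta> v w) y h))) (at y)"
proof -
  have "((\<lambda>y. dB w y + dB y w + fd \<eta> y w) has_derivative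
      (\<lambda>h. dB w h + dB h w + fd (\<lambda>v. fd \<eta> v w) y h)) (at y)"
    by (intro has_derivative_add linear_has_derivative fd_B_linear[OF x0] fd_linear[OF B_differentiable[OF x0]]
        fd_works[OF fd_\<eta>_differentiable[OF y]])
  from has_derivative_scaleR_right[OF this, of "1/2"]
  show ?thesis unfolding spray_y_def by (simp add: B_x0 E_x0)
qed

lemma spray_y_linear: "x \<in> S \<Longrightarrow> y \<noteq> 0 \<Longrightarrow> linear (spray_y x y)"
  using spray_has_derivative_y has_derivative_linear by blast

lemma riemann_coeff_L:
  assumes y: "y \<noteq> 0" and dx: "((\<lambda>x. spray x y) has_derivative Gx) (at x0)"
    and dxy: "\<And>w. ((\<lambda>x. spray_y x y w) has_derivative Gxy w) (at x0)"
    and dyy: "\<And>w. ((\<lambda>y. spray_y x0 y w) has_derivative Gyy w) (at y)"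
  shows "riemann_coeff L x0 y *v w
    = 2 *\<^sub>R Gx w - Gxy w y + 2 *\<^sub>R Gyy w (spray x0 y) - spray_y x0 y (spray_y x0 y w)"
proof (rule matrix_vector_mult_linear)
  have x1: "partial_deriv k (\<lambda>x. spray_coeff L i x y) x0 = Gx (axis k 1) $ i" for i k
    by (rule partial_deriv_eq, rule has_derivative_transform_within_open[OF has_derivative_nth[OF dx] open_S x0])
      (simp add: spray_coeff_L y)
  have y1: "partial_deriv k (\<lambda>y. spray_coeff L i x y) z = spray_y x z (axis k 1) $ i"
    if "x \<in> S" "z \<noteq> 0" for i k x z
    by (rule partial_deriv_eq, rule has_derivative_transform_within_open[OF has_derivative_nth[OF
            spray_has_derivative_y[OF that]] open_nonzero])
      (use that in \<open>auto simp: spray_coeff_L\<close>)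
  have xy: "partial_deriv j (\<lambda>x. partial_deriv k (\<lambda>y. spray_coeff L i x y) y) x0
      = Gxy (axis k 1) (axis j 1) $ i" for i j k
    by (rule partial_deriv_eq, rule has_derivative_transform_within_open[OF has_derivative_nth[OF dxy] open_S x0])
      (simp add: y1 y)
  have yy: "partial_deriv j (\<lambda>y. partial_deriv k (\<lambda>y. spray_coeff L i x0 y) y) y
      = Gyy (axis k 1) (axis j 1) $ i" for i j k
    by (rule partial_deriv_eq, rule has_derivative_transform_within_open[OF has_derivative_nth[OF dyy] open_nonzero])
      (use y in \<open>auto simp: y1[OF x0]\<close>)
  have nth: "linear (\<lambda>h. f h $ i)" if "linear f" for f :: "real^'n \<Rightarrow> real^'n" and i
    using that by (simp add: linear_iff)
  fix i k
  let ?e = "axis k 1 :: real^'n"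
  have "(\<Sum>j\<in>UNIV. y $ j * Gxy ?e (axis j 1) $ i) = Gxy ?e y $ i"
    using linear_axis_sum_real[OF nth[OF has_derivative_linear[OF dxy]], of ?e i y] by (simp add: mult.commute)
  moreover have "(\<Sum>j\<in>UNIV. spray x0 y $ j * Gyy ?e (axis j 1) $ i) = Gyy ?e (spray x0 y) $ i"
    using linear_axis_sum_real[OF nth[OF has_derivative_linear[OF dyy]], of ?e i "spray x0 y"] by (simp add: mult.commute)
  moreover have "(\<Sum>j\<in>UNIV. spray_y x0 y (axis j 1) $ i * spray_y x0 y ?e $ j) = spray_y x0 y (spray_y x0 y ?e) $ i"
    using linear_axis_sum_real[OF nth[OF spray_y_linear[OF x0 y]]] .
  ultimately show "riemann_coeff L x0 y $ i $ k
    = (2 *\<^sub>R Gx ?e - Gxy ?e y + 2 *\<^sub>R Gyy ?e (spray x0 y) - spray_y x0 y (spray_y x0 y ?e)) $ i"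
    by (simp add: riemann_coeff_def Let_def x1 y1[OF x0] xy yy y spray_coeff_L[OF x0])
next
  have lGxy: "linear (\<lambda>w. Gxy w h)" and lGyy: "linear (\<lambda>w. Gyy w h)" for h
  proof -
    have "Gxy w h = fd (\<lambda>x. spray_y x y w) x0 h" for w using fd_eqI[OF dxy] by simp
    moreover have "linear (\<lambda>w. fd (\<lambda>x. spray_y x y w) x0 h)"
      by (rule linear_fd_parameter[OF open_S x0 spray_y_linear[OF _ y]])
        (use dxy in \<open>auto simp: differentiable_def\<close>)
    ultimately show "linear (\<lambda>w. Gxy w h)" by simp
    have "Gyy w h = fd (\<lambda>y. spray_y x0 y w) y h" for w using fd_eqI[OF dyy] by simp
    moreover have "linear (\<lambda>w. fd (\<lambda>y. spray_y x0 y w) y h)"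
      by (rule linear_fd_parameter[OF open_nonzero _ spray_y_linear[OF x0]])
        (use dyy y in \<open>auto simp: differentiable_def\<close>)
    ultimately show "linear (\<lambda>w. Gyy w h)" by simp
  qed
  show "linear (\<lambda>w. 2 *\<^sub>R Gx w - Gxy w y + 2 *\<^sub>R Gyy w (spray x0 y) - spray_y x0 y (spray_y x0 y w))"
    using linear_compose[OF spray_y_linear[OF x0 y] spray_y_linear[OF x0 y]]
    by (intro linear_compose_sub linear_compose_add linear_compose_scale_right lGxy lGyy
        has_derivative_linear[OF dx]) (simp add: o_def)
qed

text \<open>The second derivatives of \<open>\<eta>\<close> cancel because \<open>2 G = dB(y) y\<close> when \<open>\<eta>(y) = 0\<close>. The second derivatives of \<open>B\<close>
  enter only through \<open>d\<^sup>2B(w,y) y - d\<^sup>2B(y,y) w\<close>, which the differentiated Maurer--Cartan equation expresses by first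
  derivatives, and those cancel in turn once \<open>dB(w) y\<close> is written as \<open>dB(y) w + [y,w]\<close>.\<close>

lemma riemann_coeff_geodesic_vector:
  assumes y: "y \<noteq> 0" and \<eta>: "\<eta> y = 0"
  shows "riemann_coeff L x0 y *v w = fd \<eta> y (br y w)
    - (1/4) *\<^sub>R (br y (br y w + fd \<eta> y w) + fd \<eta> y (br y w + fd \<eta> y w))"
proof -
  define a where "a = dB y"
  define A where "A = br y"
  define D where "D = fd \<eta> y"
  define p where "p = dB y y"
  have la: "linear a" unfolding a_def by (rule fd_B_linear[OF x0])
  have lA: "linear A" unfolding A_def by (rule br_linear_right)
  have lD: "linear D" unfolding D_def by (rule fd_\<eta>_linear[OF y])
  have la': "linear (\<lambda>h. dB h w)" for w by (rule fd_linear[OF B_differentiable[OF x0]])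
  have ld2: "linear (\<lambda>h. fd (\<lambda>v. fd \<eta> v w) y h)" by (rule fd_linear[OF fd_\<eta>_differentiable[OF y]])
  have aw: "dB y w = a w" for w by (simp add: a_def)
  have ay: "a y = p" and Ay: "A y = 0" by (simp_all add: a_def p_def A_def br_self)
  have b: "dB w y = a w + A w" for w
    using maurer_cartan[OF x0, where u=w and w=y] br_skew[of w y] by (simp add: a_def A_def B_x0 algebra_simps)
  have bp: "dB w p = dB p w + br p w"
    using maurer_cartan[OF x0, where u=w and w=p] br_skew[of w p] by (simp add: B_x0 algebra_simps)
  have sp: "spray x0 y = (1/2) *\<^sub>R p"
    by (simp add: spray_def E_x0 B_x0 \<eta> p_def)
  have Q: "spray_y x0 y w = (1/2) *\<^sub>R (2 *\<^sub>R a w + A w + D w)" for w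
    by (simp add: spray_y_def E_x0 B_x0 b aw scaleR_2 D_def)
  have dd: "ddB w y y = ddB y y w + A (a w) + br p w"
    using maurer_cartan_deriv[where h=y and u=w and w=y] ddB_sym[where h=w and u=y and w=y]
      br_skew[of "dB y w" y] br_skew[of w p]
    by (simp add: A_def a_def p_def algebra_simps)
  note lins = linear_add[OF la] linear_add[OF lA] linear_add[OF lD]
    linear_cmul[OF la] linear_cmul[OF lA] linear_cmul[OF lD]
  have "riemann_coeff L x0 y *v w = ddB w y y + D (a w + A w) - dB w p
      - (1/2) *\<^sub>R (ddB y w y + ddB y y w + (fd (\<lambda>v. fd \<eta> v w) y p + D (a w)) - a (2 *\<^sub>R a w + A w + D w))
      + (dB w ((1/2) *\<^sub>R p) + dB ((1/2) *\<^sub>R p) w + fd (\<lambda>v. fd \<eta> v w) y ((1/2) *\<^sub>R p))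
      - spray_y x0 y (spray_y x0 y w)"
    using riemann_coeff_L[OF y spray_has_derivative_x[OF y] spray_y_has_derivative_x[OF y]
        spray_y_has_derivative_y[OF y], of w]
    by (simp add: sp \<eta> b aw ay Ay scaleR_2 flip: D_def)
  also have "ddB y w y = ddB w y y" by (rule ddB_sym)
  also have "dB w ((1/2) *\<^sub>R p) = (1/2) *\<^sub>R dB w p" by (rule linear_cmul[OF fd_B_linear[OF x0]])
  also have "dB ((1/2) *\<^sub>R p) w = (1/2) *\<^sub>R dB p w" by (rule linear_cmul[OF la'])
  also have "fd (\<lambda>v. fd \<eta> v w) y ((1/2) *\<^sub>R p) = (1/2) *\<^sub>R fd (\<lambda>v. fd \<eta> v w) y p" by (rule linear_cmul[OF ld2])
  also have "spray_y x0 y (spray_y x0 y w) = (1/4) *\<^sub>R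
     (2 *\<^sub>R a (2 *\<^sub>R a w + A w + D w) + A (2 *\<^sub>R a w + A w + D w) + D (2 *\<^sub>R a w + A w + D w))"
    by (simp add: Q lins scaleR_add_right)
  finally have R: "riemann_coeff L x0 y *v w = ddB w y y + D (a w + A w) - dB w p
      - (1/2) *\<^sub>R (ddB w y y + ddB y y w + (fd (\<lambda>v. fd \<eta> v w) y p + D (a w)) - a (2 *\<^sub>R a w + A w + D w))
      + ((1/2) *\<^sub>R dB w p + (1/2) *\<^sub>R dB p w + (1/2) *\<^sub>R fd (\<lambda>v. fd \<eta> v w) y p)
      - (1/4) *\<^sub>R
     (2 *\<^sub>R a (2 *\<^sub>R a w + A w + D w) + A (2 *\<^sub>R a w + A w + D w) + D (2 *\<^sub>R a w + A w + D w))" .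
  have "(riemann_coeff L x0 y *v w) $ i = (D (A w) - (1/4) *\<^sub>R (A (A w + D w) + D (A w + D w))) $ i" for i
    unfolding R dd bp lins by (simp add: algebra_simps)
  then show ?thesis by (simp add: vec_eq_iff A_def D_def)
qed

end


section \<open>Charts and tangent vectors\<close>

locale manifold =
  fixes X :: "'m topology" and A :: "('m, 'e::euclidean_space) chart set"
  assumes manifold: "smooth_manifold X A"
begin

lemma chart_openin: "c \<in> A \<Longrightarrow> openin X (fst c)"
  and chart_image_open: "c \<in> A \<Longrightarrow> open (snd c ` fst c)"
  and chart_homeo: "c \<in> A \<Longrightarrow> homeomorphic_map (subtopology X (fst c)) (top_of_set (snd c ` fst c)) (snd c)"
  and transition_smooth: "c \<in> A \<Longrightarrow> d \<in> A \<Longrightarrow> smooth_on (snd c ` (fst c \<inter> fst d)) (snd d \<circ> chart_inv c)"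
  using manifold unfolding smooth_manifold_def by blast+

lemma chart_inj: "c \<in> A \<Longrightarrow> inj_on (snd c) (fst c)"
proof -
  assume c: "c \<in> A"
  have "fst c \<subseteq> topspace X" using chart_openin[OF c] openin_subset by blast
  then show ?thesis
    using homeomorphic_imp_injective_map[OF chart_homeo[OF c]] by (simp add: Int_absorb1)
qed

lemma chart_inv_left: "c \<in> A \<Longrightarrow> p \<in> fst c \<Longrightarrow> chart_inv c (snd c p) = p"
  unfolding chart_inv_def by (rule inv_into_f_f[OF chart_inj])

lemma chart_inv_in: "x \<in> snd c ` fst c \<Longrightarrow> chart_inv c x \<in> fst c"
  and chart_inv_right: "x \<in> snd c ` fst c \<Longrightarrow> snd c (chart_inv c x) = x"
  unfolding chart_inv_def by (rule inv_into_into, assumption) (rule f_inv_into_f, assumption)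

lemma open_chart_image:
  assumes c: "c \<in> A" and W: "openin X W" "W \<subseteq> fst c"
  shows "open (snd c ` W)"
proof -
  have "openin (subtopology X (fst c)) W"
    using W by (metis inf.absorb_iff1 openin_subtopology)
  then have "openin (top_of_set (snd c ` fst c)) (snd c ` W)"
    using homeomorphic_imp_open_map[OF chart_homeo[OF c]] unfolding open_map_def by blast
  then show ?thesis using openin_open_trans[OF _ chart_image_open[OF c]] by blast
qed

lemma open_overlap: "c \<in> A \<Longrightarrow> d \<in> A \<Longrightarrow> open (snd c ` (fst c \<inter> fst d))"
  by (rule open_chart_image) (auto intro: openin_Int chart_openin)

lemma charts_atD: "c \<in> charts_at A p \<Longrightarrow> c \<in> A" "c \<in> charts_at A p \<Longrightarrow> p \<in> fst c"
  by (auto simp: charts_at_def)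

lemma transition_differentiable:
  assumes "c \<in> charts_at A p" "d \<in> charts_at A p"
  shows "(snd d \<circ> chart_inv c) differentiable (at (snd c p))"
  by (rule smooth_onD[OF transition_smooth]) (use assms in \<open>auto simp: charts_at_def\<close>)

text \<open>The chain rule for passing from one chart to another; it is applied with \<open>h\<close> a coordinate map
  and with \<open>h\<close> the coordinates of a left translation.\<close>

lemma fd_change_chart:
  assumes c: "c \<in> charts_at A p" and e: "e \<in> charts_at A p"
    and h: "(h \<circ> chart_inv c) differentiable (at (snd c p))"
  shows "((h \<circ> chart_inv e) has_derivative
    (\<lambda>w. fd (h \<circ> chart_inv c) (snd c p) (fd (snd c \<circ> chart_inv e) (snd e p) w))) (at (snd e p))"
proof (rule has_derivative_transform_within_open[OF _ open_overlap])
  note cA = charts_atD[OF c] and eA = charts_atD[OF e]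
  show "e \<in> A" "c \<in> A" by fact+
  show "snd e p \<in> snd e ` (fst e \<inter> fst c)" using cA eA by blast
  have p: "(snd c \<circ> chart_inv e) (snd e p) = snd c p" using chart_inv_left[OF eA] by simp
  show "((\<lambda>x. (h \<circ> chart_inv c) ((snd c \<circ> chart_inv e) x)) has_derivative
      (\<lambda>w. fd (h \<circ> chart_inv c) (snd c p) (fd (snd c \<circ> chart_inv e) (snd e p) w))) (at (snd e p))"
    using fd_compose[of "h \<circ> chart_inv c" "snd c \<circ> chart_inv e" "snd e p", unfolded p, OF h
        fd_works[OF transition_differentiable[OF e c]]] .
  show "(h \<circ> chart_inv c) ((snd c \<circ> chart_inv e) x) = (h \<circ> chart_inv e) x"
    if "x \<in> snd e ` (fst e \<inter> fst c)" for x
    using that chart_inv_left[OF eA(1)] chart_inv_left[OF cA(1)] by auto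
qed

lemma transition_cocycle:
  assumes "c \<in> charts_at A p" "d \<in> charts_at A p" "e \<in> charts_at A p"
  shows "fd (snd e \<circ> chart_inv c) (snd c p) v
    = fd (snd e \<circ> chart_inv d) (snd d p) (fd (snd d \<circ> chart_inv c) (snd c p) v)"
  using fd_eqI[OF fd_change_chart[OF assms(2,1) transition_differentiable[OF assms(2,3)]]] by simp

lemma transition_self:
  assumes "c \<in> charts_at A p"
  shows "fd (snd c \<circ> chart_inv c) (snd c p) = (\<lambda>v. v)"
proof -
  note c = charts_atD[OF assms]
  have "fd (snd c \<circ> chart_inv c) (snd c p) = fd (\<lambda>x. x) (snd c p)"
    by (rule fd_cong_open[OF chart_image_open[OF c(1)]]) (use c in \<open>auto simp: chart_inv_right\<close>)
  then show ?thesis by simp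
qed

lemma tangent_of_coords_in_tangent_space:
  assumes "c \<in> charts_at A p"
  shows "tangent_of_coords A c p y \<in> tangent_space A p"
proof -
  let ?v = "tangent_of_coords A c p y"
  have "?v e = fd (snd e \<circ> chart_inv d) (snd d p) (?v d)" if de: "d \<in> charts_at A p" "e \<in> charts_at A p" for d e
    using transition_cocycle[OF assms de, of y] de by (simp add: tangent_of_coords_def)
  moreover have "?v d = 0" if "d \<notin> charts_at A p" for d
    using that by (simp add: tangent_of_coords_def)
  ultimately show ?thesis unfolding tangent_space_def by blast
qed

lemma tangent_of_coords_component:
  assumes "c \<in> charts_at A p"
  shows "tangent_of_coords A c p y c = y"
  using assms by (simp add: tangent_of_coords_def transition_self)

lemma tangent_of_coords_of_component:
  assumes "c \<in> charts_at A p" "v \<in> tangent_space A p"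
  shows "tangent_of_coords A c p (v c) = v"
proof
  fix d
  show "tangent_of_coords A c p (v c) d = v d"
  proof (cases "d \<in> charts_at A p")
    case True
    then have "v d = fd (snd d \<circ> chart_inv c) (snd c p) (v c)"
      using assms unfolding tangent_space_def by blast
    then show ?thesis using True by (simp add: tangent_of_coords_def)
  next
    case False
    then have "v d = 0" using assms(2) unfolding tangent_space_def by blast
    then show ?thesis using False by (simp add: tangent_of_coords_def)
  qed
qed

lemma tangent_of_coords_linear:
  assumes "c \<in> charts_at A p"
  shows "tangent_of_coords A c p (y + s *\<^sub>R u) = tangent_of_coords A c p y + s *\<^sub>R tangent_of_coords A c p u"
proof
  fix d
  show "tangent_of_coords A c p (y + s *\<^sub>R u) d = (tangent_of_coords A c p y + s *\<^sub>R tangent_of_coords A c p u) d"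
  proof (cases "d \<in> charts_at A p")
    case True
    from fd_linear[OF transition_differentiable[OF assms this]] True show ?thesis
      by (simp add: tangent_of_coords_def scaleR_fun_def linear_add linear_cmul)
  qed (simp add: tangent_of_coords_def scaleR_fun_def)
qed

lemma differential_component:
  assumes c: "c \<in> charts_at A p" and v: "v \<in> tangent_space A p" and d: "d \<in> charts_at A (f p)"
    and f: "(snd d \<circ> f \<circ> chart_inv c) differentiable (at (snd c p))"
  shows "differential A A f p v d = fd (snd d \<circ> f \<circ> chart_inv c) (snd c p) (v c)"
proof -
  define e where "e = (SOME c. c \<in> charts_at A p)"
  have e: "e \<in> charts_at A p" unfolding e_def using c by (rule someI)
  have "v c = fd (snd c \<circ> chart_inv e) (snd e p) (v e)"
    using v c e unfolding tangent_space_def by blast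
  then show ?thesis
    using fd_eqI[OF fd_change_chart[OF c e f]] d by (simp add: differential_def Let_def flip: e_def)
qed

end


section \<open>The left-invariant frame of a chart at the identity\<close>

locale lie_group_chart =
  fixes G :: "('m, 'b) monoid_scheme" (structure)
    and X :: "'m topology" and A :: "('m, real^'n) chart set" and c :: "('m, real^'n) chart"
  assumes lie: "lie_group G X A" and c1: "c \<in> charts_at A \<one>"
begin

sublocale group G
  using lie by (simp add: lie_group_def)

sublocale manifold X A
  using lie by (unfold_locales) (simp add: lie_group_def)

abbreviation D where "D \<equiv> snd c ` fst c"

abbreviation x0 where "x0 \<equiv> snd c \<one>"

abbreviation W where "W \<equiv> {xz \<in> D \<times> D. chart_inv c (fst xz) \<otimes> chart_inv c (snd xz) \<in> fst c}"

text \<open>The group multiplication in the chart.\<close>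

definition mu where "mu xz = snd c (chart_inv c (fst xz) \<otimes> chart_inv c (snd xz))"

lemma cA: "c \<in> A" and one_c: "\<one> \<in> fst c"
  using charts_atD[OF c1] .

lemma carrier_eq: "topspace X = carrier G"
  using lie by (simp add: lie_group_def)

lemma dom_carrier: "p \<in> fst c \<Longrightarrow> p \<in> carrier G"
  using openin_subset[OF chart_openin[OF cA]] unfolding carrier_eq by (rule subsetD)

lemma inv_carrier: "x \<in> D \<Longrightarrow> chart_inv c x \<in> carrier G"
  by (rule dom_carrier[OF chart_inv_in])

lemma x0_D: "x0 \<in> D" using one_c by blast

lemma inv_x0: "chart_inv c x0 = \<one>"
  by (rule chart_inv_left[OF cA one_c])

lemma open_D: "open D" by (rule chart_image_open[OF cA])

lemma open_W: "open W"
proof (subst open_subopen, rule ballI)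
  fix xz assume xz: "xz \<in> W"
  define p q where "p = chart_inv c (fst xz)" and "q = chart_inv c (snd xz)"
  have pq: "p \<in> fst c" "q \<in> fst c" "p \<otimes> q \<in> fst c" "snd c p = fst xz" "snd c q = snd xz"
    using xz by (auto simp: p_def q_def chart_inv_in chart_inv_right)
  have cont: "continuous_map (prod_topology X X) X (\<lambda>(g, h). g \<otimes> h)"
    using lie by (simp add: lie_group_def smooth_map_def)
  let ?O = "{gh \<in> topspace (prod_topology X X). (\<lambda>(g, h). g \<otimes> h) gh \<in> fst c}"
  have "openin (prod_topology X X) ?O"
    using openin_continuous_map_preimage[OF cont chart_openin[OF cA]] .
  moreover have "(p, q) \<in> ?O" using pq dom_carrier by (simp add: carrier_eq)
  ultimately obtain P Q where PQ: "openin X P" "openin X Q" "p \<in> P" "q \<in> Q" "P \<times> Q \<subseteq> ?O"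
    unfolding openin_prod_topology_alt by meson
  define P' Q' where "P' = P \<inter> fst c" and "Q' = Q \<inter> fst c"
  have "open (snd c ` P' \<times> snd c ` Q')"
    unfolding P'_def Q'_def
    by (intro open_Times open_chart_image[OF cA] openin_Int PQ chart_openin[OF cA]) auto
  moreover have "xz \<in> snd c ` P' \<times> snd c ` Q'"
    using pq PQ(3,4) by (auto simp: P'_def Q'_def mem_Times_iff intro!: image_eqI)
  moreover have "snd c ` P' \<times> snd c ` Q' \<subseteq> W"
    using PQ(5) by (auto simp: P'_def Q'_def chart_inv_left[OF cA])
  ultimately show "\<exists>T. open T \<and> xz \<in> T \<and> T \<subseteq> W" by blast
qed

lemma mu_smooth: "smooth_on W mu"
proof -
  \<comment> \<open>The chart of \<open>G \<times> G\<close> in which smoothness of the multiplication is expressed.\<close>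
  define cc where "cc = (fst c \<times> fst c, map_prod (snd c) (snd c))"
  have cc: "cc \<in> prod_atlas A A" unfolding prod_atlas_def cc_def using cA by blast
  have inv: "chart_inv cc xz = (chart_inv c (fst xz), chart_inv c (snd xz))" if "xz \<in> D \<times> D" for xz
  proof -
    have "inj_on (map_prod (snd c) (snd c)) (fst c \<times> fst c)"
      using map_prod_inj_on[OF chart_inj[OF cA] chart_inj[OF cA]] .
    then have "chart_inv cc (map_prod (snd c) (snd c) (chart_inv c (fst xz), chart_inv c (snd xz)))
        = (chart_inv c (fst xz), chart_inv c (snd xz))"
      unfolding chart_inv_def[of cc] unfolding cc_def
      using that by (simp add: inv_into_f_f chart_inv_in mem_Times_iff del: map_prod_simp)
    then show ?thesis using that by (simp add: chart_inv_right mem_Times_iff)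
  qed
  have "smooth_on (snd cc ` {gh \<in> fst cc. (\<lambda>(g, h). g \<otimes> h) gh \<in> fst c}) (snd c \<circ> (\<lambda>(g, h). g \<otimes> h) \<circ> chart_inv cc)"
    using lie cc cA unfolding lie_group_def smooth_map_def by blast
  moreover have "snd cc ` {gh \<in> fst cc. (\<lambda>(g, h). g \<otimes> h) gh \<in> fst c} = W"
  proof (intro equalityI subsetI)
    fix xz assume "xz \<in> snd cc ` {gh \<in> fst cc. (\<lambda>(g, h). g \<otimes> h) gh \<in> fst c}"
    then show "xz \<in> W" by (auto simp: cc_def chart_inv_left[OF cA])
  next
    fix xz assume "xz \<in> W"
    then show "xz \<in> snd cc ` {gh \<in> fst cc. (\<lambda>(g, h). g \<otimes> h) gh \<in> fst c}"
      by (intro image_eqI[of _ _ "(chart_inv c (fst xz), chart_inv c (snd xz))"])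
        (auto simp: cc_def chart_inv_in chart_inv_left[OF cA])
  qed
  ultimately have "smooth_on W (snd c \<circ> (\<lambda>(g, h). g \<otimes> h) \<circ> chart_inv cc)" by simp
  moreover have "(snd c \<circ> (\<lambda>(g, h). g \<otimes> h) \<circ> chart_inv cc) xz = mu xz" if "xz \<in> W" for xz
    using that inv[of xz] by (simp add: mu_def)
  ultimately show ?thesis using smooth_on_cong[OF open_W] by blast
qed

lemma mu_in_D: "xz \<in> W \<Longrightarrow> mu xz \<in> D" and inv_mu: "xz \<in> W \<Longrightarrow> chart_inv c (mu xz) = chart_inv c (fst xz) \<otimes> chart_inv c (snd xz)"
  unfolding mu_def by (auto simp: chart_inv_left[OF cA])

lemma right_W: "x \<in> D \<Longrightarrow> (x, x0) \<in> W"
  using inv_carrier[of x] chart_inv_in[of x c] x0_D by (auto simp: inv_x0)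

lemma mu_x0_right: "x \<in> D \<Longrightarrow> mu (x, x0) = x" and mu_x0_left: "x \<in> D \<Longrightarrow> mu (x0, x) = x"
  using inv_carrier[of x] chart_inv_right[of x c] by (simp_all add: mu_def inv_x0)

lemma mu_assoc:
  assumes "(x, z) \<in> W" "(z, w) \<in> W"
  shows "mu (x, mu (z, w)) = mu (mu (x, z), w)"
  using inv_mu[OF assms(1)] inv_mu[OF assms(2)] assms inv_carrier
  by (auto simp: mu_def[of "(x, mu (z, w))"] mu_def[of "(mu (x, z), w)"] m_assoc)

definition E where "E x v = fd mu (x, x0) (0, v)"

lemma mu_has_derivative_right:
  assumes "(x, z) \<in> W"
  shows "((\<lambda>z. mu (x, z)) has_derivative (\<lambda>v. fd mu (x, z) (0, v))) (at z)"
  by (rule fd_compose[of mu "\<lambda>z. (x, z)", OF smooth_onD[OF mu_smooth assms]])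
    (rule has_derivative_Pair[OF has_derivative_const has_derivative_ident])

lemma E_has_derivative: "x \<in> D \<Longrightarrow> ((\<lambda>z. mu (x, z)) has_derivative E x) (at x0)"
  unfolding E_def[abs_def] by (rule mu_has_derivative_right[OF right_W])

lemma E_lin: "x \<in> D \<Longrightarrow> linear (E x)"
  using E_has_derivative has_derivative_linear by blast

lemma E_at_x0: "E x0 v = v"
proof -
  have "((\<lambda>z. mu (x0, z)) has_derivative (\<lambda>v. v)) (at x0)"
    by (rule has_derivative_transform_within_open[OF has_derivative_ident open_D x0_D]) (simp add: mu_x0_left)
  from has_derivative_unique[OF E_has_derivative[OF x0_D] this] show ?thesis by simp
qed

lemma E_smooth_D: "smooth_on D (\<lambda>x. E x v)"
  unfolding E_def
proof (rule smooth_on_compose[OF open_D open_W])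
  show "smooth_on W (\<lambda>xz. fd mu xz (0, v))" by (rule smooth_on_fd[OF mu_smooth])
  show "smooth_on D (\<lambda>x. (x, x0))"
    by (rule smooth_on_Pair[OF open_D smooth_on_bounded_linear[OF bounded_linear_ident open_D] smooth_on_const])
qed (use right_W in auto)

text \<open>Associativity of the multiplication, differentiated in the third factor at the identity: left
  translation carries the frame to itself.\<close>

lemma E_left_translation:
  assumes xz: "(x, z) \<in> W"
  shows "fd mu (x, z) (0, E z v) = E (mu (x, z)) v"
proof -
  have z: "z \<in> D" using xz by auto
  define Q where "Q = {w. (z, w) \<in> W \<and> (x, mu (z, w)) \<in> W}"
  let ?W1 = "{w. (z, w) \<in> W}"
  have o1: "open ?W1" using open_vimage[OF open_W, of "\<lambda>w. (z, w)"] by (simp add: vimage_def continuous_on_Pair)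
  have "continuous_on ?W1 (\<lambda>w. (x, mu (z, w)))"
    by (intro continuous_on_Pair continuous_on_const continuous_on_compose2[OF smooth_on_continuous[OF mu_smooth]])
      (auto intro!: continuous_intros)
  then have "open (?W1 \<inter> (\<lambda>w. (x, mu (z, w))) -` W)" by (rule continuous_open_preimage[OF _ o1 open_W])
  then have oQ: "open Q" by (simp add: Q_def Int_def vimage_def)
  have Q0: "x0 \<in> Q" using right_W[OF z] mu_x0_right[OF z] xz by (simp add: Q_def)
  have der: "((\<lambda>w. mu (x, mu (z, w))) has_derivative (\<lambda>v. fd mu (x, z) (0, E z v))) (at x0)"
    using has_derivative_compose[OF E_has_derivative[OF z], of "\<lambda>u. mu (x, u)" "\<lambda>v. fd mu (x, z) (0, v)"]
      mu_has_derivative_right[OF xz] by (simp add: mu_x0_right[OF z])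
  have eq: "mu (x, mu (z, w)) = mu (mu (x, z), w)" if "w \<in> Q" for w
    using mu_assoc[OF xz] that by (simp add: Q_def)
  have "((\<lambda>w. mu (mu (x, z), w)) has_derivative (\<lambda>v. fd mu (x, z) (0, E z v))) (at x0)"
    by (rule has_derivative_transform_within_open[OF der oQ Q0 eq])
  from fun_cong[OF has_derivative_unique[OF this E_has_derivative[OF mu_in_D[OF xz]]]] show ?thesis .
qed

definition br where "br u v = fd (\<lambda>x. E x v) x0 u - fd (\<lambda>x. E x u) x0 v"

text \<open>Differentiating \<open>E_left_translation\<close> in \<open>z\<close> at the identity expresses
  the derivative of \<open>E v\<close> along \<open>E u\<close> by the Hessian \<open>H\<close> of a left translation and the derivative of \<open>E v\<close> at the
  identity. The Hessian is symmetric and cancels in the bracket.\<close>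

lemma E_bracket:
  assumes x: "x \<in> D"
  shows "fd (\<lambda>z. E z v) x (E x u) - fd (\<lambda>z. E z u) x (E x v) = E x (br u v)"
proof -
  let ?V = "{z. (x, z) \<in> W}"
  have oV: "open ?V" using open_vimage[OF open_W, of "\<lambda>w. (x, w)"] by (simp add: vimage_def continuous_on_Pair)
  have V0: "x0 \<in> ?V" using right_W[OF x] by simp
  have sm: "smooth_on ?V (\<lambda>z. mu (x, z))"
    by (rule smooth_on_compose[OF oV open_W _ smooth_on_Pair[OF oV smooth_on_const
          smooth_on_bounded_linear[OF bounded_linear_ident oV]] mu_smooth]) auto
  have fdV: "fd (\<lambda>z. mu (x, z)) z = (\<lambda>v. fd mu (x, z) (0, v))" if "z \<in> ?V" for z
    using that by (intro fd_eqI mu_has_derivative_right) simp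
  define H where "H u v = fd (\<lambda>z. fd mu (x, z) (0, v)) x0 u" for u v
  have H: "H u v = fd (\<lambda>z. fd (\<lambda>z. mu (x, z)) z v) x0 u" for u v
    unfolding H_def by (rule fun_cong[OF fd_cong_open[OF oV V0]]) (simp add: fdV)
  have Hsym: "H u v = H v u" for u v
    unfolding H using second_derivative_symmetric[OF oV V0 sm] .
  have dif: "(\<lambda>z. fd mu (x, z) (0, v)) differentiable (at x0)" for v
    using smooth_onD[OF smooth_on_fd[OF sm] V0] differentiable_cong_open[OF oV V0] fdV by (metis (no_types, lifting))
  have key: "fd (\<lambda>z. E z v) x (E x u) = H u v + E x (fd (\<lambda>z. E z v) x0 u)" for u v
  proof -
    have "((\<lambda>z. fd mu (x, z) (0, E z v)) has_derivative
        (\<lambda>h. fd (\<lambda>z. fd mu (x, z) (0, E x0 v)) x0 h + fd mu (x, x0) (0, fd (\<lambda>z. E z v) x0 h))) (at x0)"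
      by (rule has_derivative_apply_fd[where M="\<lambda>z w. fd mu (x, z) (0, w)", OF oV V0])
        (use mu_has_derivative_right has_derivative_linear dif fd_works[OF smooth_onD[OF E_smooth_D x0_D]] in blast)+
    then have "((\<lambda>z. E (mu (x, z)) v) has_derivative (\<lambda>h. H h v + E x (fd (\<lambda>z. E z v) x0 h))) (at x0)"
      unfolding E_at_x0 H_def[symmetric] E_def[symmetric]
      by (rule has_derivative_transform_within_open[OF _ oV V0]) (simp add: E_left_translation)
    moreover have "((\<lambda>z. E (mu (x, z)) v) has_derivative (\<lambda>h. fd (\<lambda>z. E z v) x (E x h))) (at x0)"
      using fd_compose[of "\<lambda>z. E z v" "\<lambda>z. mu (x, z)" x0, OF _ E_has_derivative[OF x]]
        smooth_onD[OF E_smooth_D x] by (simp add: mu_x0_right[OF x])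
    ultimately have "(\<lambda>h. H h v + E x (fd (\<lambda>z. E z v) x0 h)) = (\<lambda>h. fd (\<lambda>z. E z v) x (E x h))"
      by (rule has_derivative_unique)
    from fun_cong[OF this, of u] show ?thesis by simp
  qed
  show ?thesis by (simp add: key br_def linear_diff[OF E_lin[OF x]] Hsym[of u v])
qed

text \<open>A neighbourhood of the identity on which the frame is a basis.\<close>

definition S where "S = {x \<in> D. det (matrix (E x)) \<noteq> 0}"

lemma open_S: "open S"
proof -
  have "smooth_on D (\<lambda>x. det (matrix (E x)))"
    using smooth_on_vec_nth[OF open_D E_smooth_D] by (intro smooth_on_det open_D) (simp add: matrix_def)
  from continuous_open_preimage[OF smooth_on_continuous[OF this] open_D open_Compl[OF closed_singleton[of 0]]]
  show ?thesis by (simp add: S_def Int_def vimage_def)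
qed

sublocale lie_frame S x0 E br
proof (rule lie_frame.intro)
  show "open S" by (rule open_S)
  have "E x0 = id" by (auto simp: E_at_x0)
  then show "x0 \<in> S" using x0_D by (simp add: S_def matrix_id_mat_1)
  show "smooth_on S (\<lambda>x. E x v)" for v
    by (rule smooth_on_subset[OF E_smooth_D]) (auto simp: S_def)
  fix x assume "x \<in> S"
  then have x: "x \<in> D" "det (matrix (E x)) \<noteq> 0" by (auto simp: S_def)
  show "linear (E x)" by (rule E_lin[OF x(1)])
  have "\<forall>v. matrix (E x) *v v = 0 \<longrightarrow> v = 0"
    using x(2) by (simp add: det_nonzero_iff)
  then show "v = 0" if "E x v = 0" for v using that E_lin[OF x(1)] by (simp add: matrix_works)
  show "fd (\<lambda>z. E z v) x (E x u) - fd (\<lambda>z. E z u) x (E x v) = E x (br u v)" for u v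
    by (rule E_bracket[OF x(1)])
qed (rule E_at_x0)

end


context lie_group_chart
begin

lemma c_at: "g \<in> fst c \<Longrightarrow> c \<in> charts_at A g"
  using cA by (simp add: charts_at_def)

lemma left_invariant_field_eq:
  assumes g: "g \<in> fst c" and v: "v \<in> tangent_space A \<one>"
  shows "differential A A (\<lambda>h. g \<otimes> h) \<one> v = tangent_of_coords A c g (E (snd c g) (v c))"
proof
  fix d
  let ?x = "snd c g"
  have x: "?x \<in> D" using g by blast
  have g1: "g \<otimes> \<one> = g" using dom_carrier[OF g] by simp
  show "differential A A (\<lambda>h. g \<otimes> h) \<one> v d = tangent_of_coords A c g (E ?x (v c)) d"
  proof (cases "d \<in> charts_at A g")
    case True
    have oV: "open {z. (?x, z) \<in> W}"
      using open_vimage[OF open_W, of "\<lambda>w. (?x, w)"] by (simp add: vimage_def continuous_on_Pair)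
    have V0: "x0 \<in> {z. (?x, z) \<in> W}" using right_W[OF x] by simp
    have "((\<lambda>z. (snd d \<circ> chart_inv c) (mu (?x, z))) has_derivative
        (\<lambda>w. fd (snd d \<circ> chart_inv c) ?x (E ?x w))) (at x0)"
      using fd_compose[of "snd d \<circ> chart_inv c" "\<lambda>z. mu (?x, z)" x0, OF _ E_has_derivative[OF x]]
        transition_differentiable[OF c_at[OF g] True] by (simp add: mu_x0_right[OF x])
    then have der: "((snd d \<circ> (\<lambda>h. g \<otimes> h) \<circ> chart_inv c) has_derivative
        (\<lambda>w. fd (snd d \<circ> chart_inv c) ?x (E ?x w))) (at x0)"
    proof (rule has_derivative_transform_within_open[OF _ oV V0])
      fix z assume "z \<in> {z. (?x, z) \<in> W}"
      then show "(snd d \<circ> chart_inv c) (mu (?x, z)) = (snd d \<circ> (\<lambda>h. g \<otimes> h) \<circ> chart_inv c) z"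
        using inv_mu[of "(?x, z)"] g by (simp add: chart_inv_left[OF cA])
    qed
    then have "(snd d \<circ> (\<lambda>h. g \<otimes> h) \<circ> chart_inv c) differentiable (at x0)"
      unfolding differentiable_def by blast
    from differential_component[where f="\<lambda>h. g \<otimes> h", OF c1 v _ this] True fd_eqI[OF der]
    show ?thesis by (simp add: g1 tangent_of_coords_def)
  next
    case False
    then show ?thesis by (simp add: differential_def Let_def tangent_of_coords_def g1)
  qed
qed

lemma left_invariant_field_component:
  assumes g: "g \<in> fst c" and v: "v \<in> tangent_space A \<one>"
  shows "left_invariant_field G A v g c = E (snd c g) (v c)"
  unfolding left_invariant_field_def left_invariant_field_eq[OF assms]
  by (rule tangent_of_coords_component[OF c_at[OF g]])

lemma lie_bracket_component:
  assumes u: "u \<in> tangent_space A \<one>" and v: "v \<in> tangent_space A \<one>"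
  shows "lie_bracket G A u v c = br (u c) (v c)"
proof -
  have f: "fd (\<lambda>x. left_invariant_field G A w (chart_inv c x) c) x0 = fd (\<lambda>x. E x (w c)) x0"
    if "w \<in> tangent_space A \<one>" for w
    by (rule fd_cong_open[OF open_D x0_D])
      (simp add: left_invariant_field_component[OF chart_inv_in that] chart_inv_right)
  show ?thesis
    using c1 u v
    by (simp add: lie_bracket_def field_bracket_def f left_invariant_field_component[OF one_c] E_at_x0 br_def)
qed

end

text \<open>The coordinate expressions of a left-invariant field in two charts are related by the derivative of
  the transition map \<open>\<tau>\<close>. Differentiating this relation, the Hessian of \<open>\<tau>\<close> cancels in the bracket; this is what
  makes the bracket a tangent vector.\<close>

lemma lie_bracket_change_chart:
  assumes "lie_group_chart G X A c" "lie_group_chart G X A d"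
    and u: "u \<in> tangent_space A \<one>\<^bsub>G\<^esub>" and v: "v \<in> tangent_space A \<one>\<^bsub>G\<^esub>"
  shows "lie_bracket G A u v d
    = fd (snd d \<circ> chart_inv c) (snd c \<one>\<^bsub>G\<^esub>) (lie_bracket G A u v c)"
proof -
  interpret c: lie_group_chart G X A c by fact
  interpret d: lie_group_chart G X A d by fact
  define \<tau> where "\<tau> = snd d \<circ> chart_inv c"
  define O' where "O' = snd c ` (fst c \<inter> fst d)"
  have oO: "open O'" unfolding O'_def by (rule c.open_overlap[OF c.cA d.cA])
  have O0: "c.x0 \<in> O'" unfolding O'_def using c.one_c d.one_c by blast
  have \<tau>0: "\<tau> c.x0 = d.x0" by (simp add: \<tau>_def c.inv_x0)
  have sm: "smooth_on O' \<tau>" unfolding O'_def \<tau>_def by (rule c.transition_smooth[OF c.cA d.cA])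
  have comp: "w d = fd \<tau> c.x0 (w c)" if "w \<in> tangent_space A \<one>\<^bsub>G\<^esub>" for w
    using that c.c1 d.c1 unfolding tangent_space_def \<tau>_def by blast
  have rel: "d.E (\<tau> x) (w d) = fd \<tau> x (c.E x (w c))"
    if x: "x \<in> O'" and w: "w \<in> tangent_space A \<one>\<^bsub>G\<^esub>" for x w
  proof -
    obtain g where g: "g \<in> fst c" "g \<in> fst d" "x = snd c g" using x unfolding O'_def by blast
    have \<tau>x: "\<tau> x = snd d g" using g by (simp add: \<tau>_def c.chart_inv_left[OF c.cA])
    have "d.E (snd d g) (w d) = tangent_of_coords A d g (d.E (snd d g) (w d)) d"
      by (rule c.tangent_of_coords_component[OF d.c_at[OF g(2)], symmetric])
    also have "\<dots> = tangent_of_coords A c g (c.E (snd c g) (w c)) d"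
      using c.left_invariant_field_eq[OF g(1) w] d.left_invariant_field_eq[OF g(2) w] by simp
    also have "\<dots> = fd \<tau> x (c.E x (w c))"
      using d.c_at[OF g(2)] by (simp add: tangent_of_coords_def \<tau>_def g(3))
    finally show ?thesis by (simp add: \<tau>x)
  qed
  have dt: "(\<lambda>x. fd \<tau> x w) differentiable (at c.x0)" for w
    by (rule smooth_onD[OF smooth_on_fd[OF sm] O0])
  have key: "fd (\<lambda>x. d.E x (w d)) d.x0 (fd \<tau> c.x0 a)
      = fd (\<lambda>x. fd \<tau> x (w c)) c.x0 a + fd \<tau> c.x0 (fd (\<lambda>x. c.E x (w c)) c.x0 a)"
    if w: "w \<in> tangent_space A \<one>\<^bsub>G\<^esub>" for w a
  proof -
    have "((\<lambda>x. fd \<tau> x (c.E x (w c))) has_derivative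
        (\<lambda>h. fd (\<lambda>x. fd \<tau> x (c.E c.x0 (w c))) c.x0 h + fd \<tau> c.x0 (fd (\<lambda>x. c.E x (w c)) c.x0 h))) (at c.x0)"
      by (rule has_derivative_apply_fd[where M="\<lambda>x. fd \<tau> x", OF oO O0 fd_linear[OF smooth_onD[OF sm]] dt
            fd_works[OF smooth_onD[OF c.E_smooth_D c.x0_D]]])
    then have 1: "((\<lambda>x. d.E (\<tau> x) (w d)) has_derivative
        (\<lambda>h. fd (\<lambda>x. fd \<tau> x (w c)) c.x0 h + fd \<tau> c.x0 (fd (\<lambda>x. c.E x (w c)) c.x0 h))) (at c.x0)"
      unfolding c.E_at_x0
      by (rule has_derivative_transform_within_open[OF _ oO O0]) (simp add: rel w)
    have "((\<lambda>x. d.E (\<tau> x) (w d)) has_derivative (\<lambda>h. fd (\<lambda>x. d.E x (w d)) d.x0 (fd \<tau> c.x0 h))) (at c.x0)"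
      using fd_compose[of "\<lambda>x. d.E x (w d)" \<tau> c.x0, unfolded \<tau>0,
          OF smooth_onD[OF d.E_smooth_D d.x0_D] fd_works[OF smooth_onD[OF sm O0]]] .
    from fun_cong[OF has_derivative_unique[OF this 1], of a] show ?thesis .
  qed
  have "fd (\<lambda>x. fd \<tau> x (v c)) c.x0 (u c) = fd (\<lambda>x. fd \<tau> x (u c)) c.x0 (v c)"
    by (rule second_derivative_symmetric[OF oO O0 sm])
  then have "d.br (u d) (v d) = fd \<tau> c.x0 (c.br (u c) (v c))"
    by (simp add: d.br_def c.br_def comp[OF u] comp[OF v] key[OF v, unfolded comp[OF v]]
        key[OF u, unfolded comp[OF u]] linear_diff[OF fd_linear[OF smooth_onD[OF sm O0]]])
  then show ?thesis
    using c.lie_bracket_component[OF u v] d.lie_bracket_component[OF u v] by (simp add: \<tau>_def)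
qed

context lie_group_chart
begin

lemma lie_bracket_in_tangent_space:
  assumes u: "u \<in> tangent_space A \<one>" and v: "v \<in> tangent_space A \<one>"
  shows "lie_bracket G A u v \<in> tangent_space A \<one>"
proof -
  have chart: "lie_group_chart G X A d" if "d \<in> charts_at A \<one>" for d
    using that lie by unfold_locales
  have "lie_bracket G A u v e = fd (snd e \<circ> chart_inv d) (snd d \<one>) (lie_bracket G A u v d)"
    if "d \<in> charts_at A \<one>" "e \<in> charts_at A \<one>" for d e
    by (rule lie_bracket_change_chart[OF chart chart u v]) fact+
  moreover have "lie_bracket G A u v d = 0" if "d \<notin> charts_at A \<one>" for d
    using that by (simp add: lie_bracket_def field_bracket_def)
  ultimately show ?thesis unfolding tangent_space_def by blast
qed

end


section \<open>Left-invariant Finsler metrics in a chart\<close>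

locale finsler_lie_chart = lie_group_chart G X A c
  for G :: "('m, 'b) monoid_scheme" (structure)
    and X and A :: "('m, real^'n) chart set" and c +
  fixes F :: "'m \<Rightarrow> ('m, real^'n) tvec \<Rightarrow> real"
  assumes finsler: "finsler_metric A F" and invariant: "left_invariant G A F"
begin

abbreviation T :: "real^'n \<Rightarrow> ('m, real^'n) tvec" where
  "T \<equiv> tangent_of_coords A c \<one>"

lemma T_in: "T y \<in> tangent_space A \<one>"
  by (rule tangent_of_coords_in_tangent_space[OF c1])

lemma T_component: "T y c = y"
  by (rule tangent_of_coords_component[OF c1])

lemma F_one_T: "F \<one> (T y) = local_expr A F c x0 y"
  by (simp add: local_expr_def inv_x0)

lemma local_expr_E:
  assumes x: "x \<in> D"
  shows "local_expr A F c x (E x y) = local_expr A F c x0 y"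
proof -
  let ?g = "chart_inv c x"
  have g: "?g \<in> fst c" "snd c ?g = x" using x by (auto simp: chart_inv_in chart_inv_right)
  have gc: "?g \<in> carrier G" by (rule inv_carrier[OF x])
  have "F (?g \<otimes> \<one>) (differential A A (\<lambda>k. ?g \<otimes> k) \<one> (T y)) = F \<one> (T y)"
    using invariant gc T_in unfolding left_invariant_def by blast
  then show ?thesis
    using gc by (simp add: left_invariant_field_eq[OF g(1) T_in] g(2) T_component local_expr_def inv_x0)
qed

sublocale finsler_frame S x0 E br "local_expr A F c x0" "local_expr A F c"
proof (intro finsler_frame.intro finsler_frame_axioms.intro minkowski.intro)
  show "lie_frame S x0 E br" by (rule lie_frame_axioms)
  show "minkowski_norm (local_expr A F c x0)"
    using finsler cA x0_D unfolding finsler_metric_def by blast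
  fix x y assume x: "x \<in> S"
  then have "x \<in> D" by (simp add: S_def)
  from local_expr_E[OF this, of "B x y"] show "local_expr A F c x y = local_expr A F c x0 (B x y)"
    by (simp add: E_B[OF x])
qed

lemma fundamental_tensor_T: "fundamental_tensor (F \<one>) (T y) (T u) (T w) = g y u w"
  unfolding fundamental_tensor_def
  by (simp add: F_one_T flip: tangent_of_coords_linear[OF c1])

lemma lie_bracket_T: "lie_bracket G A (T u) (T v) = T (br u v)"
  using tangent_of_coords_of_component[OF c1 lie_bracket_in_tangent_space[OF T_in T_in]]
  by (simp add: lie_bracket_component[OF T_in T_in] T_component)

lemma cyclic_in_chart:
  assumes "cyclic_metric G A F" and y: "y \<noteq> 0"
  shows "g y (br x y) z + g y (br y z) x + g y (br z x) y = 0"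
proof -
  have "T y \<noteq> 0" using T_component[of y] y by (metis zero_fun_apply)
  then have "fundamental_tensor (F \<one>) (T y) (lie_bracket G A (T x) (T y)) (T z)
      + fundamental_tensor (F \<one>) (T y) (lie_bracket G A (T y) (T z)) (T x)
      + fundamental_tensor (F \<one>) (T y) (lie_bracket G A (T z) (T x)) (T y) = 0"
    using assms(1) T_in unfolding cyclic_metric_def lie_algebra_def by blast
  then show ?thesis by (simp add: lie_bracket_T fundamental_tensor_T)
qed

lemma cauchy_schwarz_strict:
  assumes y: "y \<noteq> 0" and ind: "\<And>r. u \<noteq> r *\<^sub>R y"
  shows "g y y y * g y u u - (g y y u)\<^sup>2 > 0"
proof -
  define a where "a = g y y y"
  define b where "b = g y y u"
  have a: "a > 0" using g_pos[OF y y] by (simp add: a_def)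
  \<comment> \<open>A multiple of the component of \<open>u\<close> orthogonal to \<open>y\<close>.\<close>
  define w where "w = a *\<^sub>R u - b *\<^sub>R y"
  have "w \<noteq> 0"
  proof
    assume "w = 0"
    then have "(1/a) *\<^sub>R (a *\<^sub>R u) = (1/a) *\<^sub>R (b *\<^sub>R y)" by (simp add: w_def)
    then have "u = (b / a) *\<^sub>R y" using a by simp
    then show False using ind by blast
  qed
  then have "0 < g y w w" by (rule g_pos[OF y])
  also have "g y w w = a * (a * g y u u - b\<^sup>2)"
    unfolding w_def linear_diff[OF g_linear_left[OF y]] linear_diff[OF g_linear_right[OF y]]
      linear_cmul[OF g_linear_left[OF y]] linear_cmul[OF g_linear_right[OF y]]
    using g_sym[OF y, of u y] by (simp add: power2_eq_square algebra_simps flip: a_def b_def)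
  finally show ?thesis using a by (simp add: a_def b_def zero_less_mult_iff)
qed

text \<open>The denominator of the flag curvature is positive by the strict Cauchy--Schwarz inequality, so
  its numerator vanishes.\<close>

lemma flat_in_chart:
  assumes flat: "constant_flag_curvature X A F 0"
    and y: "y \<noteq> 0" and ind: "\<And>r. u \<noteq> r *\<^sub>R y"
  shows "g y (riemann_coeff (local_expr A F c) x0 y *v u) u = 0"
proof -
  have uy: "u \<noteq> y" using ind[of 1] by simp
  have "T y \<noteq> T u" using uy T_component by metis
  moreover have "independent {T y, T u}"
  proof
    assume "dependent {T y, T u}"
    then obtain k where k: "k (T y) \<noteq> 0 \<or> k (T u) \<noteq> (0::real)" "(\<Sum>v\<in>{T y, T u}. k v *\<^sub>R v) = 0"
      using dependent_finite[of "{T y, T u}"] by auto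
    from k(2) have "k (T y) *\<^sub>R T y + k (T u) *\<^sub>R T u = 0" using \<open>T y \<noteq> T u\<close> by simp
    from fun_cong[OF this, of c] have e: "k (T y) *\<^sub>R y + k (T u) *\<^sub>R u = 0"
      by (simp add: scaleR_fun_def T_component)
    show False
    proof (cases "k (T u) = 0")
      case True
      then show False using e k(1) y by simp
    next
      case False
      have "k (T u) *\<^sub>R u = - k (T y) *\<^sub>R y" using e by (simp add: add_eq_0_iff)
      then have "(1 / k (T u)) *\<^sub>R k (T u) *\<^sub>R u = (1 / k (T u)) *\<^sub>R - k (T y) *\<^sub>R y" by simp
      then have "u = (- k (T y) / k (T u)) *\<^sub>R y" using False by simp
      then show False using ind by blast
    qed
  qed
  ultimately have "flag_curvature A F c \<one> (T y) (T u) = 0"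
    using flat c1 T_in carrier_eq unfolding constant_flag_curvature_def by simp
  then show ?thesis
    using cauchy_schwarz_strict[OF y ind]
    by (simp add: flag_curvature_def local_flag_curvature_def T_component)
qed

text \<open>If \<open>u\<close> is a multiple of \<open>y\<close>, there is no flag; but then \<open>ad y\<close> and \<open>d\<eta>(y)\<close> both
  annihilate \<open>u\<close>.\<close>

lemma curvature_in_chart:
  assumes flat: "constant_flag_curvature X A F 0" and y: "y \<noteq> 0" and geo: "\<And>u. g y y (br u y) = 0"
  shows "\<exists>D. linear D \<and> (\<forall>u w. g y (D u) w = g y y (br w u) - g y u (br y w)) \<and>
    (\<forall>u. g y (D (br y u) - (1/4) *\<^sub>R (br y (br y u + D u) + D (br y u + D u))) u = 0)"
proof (intro exI conjI allI)
  have \<eta>: "\<eta> y = 0" using \<eta>_eq_0_iff[OF y] geo by blast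
  show lin: "linear (fd \<eta> y)" by (rule fd_\<eta>_linear[OF y])
  show D: "g y (fd \<eta> y u) w = g y y (br w u) - g y u (br y w)" for u w
    by (rule fd_\<eta>[OF y \<eta>])
  show "g y (fd \<eta> y (br y u) - (1/4) *\<^sub>R (br y (br y u + fd \<eta> y u) + fd \<eta> y (br y u + fd \<eta> y u))) u = 0" for u
  proof (cases "\<exists>r. u = r *\<^sub>R y")
    case True
    then obtain r where r: "u = r *\<^sub>R y" by blast
    have "g y (fd \<eta> y y) w = 0" for w using D[of y w] br_skew[of y w] geo[of w] linear_neg[OF g_linear_right[OF y]] by simp
    then have "fd \<eta> y y = 0" by (rule g_nondegenerate[OF y])
    then have "fd \<eta> y u = 0" "br y u = 0"
      using linear_cmul[OF lin] linear_cmul[OF br_linear_right] by (simp_all add: r br_self)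
    then show ?thesis
      using linear_0[OF lin] linear_0[OF br_linear_right] linear_0[OF g_linear_left[OF y]] by simp
  next
    case False
    then show ?thesis
      using flat_in_chart[OF flat y, of u] riemann_coeff_geodesic_vector[OF y \<eta>, of u] by simp
  qed
qed

end


section \<open>Flat cyclic left-invariant Finsler metrics\<close>

theorem theorem1p3:
  fixes G :: "('m, 'b) monoid_scheme"
    and X :: "'m topology"
    and A :: "('m, real^'n) chart set"
    and F :: "'m \<Rightarrow> ('m, real^'n) tvec \<Rightarrow> real"
  assumes "lie_group G X A"
    and "finsler_metric A F"
    and "left_invariant G A F"
    and "cyclic_metric G A F"
    and "constant_flag_curvature X A F 0"
  shows "abelian_lie_algebra G A"
proof -
  have "lie_bracket G A u v = 0" if u: "u \<in> lie_algebra G A" and v: "v \<in> lie_algebra G A" for u v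
  proof
    fix c
    show "lie_bracket G A u v c = 0 c"
    proof (cases "c \<in> charts_at A \<one>\<^bsub>G\<^esub>")
      case True
      interpret finsler_lie_chart G X A c F
        using assms True
        by (intro finsler_lie_chart.intro lie_group_chart.intro finsler_lie_chart_axioms.intro)
      have "real_lie_algebra br"
        by (rule real_lie_algebra.intro[OF br_bilinear br_skew jacobi])
      then have "br (u c) (v c) = 0"
        by (rule cyclic_flat_imp_abelian[OF _ minkowski_norm cyclic_in_chart[OF assms(4)]
              curvature_in_chart[OF assms(5)]])
      then show ?thesis
        using u v by (simp add: lie_algebra_def lie_bracket_component)
    next
      case False
      then show ?thesis by (simp add: lie_bracket_def field_bracket_def)
    qed
  qed
  then show ?thesis unfolding abelian_lie_algebra_def by blast
qed

end
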